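(* Let $R$ be a commutative artinian ring and let $\mathcal{C}$ be a Hom-finite $R$-linear category (not assumed to be additive). Then there is a unique functor (up to isomorphism) $S\colon\mathcal{C}_r\to\mathcal{C}_l$ such that for each $X\in\mathcal{C}_r$ and $Y\in\mathcal{C}$ there is an $R$-linear isomorphism $$\phi_{X,Y}\colon D\,\mathrm{Hom}_{\mathcal{C}}(X,Y)\simeq\mathrm{Hom}_{\mathcal{C}}(Y,S(X)),$$ natural in $X$ and $Y$. Moreover, the functor $S$ is an $R$-linear equivalence between $\mathcal{C}_r$ and $\mathcal{C}_l$.
   Context: An $R$-linear category is Hom-finite if all its Hom spaces are finitely generated $R$-modules. $D=\mathrm{Hom}_R(-,E)$ is the Matlis duality on finitely generated $R$-modules, where $E$ is the minimal injective cogenerator of $R$. Write $D(X,-)=D\,\mathrm{Hom}_{\mathcal{C}}(X,-)$ and $D(-,X)=D\,\mathrm{Hom}_{\mathcal{C}}(-,X)$. The full subcategories $\mathcal{C}_r,\mathcal{C}_l\subseteq\mathcal{C}$ are $\mathcal{C}_r=\{X\in\mathcal{C}\mid D(X,-)\text{ is representable}\}$, that is, $D(X,-)\simeq\mathrm{Hom}_{\mathcal{C}}(-,Z)$ as $R$-linear functors for some $Z\in\mathcal{C}$, and $\mathcal{C}_l=\{X\in\mathcal{C}\mid D(-,X)\text{ is representable}\}$, that is, $D(-,X)\simeq\mathrm{Hom}_{\mathcal{C}}(Z,-)$ as $R$-linear functors for some $Z\in\mathcal{C}$. *)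

theory Defs
  imports "HOL-Algebra.Module" "HOL-Algebra.Ideal"
begin

section \<open>Modules\<close>

text \<open>Linear maps are not required to be extensional; only their values on the carrier matter.\<close>

definition mod_hom ::
    "('r, 'x) ring_scheme \<Rightarrow> ('r, 'm, 'y) module_scheme \<Rightarrow> ('r, 'n, 'z) module_scheme \<Rightarrow> ('m \<Rightarrow> 'n) set"
  where "mod_hom R M N = {f \<in> carrier M \<rightarrow> carrier N.
    (\<forall>x\<in>carrier M. \<forall>y\<in>carrier M. f (x \<oplus>\<^bsub>M\<^esub> y) = f x \<oplus>\<^bsub>N\<^esub> f y) \<and>
    (\<forall>a\<in>carrier R. \<forall>x\<in>carrier M. f (a \<odot>\<^bsub>M\<^esub> x) = a \<odot>\<^bsub>N\<^esub> f x)}"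

definition mod_iso ::
    "('r, 'x) ring_scheme \<Rightarrow> ('r, 'm, 'y) module_scheme \<Rightarrow> ('r, 'n, 'z) module_scheme \<Rightarrow> ('m \<Rightarrow> 'n) set"
  where "mod_iso R M N = {f \<in> mod_hom R M N. bij_betw f (carrier M) (carrier N)}"

text \<open>The module of linear maps. Its elements are the extensional linear maps, so that distinct
  elements differ on the carrier. The fields \<open>mult\<close> and \<open>one\<close>, which the record type
  inherits from rings, are irrelevant for modules.\<close>

definition hom_module ::
    "('r, 'x) ring_scheme \<Rightarrow> ('r, 'm, 'y) module_scheme \<Rightarrow> ('r, 'n, 'z) module_scheme \<Rightarrow> ('r, 'm \<Rightarrow> 'n) module"
  where "hom_module R M N =
    \<lparr>carrier = mod_hom R M N \<inter> extensional (carrier M),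
     monoid.mult = undefined, one = undefined,
     zero = (\<lambda>x\<in>carrier M. \<zero>\<^bsub>N\<^esub>),
     add = (\<lambda>f g. \<lambda>x\<in>carrier M. f x \<oplus>\<^bsub>N\<^esub> g x),
     smult = (\<lambda>a f. \<lambda>x\<in>carrier M. a \<odot>\<^bsub>N\<^esub> f x)\<rparr>"

lemma hom_module_is_module:
  fixes R :: "('r, 'x) ring_scheme" and M :: "('r, 'm, 'y) module_scheme"
    and N :: "('r, 'n, 'z) module_scheme"
  assumes "module R M" and "module R N"
  shows "module R (hom_module R M N)"
proof -
  interpret M: module R M by fact
  interpret N: module R N by fact
  have app: "f x \<in> carrier N" if "f \<in> carrier (hom_module R M N)" "x \<in> carrier M" for f x
    using that by (auto simp: hom_module_def mod_hom_def)
  have ext: "f = g"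
    if "f \<in> carrier (hom_module R M N)" "g \<in> carrier (hom_module R M N)"
      "\<And>x. x \<in> carrier M \<Longrightarrow> f x = g x" for f g
    using that by (auto simp: hom_module_def intro: extensionalityI)
  have add_app: "(f \<oplus>\<^bsub>hom_module R M N\<^esub> g) x = f x \<oplus>\<^bsub>N\<^esub> g x" if "x \<in> carrier M" for f g x
    using that by (simp add: hom_module_def)
  have sm_app: "(a \<odot>\<^bsub>hom_module R M N\<^esub> f) x = a \<odot>\<^bsub>N\<^esub> f x" if "x \<in> carrier M" for a f x
    using that by (simp add: hom_module_def)
  have zero_app: "\<zero>\<^bsub>hom_module R M N\<^esub> x = \<zero>\<^bsub>N\<^esub>" if "x \<in> carrier M" for x
    using that by (simp add: hom_module_def)
  have add_cl: "f \<oplus>\<^bsub>hom_module R M N\<^esub> g \<in> carrier (hom_module R M N)"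
    if "f \<in> carrier (hom_module R M N)" "g \<in> carrier (hom_module R M N)" for f g
    using that by (auto simp: hom_module_def mod_hom_def Pi_iff N.M.a_ac N.smult_r_distr)
  have sm_cl: "a \<odot>\<^bsub>hom_module R M N\<^esub> f \<in> carrier (hom_module R M N)"
    if "a \<in> carrier R" "f \<in> carrier (hom_module R M N)" for a f
    using that
    by (auto simp: hom_module_def mod_hom_def Pi_iff N.smult_r_distr M.R.m_comm
        simp flip: N.smult_assoc1)
  have zero_cl: "\<zero>\<^bsub>hom_module R M N\<^esub> \<in> carrier (hom_module R M N)"
    by (auto simp: hom_module_def mod_hom_def)
  note cl = add_cl sm_cl zero_cl
  show ?thesis
  proof (rule moduleI)
    show "abelian_group (hom_module R M N)"
    proof (rule abelian_groupI)
      fix f assume f: "f \<in> carrier (hom_module R M N)"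
      show "\<exists>g\<in>carrier (hom_module R M N).
          g \<oplus>\<^bsub>hom_module R M N\<^esub> f = \<zero>\<^bsub>hom_module R M N\<^esub>"
        by (rule bexI[of _ "(\<ominus>\<^bsub>R\<^esub> \<one>\<^bsub>R\<^esub>) \<odot>\<^bsub>hom_module R M N\<^esub> f"])
          (use f in \<open>auto intro!: ext cl
            simp: add_app sm_app zero_app app N.smult_l_minus N.M.l_neg\<close>)
    qed (auto intro!: ext cl simp: add_app zero_app app N.M.a_ac)
  qed (auto intro!: ext cl simp: add_app sm_app app N.smult_l_distr N.smult_r_distr
      N.smult_assoc1 M.R.is_cring)
qed

definition finitely_generated_module :: "('r, 'x) ring_scheme \<Rightarrow> ('r, 'm, 'y) module_scheme \<Rightarrow> bool"
  where "finitely_generated_module R M \<longleftrightarrow> module R M \<and>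
    (\<exists>A. finite A \<and> A \<subseteq> carrier M \<and>
      (\<forall>x\<in>carrier M. \<exists>c\<in>A \<rightarrow> carrier R. x = (\<Oplus>\<^bsub>M\<^esub>a\<in>A. c a \<odot>\<^bsub>M\<^esub> a)))"

locale artinian_cring = cring +
  assumes ideal_dcc:
    "\<And>I :: nat \<Rightarrow> 'a set. (\<And>n. ideal (I n) R) \<Longrightarrow> (\<And>n. I (Suc n) \<subseteq> I n)
      \<Longrightarrow> \<exists>n. \<forall>m\<ge>n. I m = I n"


section \<open>The minimal injective cogenerator and Matlis duality\<close>

text \<open>A definition cannot quantify over all types, so the test modules below have carriers of
  type \<^typ>\<open>'r set\<close>. That type contains a copy of every cyclic \<^term>\<open>R\<close>-module, hence no
  generality is lost: the lemmas \<open>injective_module_extend\<close> and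
  \<open>injective_cogenerator_separate\<close> below give the properties for test modules of
  arbitrary types.\<close>

definition injective_module :: "('r, 'x) ring_scheme \<Rightarrow> ('r, 'e, 'y) module_scheme \<Rightarrow> bool"
  where "injective_module R E \<longleftrightarrow> module R E \<and>
    (\<forall>(M :: ('r, 'r set) module) (N :: ('r, 'r set) module) i f.
      module R M \<and> module R N \<and> i \<in> mod_hom R M N \<and> inj_on i (carrier M) \<and> f \<in> mod_hom R M E
      \<longrightarrow> (\<exists>g\<in>mod_hom R N E. \<forall>x\<in>carrier M. g (i x) = f x))"

definition cogenerator_module :: "('r, 'x) ring_scheme \<Rightarrow> ('r, 'e, 'y) module_scheme \<Rightarrow> bool"
  where "cogenerator_module R E \<longleftrightarrow> module R E \<and>
    (\<forall>(M :: ('r, 'r set) module) x.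
      module R M \<and> x \<in> carrier M \<and> x \<noteq> \<zero>\<^bsub>M\<^esub> \<longrightarrow> (\<exists>f\<in>mod_hom R M E. f x \<noteq> \<zero>\<^bsub>E\<^esub>))"

definition injective_cogenerator :: "('r, 'x) ring_scheme \<Rightarrow> ('r, 'e, 'y) module_scheme \<Rightarrow> bool"
  where "injective_cogenerator R E \<longleftrightarrow> injective_module R E \<and> cogenerator_module R E"


subsection \<open>Test modules of arbitrary types\<close>

text \<open>The module structure on the image of \<open>M\<close> under an injection.\<close>

definition transport_module ::
    "('m \<Rightarrow> 'n) \<Rightarrow> ('r, 'm, 'y) module_scheme \<Rightarrow> ('r, 'n) module"
  where "transport_module j M =
    \<lparr>carrier = j ` carrier M,
     monoid.mult = undefined, one = undefined,
     zero = j \<zero>\<^bsub>M\<^esub>,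
     add = (\<lambda>u v. j (inv_into (carrier M) j u \<oplus>\<^bsub>M\<^esub> inv_into (carrier M) j v)),
     smult = (\<lambda>a u. j (a \<odot>\<^bsub>M\<^esub> inv_into (carrier M) j u))\<rparr>"

lemma transport_module:
  assumes "module R M" and "inj_on j (carrier M)"
  shows "module R (transport_module j M)"
    and "j \<in> mod_hom R M (transport_module j M)"
    and "inv_into (carrier M) j \<in> mod_hom R (transport_module j M) M"
proof -
  interpret module R M by fact
  have inv: "inv_into (carrier M) j (j x) = x" if "x \<in> carrier M" for x
    using assms(2) that by simp
  show "module R (transport_module j M)"
  proof (rule moduleI)
    show "abelian_group (transport_module j M)"
    proof (rule abelian_groupI)
      fix u assume "u \<in> carrier (transport_module j M)"
      then obtain x where x: "x \<in> carrier M" "u = j x" by (auto simp: transport_module_def)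
      show "\<exists>v\<in>carrier (transport_module j M).
          v \<oplus>\<^bsub>transport_module j M\<^esub> u = \<zero>\<^bsub>transport_module j M\<^esub>"
        by (rule bexI[of _ "j (\<ominus>\<^bsub>M\<^esub> x)"]) (use x in \<open>auto simp: transport_module_def inv M.l_neg\<close>)
    qed (auto simp: transport_module_def inv M.a_ac)
  qed (auto simp: transport_module_def inv smult_l_distr smult_r_distr smult_assoc1 R.cring_axioms)
  show "j \<in> mod_hom R M (transport_module j M)"
    by (auto simp: mod_hom_def transport_module_def inv)
  show "inv_into (carrier M) j \<in> mod_hom R (transport_module j M) M"
    by (auto simp: mod_hom_def transport_module_def inv)
qed

lemma mod_hom_comp:
  assumes "f \<in> mod_hom R M N" and "g \<in> mod_hom R N P"
  shows "(\<lambda>x. g (f x)) \<in> mod_hom R M P"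
  using assms unfolding mod_hom_def by (auto simp: Pi_iff)

lemma injective_module_extend_small:
  fixes j :: "'n \<Rightarrow> 'r set" and R :: "('r, 'x) ring_scheme"
    and M :: "('r, 'm, 'z) module_scheme" and N :: "('r, 'n, 'w) module_scheme"
  assumes "injective_module R E" and "module R M" and "module R N"
    and i: "i \<in> mod_hom R M N" "inj_on i (carrier M)" and f: "f \<in> mod_hom R M E"
    and j: "inj_on j (carrier N)"
  shows "\<exists>g\<in>mod_hom R N E. \<forall>x\<in>carrier M. g (i x) = f x"
proof -
  have iN: "i ` carrier M \<subseteq> carrier N" using i(1) by (auto simp: mod_hom_def)
  have ji: "inj_on (j \<circ> i) (carrier M)"
    using i(2) j iN by (meson comp_inj_on inj_on_subset)
  let ?M = "transport_module (j \<circ> i) M" and ?N = "transport_module j N"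
  let ?p = "inv_into (carrier M) (j \<circ> i)"
  note TM = transport_module[OF \<open>module R M\<close> ji] and TN = transport_module[OF \<open>module R N\<close> j]
  have p: "?p (j (i x)) = x" if "x \<in> carrier M" for x
    using inv_into_f_f[OF ji that] by simp
  have incl: "(\<lambda>u. j (i (?p u))) \<in> mod_hom R ?M ?N"
    using mod_hom_comp[OF mod_hom_comp[OF TM(3) i(1)] TN(2)] .
  have "inj_on (\<lambda>u. j (i (?p u))) (carrier ?M)"
    by (auto simp: transport_module_def p intro!: inj_onI)
  then obtain g where g: "g \<in> mod_hom R ?N E" "\<forall>u\<in>carrier ?M. g (j (i (?p u))) = f (?p u)"
    using assms(1)[unfolded injective_module_def, THEN conjunct2, THEN spec[of _ ?M],
        THEN spec[of _ ?N], THEN spec[of _ "\<lambda>u. j (i (?p u))"], THEN spec[of _ "\<lambda>u. f (?p u)"]]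
      TM(1) TN(1) incl mod_hom_comp[OF TM(3) f] by blast
  show ?thesis
  proof (intro bexI[of _ "\<lambda>y. g (j y)"] ballI)
    show "(\<lambda>y. g (j y)) \<in> mod_hom R N E" using mod_hom_comp[OF TN(2) g(1)] .
    fix x assume x: "x \<in> carrier M"
    then have "j (i x) \<in> carrier ?M" by (simp add: transport_module_def)
    from bspec[OF g(2) this] show "g (j (i x)) = f x" by (simp only: p[OF x])
  qed
qed

lemma Baer_extend:
  assumes "injective_module R E" and "ideal I R" and "cring R"
    and h: "h \<in> I \<rightarrow> carrier E"
      "\<And>a b. \<lbrakk>a \<in> I; b \<in> I\<rbrakk> \<Longrightarrow> h (a \<oplus>\<^bsub>R\<^esub> b) = h a \<oplus>\<^bsub>E\<^esub> h b"
      "\<And>a b. \<lbrakk>a \<in> carrier R; b \<in> I\<rbrakk> \<Longrightarrow> h (a \<otimes>\<^bsub>R\<^esub> b) = a \<odot>\<^bsub>E\<^esub> h b"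
  obtains e where "e \<in> carrier E" "\<And>a. a \<in> I \<Longrightarrow> h a = a \<odot>\<^bsub>E\<^esub> e"
proof -
  interpret cring R by fact
  interpret I: ideal I R by fact
  define N where "N = \<lparr>carrier = carrier R, monoid.mult = mult R, one = one R, zero = zero R,
    add = add R, smult = mult R\<rparr>"
  have N: "module R N"
  proof (rule moduleI)
    show "abelian_group N"
    proof (rule abelian_groupI)
      fix x assume "x \<in> carrier N"
      then show "\<exists>y\<in>carrier N. y \<oplus>\<^bsub>N\<^esub> x = \<zero>\<^bsub>N\<^esub>"
        by (intro bexI[of _ "\<ominus>\<^bsub>R\<^esub> x"]) (auto simp: N_def l_neg)
    qed (auto simp: N_def a_ac)
  qed (auto simp: N_def l_distr r_distr m_assoc is_cring)
  interpret N: module R N by fact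
  have "submodule I R N"
  proof (rule N.submoduleI)
    have "\<ominus>\<^bsub>N\<^esub> a = \<ominus>\<^bsub>R\<^esub> a" for a
      by (simp add: a_inv_def N_def m_inv_def)
    then show "\<ominus>\<^bsub>N\<^esub> a \<in> I" if "a \<in> I" for a using that by simp
  qed (auto simp: N_def I.I_l_closed I.Icarr)
  then have M: "module R (N\<lparr>carrier := I\<rparr>)"
    using submodule.submodule_is_module N by blast
  have "\<exists>g\<in>mod_hom R N E. \<forall>x\<in>carrier (N\<lparr>carrier := I\<rparr>). g x = h x"
    by (rule injective_module_extend_small[OF assms(1) M N, where j = "\<lambda>x. {x}"])
      (use h in \<open>auto simp: mod_hom_def N_def I.Icarr\<close>)
  then obtain g where g: "g \<in> mod_hom R N E" "\<And>a. a \<in> I \<Longrightarrow> g a = h a" by auto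
  show thesis
  proof
    show "g \<one>\<^bsub>R\<^esub> \<in> carrier E" using g(1) by (auto simp: mod_hom_def N_def)
    fix a assume "a \<in> I"
    then have "g (a \<otimes>\<^bsub>R\<^esub> \<one>\<^bsub>R\<^esub>) = a \<odot>\<^bsub>E\<^esub> g \<one>\<^bsub>R\<^esub>"
      using g(1) by (simp add: mod_hom_def N_def I.Icarr del: r_one)
    then show "h a = a \<odot>\<^bsub>E\<^esub> g \<one>\<^bsub>R\<^esub>" using \<open>a \<in> I\<close> g(2) by (simp add: I.Icarr)
  qed
qed

theorem injective_module_extend:
  fixes R :: "('r, 'x) ring_scheme" and E :: "('r, 'e, 'y) module_scheme"
    and M :: "('r, 'm, 'z) module_scheme" and N :: "('r, 'n, 'w) module_scheme"
  assumes inj: "injective_module R E" and "module R M" and "module R N"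
    and i: "i \<in> mod_hom R M N" "inj_on i (carrier M)" and f: "f \<in> mod_hom R M E"
  shows "\<exists>g\<in>mod_hom R N E. \<forall>x\<in>carrier M. g (i x) = f x"
proof -
  interpret M: module R M by fact
  interpret N: module R N by fact
  interpret E: module R E using inj by (simp add: injective_module_def)
  have iN: "i x \<in> carrier N" and fE: "f x \<in> carrier E" if "x \<in> carrier M" for x
    using that i(1) f by (auto simp: mod_hom_def)
  have i_add: "i (x \<oplus>\<^bsub>M\<^esub> y) = i x \<oplus>\<^bsub>N\<^esub> i y" and f_add: "f (x \<oplus>\<^bsub>M\<^esub> y) = f x \<oplus>\<^bsub>E\<^esub> f y"
    if "x \<in> carrier M" "y \<in> carrier M" for x y
    using that i(1) f by (auto simp: mod_hom_def)
  have i_sm: "i (a \<odot>\<^bsub>M\<^esub> x) = a \<odot>\<^bsub>N\<^esub> i x" and f_sm: "f (a \<odot>\<^bsub>M\<^esub> x) = a \<odot>\<^bsub>E\<^esub> f x"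
    if "a \<in> carrier R" "x \<in> carrier M" for a x
    using that i(1) f by (auto simp: mod_hom_def)
  \<comment> \<open>graphs of partial extensions\<close>
  define P where "P G \<longleftrightarrow> G \<subseteq> carrier N \<times> carrier E \<and> (\<lambda>x. (i x, f x)) ` carrier M \<subseteq> G \<and>
    (\<forall>x y x' y'. (x, y) \<in> G \<and> (x', y') \<in> G \<longrightarrow> (x \<oplus>\<^bsub>N\<^esub> x', y \<oplus>\<^bsub>E\<^esub> y') \<in> G) \<and>
    (\<forall>a x y. a \<in> carrier R \<and> (x, y) \<in> G \<longrightarrow> (a \<odot>\<^bsub>N\<^esub> x, a \<odot>\<^bsub>E\<^esub> y) \<in> G) \<and>
    (\<forall>y. (\<zero>\<^bsub>N\<^esub>, y) \<in> G \<longrightarrow> y = \<zero>\<^bsub>E\<^esub>)" for G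
  have "P ((\<lambda>x. (i x, f x)) ` carrier M)"
  proof -
    have "f x = \<zero>\<^bsub>E\<^esub>" if x: "x \<in> carrier M" "i x = \<zero>\<^bsub>N\<^esub>" for x
    proof -
      have "i \<zero>\<^bsub>M\<^esub> = \<zero>\<^bsub>N\<^esub>"
        using i_sm[of "\<zero>\<^bsub>R\<^esub>" "\<zero>\<^bsub>M\<^esub>"] iN[of "\<zero>\<^bsub>M\<^esub>"] by simp
      then have "x = \<zero>\<^bsub>M\<^esub>" using inj_onD[OF i(2), of x "\<zero>\<^bsub>M\<^esub>"] x by simp
      then show ?thesis using f_sm[of "\<zero>\<^bsub>R\<^esub>" "\<zero>\<^bsub>M\<^esub>"] fE[of "\<zero>\<^bsub>M\<^esub>"] by simp
    qed
    then show ?thesis unfolding P_def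
      by (auto simp: iN fE i_add[symmetric] f_add[symmetric] i_sm[symmetric] f_sm[symmetric])
  qed
  moreover have "P (\<Union>K)" if "K \<noteq> {}" and K: "subset.chain {G. P G} K" for K
  proof -
    have PG: "P G" if "G \<in> K" for G using K that by (auto simp: subset.chain_def)
    have PG_add: "(x \<oplus>\<^bsub>N\<^esub> x', y \<oplus>\<^bsub>E\<^esub> y') \<in> G"
      if "G \<in> K" "(x, y) \<in> G" "(x', y') \<in> G" for G x y x' y'
      using PG[OF that(1)] that(2,3) unfolding P_def by meson
    have PG_sm: "(a \<odot>\<^bsub>N\<^esub> x, a \<odot>\<^bsub>E\<^esub> y) \<in> G"
      if "G \<in> K" "a \<in> carrier R" "(x, y) \<in> G" for G a x y
      using PG[OF that(1)] that(2,3) unfolding P_def by meson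
    show ?thesis unfolding P_def
    proof (intro conjI allI impI)
      show "\<Union>K \<subseteq> carrier N \<times> carrier E"
        using PG unfolding P_def by (meson Sup_least)
      show "(\<lambda>x. (i x, f x)) ` carrier M \<subseteq> \<Union>K"
        using PG \<open>K \<noteq> {}\<close> unfolding P_def by (meson Union_upper ex_in_conv order_trans)
    next
      fix x y x' y' assume "(x, y) \<in> \<Union>K \<and> (x', y') \<in> \<Union>K"
      then obtain G1 G2 where *: "G1 \<in> K" "(x, y) \<in> G1" "G2 \<in> K" "(x', y') \<in> G2" by auto
      have "G1 \<subseteq> G2 \<or> G2 \<subseteq> G1" using K * by (auto simp: subset_chain_def)
      then obtain G3 where "G3 \<in> K" "(x, y) \<in> G3" "(x', y') \<in> G3" using * by auto
      then show "(x \<oplus>\<^bsub>N\<^esub> x', y \<oplus>\<^bsub>E\<^esub> y') \<in> \<Union>K" using PG_add by blast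
    next
      fix a x y assume "a \<in> carrier R \<and> (x, y) \<in> \<Union>K"
      then show "(a \<odot>\<^bsub>N\<^esub> x, a \<odot>\<^bsub>E\<^esub> y) \<in> \<Union>K" using PG_sm by blast
    next
      fix y assume "(\<zero>\<^bsub>N\<^esub>, y) \<in> \<Union>K"
      then show "y = \<zero>\<^bsub>E\<^esub>" using PG unfolding P_def by (meson UnionE)
    qed
  qed
  ultimately obtain G where "P G" and max: "\<And>G'. P G' \<Longrightarrow> G \<subseteq> G' \<Longrightarrow> G' = G"
    using subset_Zorn_nonempty[of "{G. P G}"] by auto
  note G = \<open>P G\<close>[unfolded P_def]
  have Gcar: "x \<in> carrier N" "y \<in> carrier E" if "(x, y) \<in> G" for x y using G that by auto
  have Gadd: "(x \<oplus>\<^bsub>N\<^esub> x', y \<oplus>\<^bsub>E\<^esub> y') \<in> G" if "(x, y) \<in> G" "(x', y') \<in> G" for x y x' y'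
    using G that by meson
  have Gsm: "(a \<odot>\<^bsub>N\<^esub> x, a \<odot>\<^bsub>E\<^esub> y) \<in> G" if "a \<in> carrier R" "(x, y) \<in> G" for a x y
    using G that by meson
  have Gneg: "(\<ominus>\<^bsub>N\<^esub> x, \<ominus>\<^bsub>E\<^esub> y) \<in> G" if "(x, y) \<in> G" for x y
    using Gsm[OF _ that, of "\<ominus>\<^bsub>R\<^esub> \<one>\<^bsub>R\<^esub>"] Gcar[OF that] by (simp add: N.smult_l_minus E.smult_l_minus)
  have Guniq: "y = y'" if "(x, y) \<in> G" "(x, y') \<in> G" for x y y'
  proof -
    have "(\<zero>\<^bsub>N\<^esub>, y \<oplus>\<^bsub>E\<^esub> \<ominus>\<^bsub>E\<^esub> y') \<in> G"
      using Gadd[OF that(1) Gneg[OF that(2)]] Gcar[OF that(1)] by (simp add: N.M.r_neg)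
    then have "y \<oplus>\<^bsub>E\<^esub> \<ominus>\<^bsub>E\<^esub> y' = \<zero>\<^bsub>E\<^esub>" using G by meson
    moreover have "y = (y \<oplus>\<^bsub>E\<^esub> \<ominus>\<^bsub>E\<^esub> y') \<oplus>\<^bsub>E\<^esub> y'"
      using Gcar(2)[OF that(1)] Gcar(2)[OF that(2)] by (simp add: E.M.a_assoc E.M.l_neg)
    ultimately show ?thesis using Gcar(2)[OF that(2)] by simp
  qed
  obtain z where z: "z \<in> carrier M" using M.M.zero_closed by blast
  have G0: "(\<zero>\<^bsub>N\<^esub>, \<zero>\<^bsub>E\<^esub>) \<in> G"
  proof -
    have "(i z, f z) \<in> G" using G z by blast
    from Gsm[OF _ this, of "\<zero>\<^bsub>R\<^esub>"] z show ?thesis by (simp add: iN fE)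
  qed
  have dom: "\<exists>y. (x, y) \<in> G" if x: "x \<in> carrier N" for x
  proof -
    define I where "I = {a \<in> carrier R. \<exists>y. (a \<odot>\<^bsub>N\<^esub> x, y) \<in> G}"
    define h where "h a = (THE y. (a \<odot>\<^bsub>N\<^esub> x, y) \<in> G)" for a
    have h_eq: "h a = y" if "(a \<odot>\<^bsub>N\<^esub> x, y) \<in> G" for a y
      using that Guniq by (auto simp: h_def)
    have hG: "(a \<odot>\<^bsub>N\<^esub> x, h a) \<in> G" if "a \<in> I" for a
      using that h_eq by (auto simp: I_def)
    have IR: "a \<in> carrier R" if "a \<in> I" for a using that by (simp add: I_def)
    have add: "((a \<oplus>\<^bsub>R\<^esub> b) \<odot>\<^bsub>N\<^esub> x, h a \<oplus>\<^bsub>E\<^esub> h b) \<in> G" if "a \<in> I" "b \<in> I" for a b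
      using Gadd[OF hG hG, OF that] that x by (simp add: IR N.smult_l_distr)
    have sm: "((a \<otimes>\<^bsub>R\<^esub> b) \<odot>\<^bsub>N\<^esub> x, a \<odot>\<^bsub>E\<^esub> h b) \<in> G" if "a \<in> carrier R" "b \<in> I" for a b
      using Gsm[OF _ hG, OF that] that x by (simp add: IR N.smult_assoc1)
    have "ideal I R"
    proof (rule idealI)
      show "ring R" by (rule M.R.ring_axioms)
      show "subgroup I (add_monoid R)"
      proof (rule M.R.add.subgroupI)
        show "I \<subseteq> carrier R" by (auto simp: I_def)
        show "I \<noteq> {}" using G0 x by (auto simp: I_def intro!: exI[of _ "\<zero>\<^bsub>R\<^esub>"])
        show "\<ominus>\<^bsub>R\<^esub> a \<in> I" if "a \<in> I" for a
          using Gneg[OF hG[OF that]] that x by (auto simp: I_def N.smult_l_minus)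
        show "a \<oplus>\<^bsub>R\<^esub> b \<in> I" if "a \<in> I" "b \<in> I" for a b
          using add[OF that] that by (auto simp: I_def)
      qed
      show "b \<otimes>\<^bsub>R\<^esub> a \<in> I" if "a \<in> I" "b \<in> carrier R" for a b
        using sm[OF that(2,1)] that by (auto simp: I_def)
      then show "a \<otimes>\<^bsub>R\<^esub> b \<in> I" if "a \<in> I" "b \<in> carrier R" for a b
        using that by (simp add: IR M.R.m_comm)
    qed
    from Baer_extend[OF inj this M.R.cring_axioms, of h]
    obtain e where e: "e \<in> carrier E" "\<And>a. a \<in> I \<Longrightarrow> h a = a \<odot>\<^bsub>E\<^esub> e"
      using hG Gcar h_eq[OF add] h_eq[OF sm] by (metis (no_types, lifting) Pi_I)
    define G' where "G' = {(n \<oplus>\<^bsub>N\<^esub> a \<odot>\<^bsub>N\<^esub> x, y \<oplus>\<^bsub>E\<^esub> a \<odot>\<^bsub>E\<^esub> e) | n y a. (n, y) \<in> G \<and> a \<in> carrier R}"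
    have G'I: "(n \<oplus>\<^bsub>N\<^esub> a \<odot>\<^bsub>N\<^esub> x, y \<oplus>\<^bsub>E\<^esub> a \<odot>\<^bsub>E\<^esub> e) \<in> G'" if "(n, y) \<in> G" "a \<in> carrier R" for n y a
      using that by (auto simp: G'_def)
    have sub: "G \<subseteq> G'"
    proof
      fix p assume "p \<in> G"
      then show "p \<in> G'" using G'I[of "fst p" "snd p" "\<zero>\<^bsub>R\<^esub>"] Gcar[of "fst p" "snd p"] x e(1) by simp
    qed
    have "P G'" unfolding P_def
    proof (intro conjI allI impI)
      show "G' \<subseteq> carrier N \<times> carrier E" using Gcar x e(1) by (auto simp: G'_def)
      show "(\<lambda>x. (i x, f x)) ` carrier M \<subseteq> G'"
        using G sub by (meson order_trans)
    next
      fix u v u' v' assume "(u, v) \<in> G' \<and> (u', v') \<in> G'"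
      then obtain n y a n' y' a' where *: "(n, y) \<in> G" "a \<in> carrier R" "(n', y') \<in> G" "a' \<in> carrier R"
        and uv: "u = n \<oplus>\<^bsub>N\<^esub> a \<odot>\<^bsub>N\<^esub> x" "v = y \<oplus>\<^bsub>E\<^esub> a \<odot>\<^bsub>E\<^esub> e"
          "u' = n' \<oplus>\<^bsub>N\<^esub> a' \<odot>\<^bsub>N\<^esub> x" "v' = y' \<oplus>\<^bsub>E\<^esub> a' \<odot>\<^bsub>E\<^esub> e"
        by (auto simp: G'_def)
      have "u \<oplus>\<^bsub>N\<^esub> u' = (n \<oplus>\<^bsub>N\<^esub> n') \<oplus>\<^bsub>N\<^esub> (a \<oplus>\<^bsub>R\<^esub> a') \<odot>\<^bsub>N\<^esub> x"
        using * x Gcar[OF *(1)] Gcar[OF *(3)] by (simp add: uv N.smult_l_distr N.M.a_ac)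
      moreover have "v \<oplus>\<^bsub>E\<^esub> v' = (y \<oplus>\<^bsub>E\<^esub> y') \<oplus>\<^bsub>E\<^esub> (a \<oplus>\<^bsub>R\<^esub> a') \<odot>\<^bsub>E\<^esub> e"
        using * e(1) Gcar[OF *(1)] Gcar[OF *(3)] by (simp add: uv E.smult_l_distr E.M.a_ac)
      ultimately show "(u \<oplus>\<^bsub>N\<^esub> u', v \<oplus>\<^bsub>E\<^esub> v') \<in> G'"
        using G'I[OF Gadd[OF *(1,3)], of "a \<oplus>\<^bsub>R\<^esub> a'"] * by simp
    next
      fix b u v assume "b \<in> carrier R \<and> (u, v) \<in> G'"
      then obtain n y a where *: "b \<in> carrier R" "(n, y) \<in> G" "a \<in> carrier R"
        and uv: "u = n \<oplus>\<^bsub>N\<^esub> a \<odot>\<^bsub>N\<^esub> x" "v = y \<oplus>\<^bsub>E\<^esub> a \<odot>\<^bsub>E\<^esub> e"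
        by (auto simp: G'_def)
      have "b \<odot>\<^bsub>N\<^esub> u = b \<odot>\<^bsub>N\<^esub> n \<oplus>\<^bsub>N\<^esub> (b \<otimes>\<^bsub>R\<^esub> a) \<odot>\<^bsub>N\<^esub> x"
        using * x Gcar[OF *(2)] by (simp add: uv N.smult_r_distr N.smult_assoc1)
      moreover have "b \<odot>\<^bsub>E\<^esub> v = b \<odot>\<^bsub>E\<^esub> y \<oplus>\<^bsub>E\<^esub> (b \<otimes>\<^bsub>R\<^esub> a) \<odot>\<^bsub>E\<^esub> e"
        using * e(1) Gcar[OF *(2)] by (simp add: uv E.smult_r_distr E.smult_assoc1)
      ultimately show "(b \<odot>\<^bsub>N\<^esub> u, b \<odot>\<^bsub>E\<^esub> v) \<in> G'"
        using G'I[OF Gsm[OF *(1,2)], of "b \<otimes>\<^bsub>R\<^esub> a"] * by simp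
    next
      fix v assume "(\<zero>\<^bsub>N\<^esub>, v) \<in> G'"
      then obtain n y a where *: "(n, y) \<in> G" "a \<in> carrier R"
        and nv: "n \<oplus>\<^bsub>N\<^esub> a \<odot>\<^bsub>N\<^esub> x = \<zero>\<^bsub>N\<^esub>" "v = y \<oplus>\<^bsub>E\<^esub> a \<odot>\<^bsub>E\<^esub> e"
        by (auto simp: G'_def)
      have "a \<odot>\<^bsub>N\<^esub> x = \<ominus>\<^bsub>N\<^esub> n"
        using nv(1) * x Gcar[OF *(1)] by (metis N.M.add.inv_equality N.M.add.m_comm N.smult_closed)
      then have ax: "(a \<odot>\<^bsub>N\<^esub> x, \<ominus>\<^bsub>E\<^esub> y) \<in> G" using Gneg[OF *(1)] by simp
      then have "a \<in> I" using * by (auto simp: I_def)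
      then have "a \<odot>\<^bsub>E\<^esub> e = \<ominus>\<^bsub>E\<^esub> y" using e(2) h_eq[OF ax] by simp
      then show "v = \<zero>\<^bsub>E\<^esub>" using Gcar[OF *(1)] by (simp add: nv(2) E.M.r_neg)
    qed
    then have "G' = G" using max sub by blast
    moreover have "(x, e) \<in> G'" using G'I[OF G0, of "\<one>\<^bsub>R\<^esub>"] x e(1) by simp
    ultimately show ?thesis by blast
  qed
  define g where "g x = (THE y. (x, y) \<in> G)" for x
  have g_eq: "g x = y" if "(x, y) \<in> G" for x y
    using that Guniq by (auto simp: g_def)
  have gG: "(x, g x) \<in> G" if "x \<in> carrier N" for x using dom[OF that] g_eq by auto
  have "g \<in> mod_hom R N E"
    using Gcar(2)[OF gG] g_eq[OF Gadd[OF gG gG]] g_eq[OF Gsm[OF _ gG]] by (auto simp: mod_hom_def)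
  moreover have "g (i x) = f x" if "x \<in> carrier M" for x
  proof (rule g_eq)
    have "(\<lambda>x. (i x, f x)) ` carrier M \<subseteq> G" using G by meson
    then show "(i x, f x) \<in> G" using that by auto
  qed
  ultimately show ?thesis by blast
qed

theorem injective_cogenerator_separate:
  fixes R :: "('r, 'x) ring_scheme" and E :: "('r, 'e, 'y) module_scheme"
    and M :: "('r, 'm, 'z) module_scheme"
  assumes E: "injective_cogenerator R E" and "module R M" and x: "x \<in> carrier M" "x \<noteq> \<zero>\<^bsub>M\<^esub>"
  shows "\<exists>f\<in>mod_hom R M E. f x \<noteq> \<zero>\<^bsub>E\<^esub>"
proof -
  interpret M: module R M by fact
  define H where "H = {a \<odot>\<^bsub>M\<^esub> x | a. a \<in> carrier R}"
  have HI: "a \<odot>\<^bsub>M\<^esub> x \<in> H" if "a \<in> carrier R" for a using that by (auto simp: H_def)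
  have H: "submodule H R M"
  proof (rule M.submoduleI)
    show "H \<subseteq> carrier M" using x by (auto simp: H_def)
    show "\<zero>\<^bsub>M\<^esub> \<in> H" using HI[of "\<zero>\<^bsub>R\<^esub>"] x by simp
    show "\<ominus>\<^bsub>M\<^esub> u \<in> H" if u: "u \<in> H" for u
      using u x by (auto simp: H_def M.smult_l_minus[symmetric])
    show "u \<oplus>\<^bsub>M\<^esub> v \<in> H" if "u \<in> H" "v \<in> H" for u v
      using that x by (auto simp: H_def M.smult_l_distr[symmetric])
    show "b \<odot>\<^bsub>M\<^esub> u \<in> H" if "b \<in> carrier R" "u \<in> H" for b u
      using that x by (auto simp: H_def M.smult_assoc1[symmetric])
  qed
  have xH: "x \<in> H" using HI[OF M.R.one_closed] x by simp
  have zH: "\<zero>\<^bsub>M\<^esub> \<in> H" using HI[OF M.R.zero_closed] x by simp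
  let ?H = "M\<lparr>carrier := H\<rparr>"
  have mH: "module R ?H" by (rule submodule.submodule_is_module[OF H \<open>module R M\<close>])
  define j where "j u = {a \<in> carrier R. a \<odot>\<^bsub>M\<^esub> x = u}" for u
  have j: "inj_on j (carrier ?H)" by (auto simp: inj_on_def H_def j_def)
  note T = transport_module[OF mH j]
  have "j x \<noteq> j \<zero>\<^bsub>M\<^esub>" 
    using inj_onD[OF j, of x "\<zero>\<^bsub>M\<^esub>"] x(2) xH zH by auto
  then have "j x \<noteq> \<zero>\<^bsub>transport_module j ?H\<^esub>" by (simp add: transport_module_def)
  moreover have "j x \<in> carrier (transport_module j ?H)" using xH by (simp add: transport_module_def)
  ultimately obtain k where k: "k \<in> mod_hom R (transport_module j ?H) E" "k (j x) \<noteq> \<zero>\<^bsub>E\<^esub>"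
    using E T(1) unfolding injective_cogenerator_def cogenerator_module_def by meson
  have "(\<lambda>u. k (j u)) \<in> mod_hom R ?H E" using mod_hom_comp[OF T(2) k(1)] .
  moreover have "(\<lambda>u. u) \<in> mod_hom R ?H M" "inj_on (\<lambda>u. u) (carrier ?H)"
    using M.submoduleE(1)[OF H] by (auto simp: mod_hom_def)
  moreover have "injective_module R E" using E by (simp add: injective_cogenerator_def)
  ultimately obtain g where g: "g \<in> mod_hom R M E" "\<forall>u\<in>carrier ?H. g u = k (j u)"
    using injective_module_extend[OF _ mH \<open>module R M\<close>] by blast
  have "g x = k (j x)" using bspec[OF g(2), of x] xH by simp
  then show ?thesis using g(1) k(2) by metis
qed


subsection \<open>Minimality and Matlis duality\<close>

text \<open>Minimality is with respect to inclusion. The injective cogenerators that are minimal in this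
  sense are exactly the injective envelopes of the direct sum of a representative set of simple modules.\<close>

definition minimal_injective_cogenerator :: "('r, 'x) ring_scheme \<Rightarrow> ('r, 'e, 'y) module_scheme \<Rightarrow> bool"
  where "minimal_injective_cogenerator R E \<longleftrightarrow> injective_cogenerator R E \<and>
    (\<forall>H. submodule H R E \<and> injective_cogenerator R (E\<lparr>carrier := H\<rparr>) \<longrightarrow> H = carrier E)"

definition Matlis_dual ::
    "('r, 'x) ring_scheme \<Rightarrow> ('r, 'e, 'y) module_scheme \<Rightarrow> ('r, 'm, 'z) module_scheme \<Rightarrow> ('r, 'm \<Rightarrow> 'e) module"
  where "Matlis_dual R E M = hom_module R M E"

text \<open>For a linear map \<open>h\<close> from \<open>M\<close> to \<open>N\<close>, this is the map from the dual of
  \<open>N\<close> to the dual of \<open>M\<close>.\<close>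

definition Matlis_dual_map ::
    "('r, 'm, 'z) module_scheme \<Rightarrow> ('m \<Rightarrow> 'n) \<Rightarrow> ('n \<Rightarrow> 'e) \<Rightarrow> ('m \<Rightarrow> 'e)"
  where "Matlis_dual_map M h \<theta> = compose (carrier M) \<theta> h"


section \<open>Linear categories\<close>

text \<open>\<open>Comp C X Y Z g f\<close> is the composite of \<open>f\<close> from \<open>X\<close> to \<open>Y\<close>
  followed by \<open>g\<close> from \<open>Y\<close> to \<open>Z\<close>. The Hom modules of different pairs
  of objects need not be disjoint; for this reason composition, as well as the action of a functor on
  morphisms, takes the objects as arguments.\<close>

record ('o, 'a, 'r) lin_cat =
  Obj :: "'o set"
  Hom :: "'o \<Rightarrow> 'o \<Rightarrow> ('r, 'a) module"
  Id :: "'o \<Rightarrow> 'a"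
  Comp :: "'o \<Rightarrow> 'o \<Rightarrow> 'o \<Rightarrow> 'a \<Rightarrow> 'a \<Rightarrow> 'a"

locale linear_category = cring R
  for R :: "('r, 'x) ring_scheme" and C :: "('o, 'a, 'r) lin_cat" +
  assumes Hom_module: "\<lbrakk>X \<in> Obj C; Y \<in> Obj C\<rbrakk> \<Longrightarrow> module R (Hom C X Y)"
    and Id_closed: "X \<in> Obj C \<Longrightarrow> Id C X \<in> carrier (Hom C X X)"
    and Comp_linear_left:
      "\<lbrakk>X \<in> Obj C; Y \<in> Obj C; Z \<in> Obj C; f \<in> carrier (Hom C X Y)\<rbrakk>
        \<Longrightarrow> (\<lambda>g. Comp C X Y Z g f) \<in> mod_hom R (Hom C Y Z) (Hom C X Z)"
    and Comp_linear_right: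
      "\<lbrakk>X \<in> Obj C; Y \<in> Obj C; Z \<in> Obj C; g \<in> carrier (Hom C Y Z)\<rbrakk>
        \<Longrightarrow> (\<lambda>f. Comp C X Y Z g f) \<in> mod_hom R (Hom C X Y) (Hom C X Z)"
    and Comp_Id_right:
      "\<lbrakk>X \<in> Obj C; Y \<in> Obj C; f \<in> carrier (Hom C X Y)\<rbrakk> \<Longrightarrow> Comp C X X Y f (Id C X) = f"
    and Comp_Id_left:
      "\<lbrakk>X \<in> Obj C; Y \<in> Obj C; f \<in> carrier (Hom C X Y)\<rbrakk> \<Longrightarrow> Comp C X Y Y (Id C Y) f = f"
    and Comp_assoc:
      "\<lbrakk>W \<in> Obj C; X \<in> Obj C; Y \<in> Obj C; Z \<in> Obj C;
        f \<in> carrier (Hom C W X); g \<in> carrier (Hom C X Y); h \<in> carrier (Hom C Y Z)\<rbrakk>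
        \<Longrightarrow> Comp C W X Z (Comp C X Y Z h g) f = Comp C W Y Z h (Comp C W X Y g f)"

definition hom_finite :: "('r, 'x) ring_scheme \<Rightarrow> ('o, 'a, 'r) lin_cat \<Rightarrow> bool"
  where "hom_finite R C \<longleftrightarrow>
    (\<forall>X\<in>Obj C. \<forall>Y\<in>Obj C. finitely_generated_module R (Hom C X Y))"

definition full_subcategory :: "('o, 'a, 'r) lin_cat \<Rightarrow> 'o set \<Rightarrow> ('o, 'a, 'r) lin_cat"
  where "full_subcategory C A = C\<lparr>Obj := A\<rparr>"

definition iso_in :: "('o, 'a, 'r) lin_cat \<Rightarrow> 'o \<Rightarrow> 'o \<Rightarrow> 'a set"
  where "iso_in C X Y = {f \<in> carrier (Hom C X Y).
    \<exists>g\<in>carrier (Hom C Y X). Comp C X Y X g f = Id C X \<and> Comp C Y X Y f g = Id C Y}"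


section \<open>Functors between linear categories\<close>

record ('o, 'a, 'p, 'b) cat_functor =
  on_obj :: "'o \<Rightarrow> 'p"
  on_hom :: "'o \<Rightarrow> 'o \<Rightarrow> 'a \<Rightarrow> 'b"

definition is_functor ::
    "('o, 'a, 'r) lin_cat \<Rightarrow> ('p, 'b, 'r) lin_cat \<Rightarrow> ('o, 'a, 'p, 'b) cat_functor \<Rightarrow> bool"
  where "is_functor C D F \<longleftrightarrow>
    (\<forall>X\<in>Obj C. on_obj F X \<in> Obj D) \<and>
    (\<forall>X\<in>Obj C. \<forall>Y\<in>Obj C. \<forall>f\<in>carrier (Hom C X Y).
      on_hom F X Y f \<in> carrier (Hom D (on_obj F X) (on_obj F Y))) \<and>
    (\<forall>X\<in>Obj C. on_hom F X X (Id C X) = Id D (on_obj F X)) \<and>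
    (\<forall>X\<in>Obj C. \<forall>Y\<in>Obj C. \<forall>Z\<in>Obj C. \<forall>f\<in>carrier (Hom C X Y). \<forall>g\<in>carrier (Hom C Y Z).
      on_hom F X Z (Comp C X Y Z g f) =
        Comp D (on_obj F X) (on_obj F Y) (on_obj F Z) (on_hom F Y Z g) (on_hom F X Y f))"

definition is_linear_functor ::
    "('r, 'x) ring_scheme \<Rightarrow> ('o, 'a, 'r) lin_cat \<Rightarrow> ('p, 'b, 'r) lin_cat
      \<Rightarrow> ('o, 'a, 'p, 'b) cat_functor \<Rightarrow> bool"
  where "is_linear_functor R C D F \<longleftrightarrow> is_functor C D F \<and>
    (\<forall>X\<in>Obj C. \<forall>Y\<in>Obj C.
      on_hom F X Y \<in> mod_hom R (Hom C X Y) (Hom D (on_obj F X) (on_obj F Y)))"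

definition id_functor :: "('o, 'a, 'o, 'a) cat_functor"
  where "id_functor = \<lparr>on_obj = (\<lambda>X. X), on_hom = (\<lambda>X Y f. f)\<rparr>"

definition comp_functor ::
    "('p, 'b, 'q, 'c) cat_functor \<Rightarrow> ('o, 'a, 'p, 'b) cat_functor \<Rightarrow> ('o, 'a, 'q, 'c) cat_functor"
  where "comp_functor G F =
    \<lparr>on_obj = (\<lambda>X. on_obj G (on_obj F X)),
     on_hom = (\<lambda>X Y f. on_hom G (on_obj F X) (on_obj F Y) (on_hom F X Y f))\<rparr>"

definition functors_isomorphic ::
    "('o, 'a, 'r) lin_cat \<Rightarrow> ('p, 'b, 'r) lin_cat
      \<Rightarrow> ('o, 'a, 'p, 'b) cat_functor \<Rightarrow> ('o, 'a, 'p, 'b) cat_functor \<Rightarrow> bool"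
  where "functors_isomorphic C D F G \<longleftrightarrow>
    (\<exists>\<eta>. (\<forall>X\<in>Obj C. \<eta> X \<in> iso_in D (on_obj F X) (on_obj G X)) \<and>
      (\<forall>X\<in>Obj C. \<forall>Y\<in>Obj C. \<forall>f\<in>carrier (Hom C X Y).
        Comp D (on_obj F X) (on_obj F Y) (on_obj G Y) (\<eta> Y) (on_hom F X Y f) =
        Comp D (on_obj F X) (on_obj G X) (on_obj G Y) (on_hom G X Y f) (\<eta> X)))"

definition is_linear_equivalence ::
    "('r, 'x) ring_scheme \<Rightarrow> ('o, 'a, 'r) lin_cat \<Rightarrow> ('p, 'b, 'r) lin_cat
      \<Rightarrow> ('o, 'a, 'p, 'b) cat_functor \<Rightarrow> bool"
  where "is_linear_equivalence R C D F \<longleftrightarrow> is_linear_functor R C D F \<and>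
    (\<exists>G. is_linear_functor R D C G \<and>
      functors_isomorphic C C (comp_functor G F) id_functor \<and>
      functors_isomorphic D D (comp_functor F G) id_functor)"


section \<open>Functors to modules and representability\<close>

text \<open>For a morphism \<open>f\<close> from \<open>X\<close> to \<open>Y\<close>, \<open>on_mor F X Y f\<close>
  goes from \<open>on_ob F X\<close> to \<open>on_ob F Y\<close> if \<open>F\<close> is covariant, and from
  \<open>on_ob F Y\<close> to \<open>on_ob F X\<close> if \<open>F\<close> is contravariant.\<close>

record ('o, 'a, 'r, 'm) mod_functor =
  on_ob :: "'o \<Rightarrow> ('r, 'm) module"
  on_mor :: "'o \<Rightarrow> 'o \<Rightarrow> 'a \<Rightarrow> 'm \<Rightarrow> 'm"

definition Hom_from :: "('o, 'a, 'r) lin_cat \<Rightarrow> 'o \<Rightarrow> ('o, 'a, 'r, 'a) mod_functor"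
  where "Hom_from C X =
    \<lparr>on_ob = (\<lambda>Y. Hom C X Y), on_mor = (\<lambda>Y Y' f g. Comp C X Y Y' f g)\<rparr>"

definition Hom_to :: "('o, 'a, 'r) lin_cat \<Rightarrow> 'o \<Rightarrow> ('o, 'a, 'r, 'a) mod_functor"
  where "Hom_to C X =
    \<lparr>on_ob = (\<lambda>Y. Hom C Y X), on_mor = (\<lambda>Y Y' f g. Comp C Y Y' X g f)\<rparr>"

text \<open>The contravariant functor \<open>D(X,-)\<close> and the covariant functor \<open>D(-,X)\<close>.\<close>

definition D_from ::
    "('r, 'x) ring_scheme \<Rightarrow> ('r, 'e, 'y) module_scheme \<Rightarrow> ('o, 'a, 'r) lin_cat \<Rightarrow> 'o
      \<Rightarrow> ('o, 'a, 'r, 'a \<Rightarrow> 'e) mod_functor"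
  where "D_from R E C X =
    \<lparr>on_ob = (\<lambda>Y. Matlis_dual R E (on_ob (Hom_from C X) Y)),
     on_mor = (\<lambda>Y Y' f. Matlis_dual_map (on_ob (Hom_from C X) Y) (on_mor (Hom_from C X) Y Y' f))\<rparr>"

definition D_to ::
    "('r, 'x) ring_scheme \<Rightarrow> ('r, 'e, 'y) module_scheme \<Rightarrow> ('o, 'a, 'r) lin_cat \<Rightarrow> 'o
      \<Rightarrow> ('o, 'a, 'r, 'a \<Rightarrow> 'e) mod_functor"
  where "D_to R E C X =
    \<lparr>on_ob = (\<lambda>Y. Matlis_dual R E (on_ob (Hom_to C X) Y)),
     on_mor = (\<lambda>Y Y' f. Matlis_dual_map (on_ob (Hom_to C X) Y') (on_mor (Hom_to C X) Y Y' f))\<rparr>"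

definition natural_iso_cov ::
    "('r, 'x) ring_scheme \<Rightarrow> ('o, 'a, 'r) lin_cat \<Rightarrow> ('o, 'a, 'r, 'm) mod_functor
      \<Rightarrow> ('o, 'a, 'r, 'n) mod_functor \<Rightarrow> ('o \<Rightarrow> 'm \<Rightarrow> 'n) \<Rightarrow> bool"
  where "natural_iso_cov R C F G \<eta> \<longleftrightarrow>
    (\<forall>Y\<in>Obj C. \<eta> Y \<in> mod_iso R (on_ob F Y) (on_ob G Y)) \<and>
    (\<forall>Y\<in>Obj C. \<forall>Y'\<in>Obj C. \<forall>f\<in>carrier (Hom C Y Y'). \<forall>u\<in>carrier (on_ob F Y).
      \<eta> Y' (on_mor F Y Y' f u) = on_mor G Y Y' f (\<eta> Y u))"

definition natural_iso_contra ::
    "('r, 'x) ring_scheme \<Rightarrow> ('o, 'a, 'r) lin_cat \<Rightarrow> ('o, 'a, 'r, 'm) mod_functor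
      \<Rightarrow> ('o, 'a, 'r, 'n) mod_functor \<Rightarrow> ('o \<Rightarrow> 'm \<Rightarrow> 'n) \<Rightarrow> bool"
  where "natural_iso_contra R C F G \<eta> \<longleftrightarrow>
    (\<forall>Y\<in>Obj C. \<eta> Y \<in> mod_iso R (on_ob F Y) (on_ob G Y)) \<and>
    (\<forall>Y\<in>Obj C. \<forall>Y'\<in>Obj C. \<forall>f\<in>carrier (Hom C Y Y'). \<forall>u\<in>carrier (on_ob F Y').
      \<eta> Y (on_mor F Y Y' f u) = on_mor G Y Y' f (\<eta> Y' u))"

definition C_r ::
    "('r, 'x) ring_scheme \<Rightarrow> ('r, 'e, 'y) module_scheme \<Rightarrow> ('o, 'a, 'r) lin_cat \<Rightarrow> ('o, 'a, 'r) lin_cat"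
  where "C_r R E C = full_subcategory C
    {X \<in> Obj C. \<exists>Z\<in>Obj C. \<exists>\<eta>. natural_iso_contra R C (D_from R E C X) (Hom_to C Z) \<eta>}"

definition C_l ::
    "('r, 'x) ring_scheme \<Rightarrow> ('r, 'e, 'y) module_scheme \<Rightarrow> ('o, 'a, 'r) lin_cat \<Rightarrow> ('o, 'a, 'r) lin_cat"
  where "C_l R E C = full_subcategory C
    {X \<in> Obj C. \<exists>Z\<in>Obj C. \<exists>\<eta>. natural_iso_cov R C (D_to R E C X) (Hom_from C Z) \<eta>}"

text \<open>Naturality of \<open>\<phi> X Y\<close> in \<open>Y\<close> is part of
  \<^const>\<open>natural_iso_contra\<close>; the last condition is naturality in \<open>X\<close>.\<close>

definition generalized_Serre_functor ::
    "('r, 'x) ring_scheme \<Rightarrow> ('r, 'e, 'y) module_scheme \<Rightarrow> ('o, 'a, 'r) lin_cat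
      \<Rightarrow> ('o, 'a, 'o, 'a) cat_functor \<Rightarrow> bool"
  where "generalized_Serre_functor R E C S \<longleftrightarrow> is_functor (C_r R E C) (C_l R E C) S \<and>
    (\<exists>\<phi> :: 'o \<Rightarrow> 'o \<Rightarrow> ('a \<Rightarrow> 'e) \<Rightarrow> 'a.
      (\<forall>X\<in>Obj (C_r R E C).
        natural_iso_contra R C (D_from R E C X) (Hom_to C (on_obj S X)) (\<phi> X)) \<and>
      (\<forall>X\<in>Obj (C_r R E C). \<forall>X'\<in>Obj (C_r R E C). \<forall>f\<in>carrier (Hom C X X').
        \<forall>Y\<in>Obj C. \<forall>\<theta>\<in>carrier (Matlis_dual R E (Hom C X Y)).
          \<phi> X' Y (on_mor (D_to R E C Y) X X' f \<theta>) =
          Comp C Y (on_obj S X) (on_obj S X') (on_hom S X X' f) (\<phi> X Y \<theta>)))"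

end

theory Submission
  imports Defs "HOL-Algebra.QuotRing"
begin

text \<open>A representation of \<open>D(X,-)\<close> by \<open>Z\<close> amounts to a linear form \<open>t\<close> on \<open>Hom(X,Z)\<close> for
  which every functional on \<open>Hom(X,Y)\<close> is \<open>f \<mapsto> t(gf)\<close> for a unique \<open>g\<close> in \<open>Hom(Y,Z)\<close>.
  Finitely generated modules being Matlis reflexive, \<open>t\<close> then represents \<open>D(-,Z)\<close> by \<open>X\<close> as
  well. Given two such forms \<open>t\<close> on \<open>Hom(X,Z)\<close> and \<open>t'\<close> on \<open>Hom(X',Z')\<close>, the relation
  \<open>t'(gh) = t(hf)\<close> for all \<open>h\<close> in \<open>Hom(X',Z)\<close> is thus a linear bijection, compatible with
  composition, between the \<open>f\<close> in \<open>Hom(X,X')\<close> and the \<open>g\<close> in \<open>Hom(Z,Z')\<close>. The Serre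
  functor is this bijection; its quasi-inverse is the same bijection read backwards.

  Reflexivity is proved by induction along a composition series. The inductive step needs that
  the part of \<open>E\<close> annihilated by a maximal ideal is one-dimensional, which is where the
  minimality of \<open>E\<close> enters.\<close>


section \<open>Submodules and finite length\<close>

text \<open>Reflexivity really depends on the size of \<open>E\<close>: over a field with
  \<open>E\<close> two-dimensional, the bidual of a line has dimension four. Minimality is used by
  contradiction: if \<open>E\<close> contained two independent lines killed by the same maximal
  ideal, some proper direct summand of \<open>E\<close> would contain one of them, avoid the other
  and still be an injective cogenerator. That summand comes from Zorn's lemma as a complement.
  Composition series exist because an artinian ring has finite length over itself; a finitely
  generated module is then reached by adjoining its generators one at a time. The natural
  isomorphisms in the theorem are given only abstractly. Each is replaced by the one functional that
  it sends to an identity morphism, so an arbitrary solution \<open>S\<close> is encoded by forms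
  just like the constructed one. This is why uniqueness and the equivalence can be proved for every
  solution. Different choices of representing objects are compared through the mates of identity
  morphisms, and every required equation between morphisms holds because both sides are mates of the
  same morphism.\<close>

definition adjoin :: "('r, 'x) ring_scheme \<Rightarrow> ('r, 'm, 'y) module_scheme \<Rightarrow> 'm set \<Rightarrow> 'm \<Rightarrow> 'm set"
  where "adjoin R M K x = {k \<oplus>\<^bsub>M\<^esub> a \<odot>\<^bsub>M\<^esub> x | k a. k \<in> K \<and> a \<in> carrier R}"

lemma adjoinI: "k \<in> K \<Longrightarrow> a \<in> carrier R \<Longrightarrow> k \<oplus>\<^bsub>M\<^esub> a \<odot>\<^bsub>M\<^esub> x \<in> adjoin R M K x"
  by (auto simp: adjoin_def)

lemma adjoinE:
  assumes "u \<in> adjoin R M K x"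
  obtains k a where "k \<in> K" "a \<in> carrier R" "u = k \<oplus>\<^bsub>M\<^esub> a \<odot>\<^bsub>M\<^esub> x"
  using assms by (auto simp: adjoin_def)

context module
begin

lemma submodule_carrier: "submodule H R M \<Longrightarrow> x \<in> H \<Longrightarrow> x \<in> carrier M"
  using submoduleE(1) by blast

lemma submodule_zero: "submodule H R M \<Longrightarrow> \<zero>\<^bsub>M\<^esub> \<in> H"
  by (metis equals0I smult_l_null R.zero_closed submoduleE(2,4) submodule_carrier)

lemma submodule_zero_set: "submodule {\<zero>\<^bsub>M\<^esub>} R M"
  by (rule submoduleI) auto

lemma submodule_adjoin:
  assumes K: "submodule K R M" and x: "x \<in> carrier M"
  shows "submodule (adjoin R M K x) R M"
proof (rule submoduleI)
  note c = submodule_carrier[OF K]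
  show "adjoin R M K x \<subseteq> carrier M" using x c by (auto simp: adjoin_def)
  show "\<zero>\<^bsub>M\<^esub> \<in> adjoin R M K x"
    using adjoinI[OF submodule_zero[OF K] R.zero_closed, of M x] x by simp
  fix u assume "u \<in> adjoin R M K x"
  then obtain k a where u: "k \<in> K" "a \<in> carrier R" "u = k \<oplus>\<^bsub>M\<^esub> a \<odot>\<^bsub>M\<^esub> x" by (rule adjoinE)
  show "\<ominus>\<^bsub>M\<^esub> u \<in> adjoin R M K x"
    using adjoinI[OF submoduleE(3)[OF K u(1)] R.a_inv_closed[OF u(2)], of M x] u x c
    by (simp add: M.minus_add smult_l_minus)
  show "b \<odot>\<^bsub>M\<^esub> u \<in> adjoin R M K x" if "b \<in> carrier R" for b
    using adjoinI[OF submoduleE(4)[OF K that u(1)] R.m_closed[OF that u(2)], of M x] u x c that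
    by (simp add: smult_r_distr smult_assoc1)
  fix v assume "v \<in> adjoin R M K x"
  then obtain l b where v: "l \<in> K" "b \<in> carrier R" "v = l \<oplus>\<^bsub>M\<^esub> b \<odot>\<^bsub>M\<^esub> x" by (rule adjoinE)
  show "u \<oplus>\<^bsub>M\<^esub> v \<in> adjoin R M K x"
    using adjoinI[OF submoduleE(5)[OF K u(1) v(1)] R.a_closed[OF u(2) v(2)], of M x] u v x c
    by (simp add: smult_l_distr M.a_ac)
qed

lemma subset_adjoin:
  assumes "submodule K R M" "x \<in> carrier M" shows "K \<subseteq> adjoin R M K x"
proof
  fix k assume "k \<in> K"
  then show "k \<in> adjoin R M K x"
    using adjoinI[of k K "\<zero>\<^bsub>R\<^esub>" R M x] assms submodule_carrier by simp
qed

lemma mem_adjoin: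
  assumes "submodule K R M" "x \<in> carrier M" shows "x \<in> adjoin R M K x"
  using adjoinI[of "\<zero>\<^bsub>M\<^esub>" K "\<one>\<^bsub>R\<^esub>" R M x] submodule_zero assms by simp

lemma adjoin_subset:
  assumes "submodule K R M" "K \<subseteq> L" "submodule L R M" "x \<in> L"
  shows "adjoin R M K x \<subseteq> L"
  using assms by (auto elim!: adjoinE intro!: submoduleE(5)[OF assms(3)] submoduleE(4)[OF assms(3)])

lemma adjoin_zero:
  assumes "x \<in> carrier M"
  shows "adjoin R M {\<zero>\<^bsub>M\<^esub>} x = (\<lambda>a. a \<odot>\<^bsub>M\<^esub> x) ` carrier R"
  using assms by (force simp: adjoin_def)

text \<open>Zorn's lemma with a general obstacle \<open>T\<close>. It yields maximal ideals
  (\<open>T\<close> consisting of the identity), hyperplanes (\<open>T\<close> consisting of a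
  vector and everything outside the space), and complements of a submodule (\<open>T\<close> being
  its nonzero elements).\<close>

lemma exists_maximal_submodule_avoiding:
  assumes "submodule A R M" and "A \<inter> T = {}"
  obtains H where "submodule H R M" "A \<subseteq> H" "H \<inter> T = {}"
    "\<And>H'. submodule H' R M \<Longrightarrow> H \<subset> H' \<Longrightarrow> H' \<inter> T \<noteq> {}"
proof -
  define P where "P H \<longleftrightarrow> submodule H R M \<and> A \<subseteq> H \<and> H \<inter> T = {}" for H
  have "P (\<Union>K)" if "K \<noteq> {}" and K: "subset.chain {H. P H} K" for K
  proof -
    have PK: "P H" if "H \<in> K" for H using K that by (auto simp: subset.chain_def)
    have sub: "submodule H R M" if "H \<in> K" for H using PK[OF that] by (simp add: P_def)
    have "submodule (\<Union>K) R M"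
    proof (rule submoduleI)
      show "\<Union>K \<subseteq> carrier M" using sub submodule_carrier by blast
      show "\<zero>\<^bsub>M\<^esub> \<in> \<Union>K" using sub submodule_zero \<open>K \<noteq> {}\<close> by blast
      show "\<ominus>\<^bsub>M\<^esub> a \<in> \<Union>K" if "a \<in> \<Union>K" for a using that sub submoduleE(3) by blast
      show "b \<odot>\<^bsub>M\<^esub> a \<in> \<Union>K" if "b \<in> carrier R" "a \<in> \<Union>K" for a b
        using that sub submoduleE(4) by blast
      fix a b assume "a \<in> \<Union>K" "b \<in> \<Union>K"
      then obtain H1 H2 where *: "H1 \<in> K" "a \<in> H1" "H2 \<in> K" "b \<in> H2" by auto
      have "H1 \<subseteq> H2 \<or> H2 \<subseteq> H1" using K * by (auto simp: subset_chain_def)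
      then obtain H3 where "H3 \<in> K" "a \<in> H3" "b \<in> H3" using * by auto
      then show "a \<oplus>\<^bsub>M\<^esub> b \<in> \<Union>K" using sub submoduleE(5) by blast
    qed
    moreover have "A \<subseteq> \<Union>K" using PK \<open>K \<noteq> {}\<close> unfolding P_def by blast
    moreover have "\<Union>K \<inter> T = {}" using PK unfolding P_def by blast
    ultimately show ?thesis by (simp add: P_def)
  qed
  moreover have "P A" using assms by (simp add: P_def)
  ultimately obtain H where "P H" and max: "\<And>H'. P H' \<Longrightarrow> H \<subseteq> H' \<Longrightarrow> H' = H"
    using subset_Zorn_nonempty[of "{H. P H}"] by auto
  show thesis
  proof (rule that)
    fix H' assume "submodule H' R M" "H \<subset> H'"
    then show "H' \<inter> T \<noteq> {}" using \<open>P H\<close> max[of H'] unfolding P_def by blast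
  qed (use \<open>P H\<close> in \<open>auto simp: P_def\<close>)
qed

end

text \<open>Composition series built from below. In each step the quotient of the new submodule by
  \<open>K\<close> is a quotient of \<open>R/P\<close>, hence simple or zero; since \<open>x\<close>
  may already lie in \<open>K\<close>, steps need not be strict.\<close>

inductive finite_length :: "('r, 'x) ring_scheme \<Rightarrow> ('r, 'm, 'y) module_scheme \<Rightarrow> 'm set \<Rightarrow> bool"
  for R M where
  zero: "finite_length R M {\<zero>\<^bsub>M\<^esub>}"
| adjoin: "\<lbrakk>finite_length R M K; x \<in> carrier M; maximalideal P R; \<And>a. a \<in> P \<Longrightarrow> a \<odot>\<^bsub>M\<^esub> x \<in> K\<rbrakk>
    \<Longrightarrow> finite_length R M (adjoin R M K x)"

lemma (in module) finite_length_submodule: "finite_length R M K \<Longrightarrow> submodule K R M"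
  by (induction rule: finite_length.induct) (auto intro: submodule_zero_set submodule_adjoin)

section \<open>Maximal ideals, and ideals as submodules of the ring\<close>

text \<open>Invertibility of \<open>a\<close> in the residue field, written out in \<open>R\<close>:
  by maximality \<open>Ra + P\<close> is the whole ring.\<close>

lemma (in cring) maximalideal_inverse:
  assumes P: "maximalideal P R" and a: "a \<in> carrier R" "a \<notin> P"
  obtains b c where "b \<in> carrier R" "c \<in> P" "b \<otimes> a \<oplus> c = \<one>"
proof -
  interpret P: maximalideal P R by fact
  have I: "ideal (PIdl a <+>\<^bsub>R\<^esub> P) R"
    using add_ideals cgenideal_ideal[OF a(1)] P.ideal_axioms by blast
  have "p \<in> PIdl a <+>\<^bsub>R\<^esub> P" if "p \<in> P" for p
    using that P.Icarr a unfolding set_add_def' cgenideal_def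
    by (auto intro!: exI[of _ "\<zero>"] bexI[of _ p] exI[of _ "\<zero> \<otimes> a"])
  moreover have "a \<in> PIdl a <+>\<^bsub>R\<^esub> P"
    using a P.zero_closed cgenideal_self[OF a(1)] unfolding set_add_def'
    by (intro UN_I[of a] UN_I[of "\<zero>"]) auto
  ultimately have "PIdl a <+>\<^bsub>R\<^esub> P = carrier R"
    using P.I_maximal[OF I] a(2) ideal.Icarr[OF I] by blast
  then have "\<one> \<in> PIdl a <+>\<^bsub>R\<^esub> P" by simp
  then show thesis using that unfolding set_add_def' cgenideal_def by auto
qed

lemma (in cring) maximalidealI_inverse:
  assumes P: "ideal P R" "\<one> \<notin> P"
    and inv: "\<And>a. a \<in> carrier R \<Longrightarrow> a \<notin> P \<Longrightarrow> \<exists>b\<in>carrier R. \<exists>c\<in>P. b \<otimes> a \<oplus> c = \<one>"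
  shows "maximalideal P R"
proof (rule maximalidealI[OF P(1)])
  show "carrier R \<noteq> P" using P(2) one_closed by blast
  fix J assume J: "ideal J R" "P \<subseteq> J" "J \<subseteq> carrier R"
  show "J = P \<or> J = carrier R"
  proof (rule disjCI)
    assume "J \<noteq> carrier R"
    then have "\<one> \<notin> J" using ideal.one_imp_carrier[OF J(1)] by blast
    have "a \<in> P" if a: "a \<in> J" for a
    proof (rule ccontr)
      assume "a \<notin> P"
      then obtain b c where "b \<in> carrier R" "c \<in> P" "b \<otimes> a \<oplus> c = \<one>" using inv a J(3) by blast
      moreover have "b \<otimes> a \<oplus> c \<in> J"
        using calculation J(2) ideal.I_l_closed[OF J(1) a]
          additive_subgroup.a_closed[OF ideal.axioms(1)[OF J(1)]] by blast
      ultimately show False using \<open>\<one> \<notin> J\<close> by simp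
    qed
    then show "J = P" using J(2) by blast
  qed
qed

text \<open>Restriction of scalars along \<open>h\<close>. The identity gives the regular module;
  the quotient map by \<open>P\<close> gives the simple module used in
  \<open>socle_at_nontrivial\<close>.\<close>

definition scalar_module ::
    "('r, 'x) ring_scheme \<Rightarrow> ('s, 'y) ring_scheme \<Rightarrow> ('r \<Rightarrow> 's) \<Rightarrow> ('r, 's) module"
  where "scalar_module R S h = \<lparr>carrier = carrier S, monoid.mult = mult S, one = one S,
    zero = zero S, add = add S, smult = (\<lambda>a x. h a \<otimes>\<^bsub>S\<^esub> x)\<rparr>"

lemma module_scalar_module:
  assumes "cring R" "cring S" "h \<in> ring_hom R S"
  shows "module R (scalar_module R S h)"
proof -
  interpret R: cring R by fact
  interpret S: cring S by fact
  note h = ring_hom_closed[OF assms(3)] ring_hom_add[OF assms(3)] ring_hom_mult[OF assms(3)]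
    ring_hom_one[OF assms(3)]
  show ?thesis
  proof (rule moduleI)
    show "abelian_group (scalar_module R S h)"
    proof (rule abelian_groupI)
      fix x assume "x \<in> carrier (scalar_module R S h)"
      then show "\<exists>y\<in>carrier (scalar_module R S h).
          y \<oplus>\<^bsub>scalar_module R S h\<^esub> x = \<zero>\<^bsub>scalar_module R S h\<^esub>"
        by (intro bexI[of _ "\<ominus>\<^bsub>S\<^esub> x"]) (auto simp: scalar_module_def S.l_neg)
    qed (auto simp: scalar_module_def S.a_ac)
  qed (auto simp: scalar_module_def h S.l_distr S.r_distr S.m_assoc R.cring_axioms)
qed

abbreviation regular_module :: "('r, 'x) ring_scheme \<Rightarrow> ('r, 'r) module"
  where "regular_module R \<equiv> scalar_module R R (\<lambda>a. a)"

context cring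
begin

lemma module_regular_module: "module R (regular_module R)"
  by (rule module_scalar_module) (auto simp: ring_hom_def intro: is_cring)

lemma regular_module_simps:
  "carrier (regular_module R) = carrier R" "\<zero>\<^bsub>regular_module R\<^esub> = \<zero>"
  "x \<oplus>\<^bsub>regular_module R\<^esub> y = x \<oplus> y" "a \<odot>\<^bsub>regular_module R\<^esub> x = a \<otimes> x"
  "\<ominus>\<^bsub>regular_module R\<^esub> x = \<ominus> x"
  by (simp_all add: scalar_module_def a_inv_def m_inv_def)

text \<open>Makes the submodule lemmas, \<open>adjoin\<close> and \<open>finite_length\<close>
  available for ideals.\<close>

lemma submodule_regular_iff: "submodule I R (regular_module R) \<longleftrightarrow> ideal I R"
proof
  interpret N: module R "regular_module R" by (rule module_regular_module)
  assume I: "submodule I R (regular_module R)"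
  note E = N.submoduleE[OF I, unfolded regular_module_simps]
  have r: "b \<otimes> a \<in> I" if "a \<in> I" "b \<in> carrier R" for a b using E(4) that by blast
  show "ideal I R"
  proof (rule idealI)
    show "subgroup I (add_monoid R)" by (rule add.subgroupI) (use E in auto)
    show "a \<otimes> b \<in> I" if "a \<in> I" "b \<in> carrier R" for a b
      using r[OF that] E(1) that by (metis m_comm subsetD)
  qed (use r in \<open>auto intro: ring_axioms\<close>)
next
  assume "ideal I R"
  then interpret I: ideal I R .
  interpret N: module R "regular_module R" by (rule module_regular_module)
  show "submodule I R (regular_module R)"
    by (rule N.submoduleI) (auto simp: regular_module_simps I.I_l_closed I.Icarr)
qed

lemma exists_maximalideal:
  assumes "ideal I R" "\<one> \<notin> I"
  obtains P where "maximalideal P R" "I \<subseteq> P"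
proof -
  interpret N: module R "regular_module R" by (rule module_regular_module)
  obtain P where P: "ideal P R" "I \<subseteq> P" "\<one> \<notin> P"
      and max: "\<And>J. ideal J R \<Longrightarrow> P \<subset> J \<Longrightarrow> \<one> \<in> J"
    using N.exists_maximal_submodule_avoiding[of I "{\<one>}"] assms
    by (auto simp: submodule_regular_iff)
  have "maximalideal P R"
  proof (rule maximalidealI[OF P(1)])
    show "carrier R \<noteq> P" using P(3) one_closed by blast
    fix J assume "ideal J R" "P \<subseteq> J" "J \<subseteq> carrier R"
    then show "J = P \<or> J = carrier R" using max[of J] ideal.one_imp_carrier by blast
  qed
  then show thesis using that P(2) by blast
qed

end

section \<open>Finite length of an artinian ring over itself\<close>

context artinian_cring
begin

text \<open>Otherwise dependent choice would produce an infinite strictly descending chain of ideals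
  satisfying \<open>Q\<close>.\<close>

lemma exists_minimal_ideal:
  assumes "ideal J R" "Q J"
  obtains I where "ideal I R" "Q I" "\<And>I'. ideal I' R \<Longrightarrow> I' \<subset> I \<Longrightarrow> \<not> Q I'"
proof (rule ccontr)
  assume "\<not> thesis"
  then have step: "\<exists>I'. (ideal I' R \<and> Q I') \<and> I' \<subset> I" if "ideal I R \<and> Q I" for I
    using that \<open>\<And>I. \<lbrakk>ideal I R; Q I; \<And>I'. \<lbrakk>ideal I' R; I' \<subset> I\<rbrakk> \<Longrightarrow> \<not> Q I'\<rbrakk> \<Longrightarrow> thesis\<close> by blast
  have "\<exists>F. \<forall>n. (ideal (F n) R \<and> Q (F n)) \<and> F (Suc n) \<subset> F n"
    by (rule dependent_nat_choice) (use assms step in auto)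
  then obtain F where F: "\<And>n. ideal (F n) R" "\<And>n. F (Suc n) \<subset> F n" by blast
  then obtain n where "\<forall>m\<ge>n. F m = F n" using ideal_dcc[of F] by (meson psubset_imp_subset)
  then have "F (Suc n) = F n" by (meson le_SucI order_refl)
  then show False using F(2)[of n] by simp
qed

text \<open>The descending chain of principal ideals generated by the powers of \<open>a\<close>
  becomes stationary. Where \<open>a\<close> acts surjectively, the resulting equation shows that
  \<open>b\<close> is an inverse action.\<close>

lemma power_stabilizes:
  assumes a: "a \<in> carrier R"
  obtains n b where "b \<in> carrier R" "a [^] (n::nat) = b \<otimes> a [^] Suc n"
proof -
  have "PIdl (a [^] Suc n) \<subseteq> PIdl (a [^] n)" for n :: nat
  proof
    fix y assume "y \<in> PIdl (a [^] Suc n)"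
    then obtain r where "r \<in> carrier R" "y = r \<otimes> a [^] Suc n" by (auto simp: cgenideal_def)
    then have "y = (r \<otimes> a) \<otimes> a [^] n" using a by (simp add: m_ac)
    then show "y \<in> PIdl (a [^] n)" using \<open>r \<in> carrier R\<close> a by (auto simp: cgenideal_def)
  qed
  then obtain n :: nat where "\<forall>m\<ge>n. PIdl (a [^] m) = PIdl (a [^] n)"
    using ideal_dcc[of "\<lambda>n. PIdl (a [^] n)"] a cgenideal_ideal by auto
  then have "a [^] n \<in> PIdl (a [^] Suc n)"
    using a cgenideal_self[of "a [^] n"] by (metis le_SucI nat_pow_closed order_refl)
  then show thesis using that[of _ n] by (auto simp: cgenideal_def)
qed

text \<open>A minimal ideal \<open>I\<close> of infinite length satisfies \<open>aI = I\<close> or \<open>aI = 0\<close> for each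
  \<open>a\<close>, as otherwise both the image and the kernel of multiplication by \<open>a\<close> on \<open>I\<close> have finite
  length. So its annihilator is maximal, and a hyperplane of the vector space \<open>I\<close> has finite
  length.\<close>

theorem finite_length_regular_module: "finite_length R (regular_module R) (carrier R)"
proof (rule ccontr)
  let ?M = "regular_module R"
  interpret N: module R ?M by (rule module_regular_module)
  note simps = regular_module_simps submodule_regular_iff
  assume "\<not> finite_length R ?M (carrier R)"
  then obtain I where I: "ideal I R" "\<not> finite_length R ?M I"
      and min: "\<And>J. ideal J R \<Longrightarrow> J \<subset> I \<Longrightarrow> finite_length R ?M J"
    by (rule exists_minimal_ideal[OF oneideal, of "\<lambda>J. \<not> finite_length R ?M J"]) blast+
  interpret I: ideal I R by fact
  define P where "P = {a \<in> carrier R. \<forall>y\<in>I. a \<otimes> y = \<zero>}"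
  have P: "ideal P R"
    unfolding submodule_regular_iff[symmetric]
    by (rule N.submoduleI)
      (auto simp: simps P_def I.Icarr l_distr l_minus m_assoc)
  have "I \<noteq> {\<zero>}" using I(2) finite_length.zero[of R ?M] by (auto simp: simps)
  then obtain x where x: "x \<in> I" "x \<noteq> \<zero>" using I.zero_closed by blast
  then have "\<one> \<notin> P" by (auto simp: P_def I.Icarr)
  have surj: "\<exists>z\<in>I. a \<otimes> z = y" if a: "a \<in> carrier R" "a \<notin> P" and y: "y \<in> I" for a y
  proof (rule ccontr)
    assume ny: "\<not> (\<exists>z\<in>I. a \<otimes> z = y)"
    define A where "A = {a \<otimes> z | z. z \<in> I}"
    have "ideal A R" unfolding submodule_regular_iff[symmetric]
    proof (rule N.submoduleI, unfold simps)
      show "A \<subseteq> carrier R" using a(1) by (auto simp: A_def I.Icarr)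
      show "\<zero> \<in> A" using a(1) by (auto simp: A_def intro!: exI[of _ \<zero>])
      fix u assume "u \<in> A"
      then obtain z where z: "z \<in> I" "u = a \<otimes> z" by (auto simp: A_def)
      show "\<ominus> u \<in> A" using z a(1)
        by (auto simp: A_def I.Icarr r_minus intro!: exI[of _ "\<ominus> z"])
      show "b \<otimes> u \<in> A" if "b \<in> carrier R" for b using z a(1) that
        by (auto simp: A_def I.Icarr m_lcomm I.I_l_closed intro!: exI[of _ "b \<otimes> z"])
      fix v assume "v \<in> A"
      then obtain w where w: "w \<in> I" "v = a \<otimes> w" by (auto simp: A_def)
      show "u \<oplus> v \<in> A" using z w a(1)
        by (auto simp: A_def I.Icarr r_distr intro!: exI[of _ "z \<oplus> w"])
    qed
    moreover have "A \<subset> I"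
    proof
      show "A \<subseteq> I" using a(1) by (auto simp: A_def I.I_l_closed)
      have "y \<notin> A" using ny by (auto simp: A_def)
      then show "A \<noteq> I" using y by blast
    qed
    ultimately have "finite_length R ?M A" using min by blast
    \<comment> \<open>The series of \<open>A = aI\<close> is pulled back along multiplication by
      \<open>a\<close>. The preimage of zero is the kernel, a proper subideal of \<open>I\<close>
      and so of finite length; a step from \<open>J\<close> to \<open>J + Rw\<close> is matched by
      adjoining some \<open>z\<close> in \<open>I\<close> with \<open>az = w\<close>. The guard
      \<open>J \<subseteq> A\<close> in the induction provides this \<open>z\<close>.\<close>
    then have "A \<subseteq> A \<Longrightarrow> finite_length R ?M {z \<in> I. a \<otimes> z \<in> A}"
      unfolding atomize_imp
    proof (induction rule: finite_length.induct[where P = "\<lambda>J. J \<subseteq> A \<longrightarrow> finite_length R ?M {z \<in> I. a \<otimes> z \<in> J}"])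
      case zero
      let ?K = "{z \<in> I. a \<otimes> z = \<zero>}"
      have "ideal ?K R" unfolding submodule_regular_iff[symmetric]
        by (rule N.submoduleI)
          (use a(1) in \<open>auto simp: simps I.Icarr r_distr r_minus m_lcomm I.I_l_closed\<close>)
      moreover have "?K \<subset> I" using a by (auto simp: P_def)
      ultimately show ?case using min by (simp add: simps)
    next
      case (adjoin J w Q)
      show ?case
      proof
        assume sub: "adjoin R ?M J w \<subseteq> A"
        have J: "submodule J R ?M" using adjoin.hyps(1) by (rule N.finite_length_submodule)
        have "w \<in> A" using N.mem_adjoin[OF J adjoin.hyps(2)] sub by blast
        then obtain z where z: "z \<in> I" "w = a \<otimes> z" by (auto simp: A_def)
        have "J \<subseteq> A" using N.subset_adjoin[OF J adjoin.hyps(2)] sub by blast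
        then have "finite_length R ?M {z \<in> I. a \<otimes> z \<in> J}" using adjoin.IH by blast
        then have "finite_length R ?M (adjoin R ?M {z \<in> I. a \<otimes> z \<in> J} z)"
        proof (rule finite_length.adjoin[OF _ _ adjoin.hyps(3)])
          show "z \<in> carrier ?M" using z by (simp add: simps I.Icarr)
          fix r assume r: "r \<in> Q"
          then have "r \<in> carrier R"
            using adjoin.hyps(3) maximalideal.axioms(1) ideal.Icarr by metis
          then show "r \<odot>\<^bsub>?M\<^esub> z \<in> {z \<in> I. a \<otimes> z \<in> J}"
            using adjoin.hyps(4)[OF r] z a(1) by (simp add: simps I.Icarr I.I_l_closed m_lcomm)
        qed
        also have "adjoin R ?M {z \<in> I. a \<otimes> z \<in> J} z = {z \<in> I. a \<otimes> z \<in> adjoin R ?M J w}"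
        proof (intro equalityI subsetI)
          fix u assume "u \<in> adjoin R ?M {z \<in> I. a \<otimes> z \<in> J} z"
          then obtain k r where "k \<in> I" "a \<otimes> k \<in> J" "r \<in> carrier R" "u = k \<oplus> r \<otimes> z"
            by (auto elim!: adjoinE simp: simps)
          moreover from this have "a \<otimes> u = a \<otimes> k \<oplus> r \<otimes> w"
            using z a(1) by (simp add: I.Icarr r_distr m_lcomm)
          ultimately show "u \<in> {z \<in> I. a \<otimes> z \<in> adjoin R ?M J w}"
            using z adjoinI[of "a \<otimes> k" J r R ?M w] by (simp add: simps I.I_l_closed)
        next
          fix u assume u: "u \<in> {z \<in> I. a \<otimes> z \<in> adjoin R ?M J w}"
          then obtain k r where k: "k \<in> J" "r \<in> carrier R" "a \<otimes> u = k \<oplus> r \<otimes> w"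
            by (auto elim!: adjoinE simp: simps)
          have "k \<in> carrier R" using N.submodule_carrier[OF J k(1)] by (simp add: simps)
          let ?k = "u \<ominus> r \<otimes> z"
          have kI: "?k \<in> I" using u k z by (simp add: minus_eq I.I_l_closed)
          have "a \<otimes> ?k = k" using u k z a(1) \<open>k \<in> carrier R\<close>
            by (simp add: minus_eq r_distr r_minus I.Icarr m_lcomm a_assoc r_neg)
          moreover have "u = ?k \<oplus> r \<otimes> z" using u k z by (simp add: minus_eq I.Icarr a_assoc l_neg)
          ultimately show "u \<in> adjoin R ?M {z \<in> I. a \<otimes> z \<in> J} z"
            using adjoinI[of ?k "{z \<in> I. a \<otimes> z \<in> J}" r R ?M z] kI k by (simp add: simps)
        qed
        finally show "finite_length R ?M {z \<in> I. a \<otimes> z \<in> adjoin R ?M J w}" .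
      qed
    qed
    moreover have "{z \<in> I. a \<otimes> z \<in> A} = I" by (auto simp: A_def)
    ultimately show False using I(2) by simp
  qed
  have maxP: "maximalideal P R"
  proof (rule maximalidealI_inverse[OF P \<open>\<one> \<notin> P\<close>])
    fix a assume a: "a \<in> carrier R" "a \<notin> P"
    obtain n b where b: "b \<in> carrier R" "a [^] (n::nat) = b \<otimes> a [^] Suc n"
      using power_stabilizes[OF a(1)] .
    have surj_pow: "\<exists>z\<in>I. a [^] (k::nat) \<otimes> z = y" if "y \<in> I" for k y
      using that
    proof (induction k arbitrary: y)
      case 0 then show ?case by (auto simp: I.Icarr intro!: bexI[of _ y])
    next
      case (Suc k)
      obtain z where z: "z \<in> I" "a [^] k \<otimes> z = y" using Suc by blast
      obtain w where "w \<in> I" "a \<otimes> w = z" using surj[OF a z(1)] by blast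
      then show ?case using z a(1) by (auto simp: I.Icarr m_assoc intro!: bexI[of _ w])
    qed
    \<comment> \<open>Each \<open>y\<close> in \<open>I\<close> has the form \<open>a^n z\<close>,
      and \<open>b a^(n+1) = a^n\<close>, so \<open>ba\<close> fixes \<open>y\<close>. Hence
      \<open>1 - ba\<close> annihilates \<open>I\<close> and \<open>b\<close> inverts
      \<open>a\<close> modulo \<open>P\<close>.\<close>
    let ?c = "\<one> \<ominus> b \<otimes> a"
    have "?c \<otimes> y = \<zero>" if y: "y \<in> I" for y
    proof -
      obtain z where z: "z \<in> I" "a [^] n \<otimes> z = y" using surj_pow[OF y] by blast
      have "(b \<otimes> a) \<otimes> a [^] n = a [^] n" using b a(1) by (metis m_assoc m_comm nat_pow_Suc nat_pow_closed)
      then have "(b \<otimes> a) \<otimes> y = y" using z a(1) b(1) by (metis I.Icarr m_assoc m_closed nat_pow_closed)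
      then show ?thesis using y a(1) b(1) by (simp add: minus_eq l_distr l_minus I.Icarr r_neg)
    qed
    then have "?c \<in> P" using a(1) b(1) by (simp add: P_def)
    moreover have "b \<otimes> a \<oplus> ?c = \<one>" using a(1) b(1) by (simp add: minus_eq a_ac r_neg r_neg2)
    ultimately show "\<exists>b\<in>carrier R. \<exists>c\<in>P. b \<otimes> a \<oplus> c = \<one>" using b(1) by blast
  qed
  \<comment> \<open>Avoiding the complement of \<open>I\<close> keeps \<open>H\<close> inside
    \<open>I\<close>; avoiding \<open>x\<close> as well makes a maximal such \<open>H\<close> a
    hyperplane of the vector space \<open>I\<close> over \<open>R/P\<close>.\<close>
  have "ideal {\<zero>} R" and "{\<zero>} \<inter> insert x (carrier R - I) = {}"
    using zeroideal x by (auto simp: simps)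
  then obtain H where H: "ideal H R" "{\<zero>} \<subseteq> H" "H \<inter> insert x (carrier R - I) = {}"
      and maxH: "\<And>H'. ideal H' R \<Longrightarrow> H \<subset> H' \<Longrightarrow> H' \<inter> insert x (carrier R - I) \<noteq> {}"
    by (rule N.exists_maximal_submodule_avoiding[unfolded submodule_regular_iff]) blast
  have HI: "H \<subseteq> I" using H ideal.Icarr[OF H(1)] by blast
  have subH: "submodule H R ?M" using H(1) by (simp add: simps)
  have "finite_length R ?M H" using min[OF H(1)] HI H(3) x(1) by blast
  then have "finite_length R ?M (adjoin R ?M H x)"
  proof (rule finite_length.adjoin[OF _ _ maxP])
    fix r assume "r \<in> P"
    then show "r \<odot>\<^bsub>?M\<^esub> x \<in> H" using x N.submodule_zero[OF subH] by (simp add: simps P_def)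
  qed (use x in \<open>simp add: simps I.Icarr\<close>)
  also have "adjoin R ?M H x = I"
  proof (intro equalityI subsetI)
    fix u assume "u \<in> adjoin R ?M H x"
    then show "u \<in> I" using N.adjoin_subset[OF subH HI _ x(1)] I(1) by (auto simp: simps)
  next
    fix y assume y: "y \<in> I"
    have yc: "y \<in> carrier ?M" and xc: "x \<in> carrier ?M" using x y by (simp_all add: simps I.Icarr)
    show "y \<in> adjoin R ?M H x"
    proof (cases "y \<in> H")
      case True then show ?thesis using N.subset_adjoin[OF subH xc] by blast
    next
      case False
      have "H \<subset> adjoin R ?M H y"
        using N.subset_adjoin[OF subH yc] N.mem_adjoin[OF subH yc] False by blast
      moreover have "adjoin R ?M H y \<subseteq> I"
        using N.adjoin_subset[OF subH HI _ y] I(1) by (simp add: simps)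
      ultimately have "x \<in> adjoin R ?M H y"
        using maxH[of "adjoin R ?M H y"] N.submodule_adjoin[OF subH yc] by (auto simp: simps)
      then obtain h r where hr: "h \<in> H" "r \<in> carrier R" "x = h \<oplus> r \<otimes> y"
        by (auto elim!: adjoinE simp: simps)
      have hc: "h \<in> carrier R" using hr(1) HI I.Icarr by blast
      \<comment> \<open>Otherwise \<open>r\<close> would kill \<open>y\<close> and
        \<open>x = h\<close> would lie in \<open>H\<close>. So \<open>r\<close> is invertible modulo
        \<open>P\<close>, which annihilates \<open>I\<close>, and \<open>x = h + ry\<close> can be
        solved for \<open>y\<close>.\<close>
      have "r \<notin> P" using hr H(3) y hc by (auto simp: P_def)
      then obtain b c where bc: "b \<in> carrier R" "c \<in> P" "b \<otimes> r \<oplus> c = \<one>"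
        using maximalideal_inverse[OF maxP hr(2)] by blast
      have cc: "c \<in> carrier R" using bc(2) by (simp add: P_def)
      have "y = (b \<otimes> r \<oplus> c) \<otimes> y" using bc(3) y by (simp add: I.Icarr)
      also have "\<dots> = b \<otimes> (r \<otimes> y)"
        using bc(1,2) y hr(2) cc by (simp add: l_distr I.Icarr m_assoc P_def)
      also have "r \<otimes> y = \<ominus> h \<oplus> x" using hr hc y by (simp add: I.Icarr r_neg1)
      also have "b \<otimes> \<dots> = (\<ominus> b) \<otimes> h \<oplus> b \<otimes> x"
        using bc(1) hc x(1) by (simp add: I.Icarr r_distr l_minus r_minus)
      finally show ?thesis
        using adjoinI[of "(\<ominus> b) \<otimes> h" H b R ?M x] bc(1) ideal.I_l_closed[OF H(1) hr(1)]
        by (simp add: simps)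
    qed
  qed
  finally show False using I(2) by simp
qed

end

section \<open>Finite length of finitely generated modules\<close>

context module
begin

text \<open>A series of \<open>J\<close> is transferred to the module: the step from
  \<open>J\<close> to \<open>J + Ry\<close> becomes the step adjoining \<open>yx\<close> to
  \<open>K + Jx\<close>. With \<open>J\<close> the whole ring, \<open>K + Rx\<close> has finite
  length for arbitrary \<open>x\<close>, whereas the introduction rule demands that a maximal ideal
  carry \<open>x\<close> into \<open>K\<close>.\<close>

lemma finite_length_adjoin_multiples:
  assumes K: "finite_length R M K" and x: "x \<in> carrier M"
    and J: "finite_length R (regular_module R) J"
  shows "finite_length R M {k \<oplus>\<^bsub>M\<^esub> a \<odot>\<^bsub>M\<^esub> x | k a. k \<in> K \<and> a \<in> J}"
  using J
proof (induction rule: finite_length.induct)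
  case zero
  have "{k \<oplus>\<^bsub>M\<^esub> a \<odot>\<^bsub>M\<^esub> x | k a. k \<in> K \<and> a \<in> {\<zero>\<^bsub>regular_module R\<^esub>}} = K"
    using x submodule_carrier[OF finite_length_submodule[OF K]] by (force simp: R.regular_module_simps)
  then show ?case using K by simp
next
  case (adjoin J y P)
  let ?L = "\<lambda>J. {k \<oplus>\<^bsub>M\<^esub> a \<odot>\<^bsub>M\<^esub> x | k a. k \<in> K \<and> a \<in> J}"
  interpret N: module R "regular_module R" by (rule R.module_regular_module)
  have y: "y \<in> carrier R" using adjoin.hyps by (simp add: R.regular_module_simps)
  have Kc: "k \<in> carrier M" if "k \<in> K" for k
    using that submodule_carrier[OF finite_length_submodule[OF K]] by simp
  have Jc: "j \<in> carrier R" if "j \<in> J" for j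
    using N.submodule_carrier[OF N.finite_length_submodule[OF adjoin.hyps(1)] that]
    by (simp add: R.regular_module_simps)
  have "finite_length R M (adjoin R M (?L J) (y \<odot>\<^bsub>M\<^esub> x))"
  proof (rule finite_length.adjoin[OF adjoin.IH _ adjoin.hyps(3)])
    show "y \<odot>\<^bsub>M\<^esub> x \<in> carrier M" using y x by simp
    fix a assume a: "a \<in> P"
    then have "a \<in> carrier R" using adjoin.hyps(3) maximalideal.axioms(1) ideal.Icarr by metis
    then have "a \<odot>\<^bsub>M\<^esub> (y \<odot>\<^bsub>M\<^esub> x) = \<zero>\<^bsub>M\<^esub> \<oplus>\<^bsub>M\<^esub> (a \<otimes>\<^bsub>R\<^esub> y) \<odot>\<^bsub>M\<^esub> x"
      using y x by (simp add: smult_assoc1)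
    then show "a \<odot>\<^bsub>M\<^esub> (y \<odot>\<^bsub>M\<^esub> x) \<in> ?L J"
      using adjoin.hyps(4)[OF a] submodule_zero[OF finite_length_submodule[OF K]]
      by (auto simp: R.regular_module_simps)
  qed
  also have "adjoin R M (?L J) (y \<odot>\<^bsub>M\<^esub> x) = ?L (adjoin R (regular_module R) J y)"
  proof (intro equalityI subsetI)
    fix u assume "u \<in> adjoin R M (?L J) (y \<odot>\<^bsub>M\<^esub> x)"
    then obtain k j a where *: "k \<in> K" "j \<in> J" "a \<in> carrier R"
        "u = (k \<oplus>\<^bsub>M\<^esub> j \<odot>\<^bsub>M\<^esub> x) \<oplus>\<^bsub>M\<^esub> a \<odot>\<^bsub>M\<^esub> (y \<odot>\<^bsub>M\<^esub> x)"
      by (auto elim!: adjoinE)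
    then have "u = k \<oplus>\<^bsub>M\<^esub> (j \<oplus>\<^bsub>R\<^esub> a \<otimes>\<^bsub>R\<^esub> y) \<odot>\<^bsub>M\<^esub> x"
      using x y by (simp add: Kc Jc smult_l_distr smult_assoc1 M.a_assoc)
    then show "u \<in> ?L (adjoin R (regular_module R) J y)"
      using * adjoinI[of j J a R "regular_module R" y] by (auto simp: R.regular_module_simps)
  next
    fix u assume "u \<in> ?L (adjoin R (regular_module R) J y)"
    then obtain k j a where *: "k \<in> K" "j \<in> J" "a \<in> carrier R"
        "u = k \<oplus>\<^bsub>M\<^esub> (j \<oplus>\<^bsub>R\<^esub> a \<otimes>\<^bsub>R\<^esub> y) \<odot>\<^bsub>M\<^esub> x"
      by (auto elim!: adjoinE simp: R.regular_module_simps)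
    then have "u = (k \<oplus>\<^bsub>M\<^esub> j \<odot>\<^bsub>M\<^esub> x) \<oplus>\<^bsub>M\<^esub> a \<odot>\<^bsub>M\<^esub> (y \<odot>\<^bsub>M\<^esub> x)"
      using x y by (simp add: Kc Jc smult_l_distr smult_assoc1 M.a_assoc)
    then show "u \<in> adjoin R M (?L J) (y \<odot>\<^bsub>M\<^esub> x)"
      using * adjoinI[of "k \<oplus>\<^bsub>M\<^esub> j \<odot>\<^bsub>M\<^esub> x" "?L J" a R M "y \<odot>\<^bsub>M\<^esub> x"] by auto
  qed
  finally show ?case .
qed

lemma submodule_finsum:
  assumes H: "submodule H R M" and "finite A" and "\<And>a. a \<in> A \<Longrightarrow> f a \<in> H"
  shows "(\<Oplus>\<^bsub>M\<^esub>a\<in>A. f a) \<in> H"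
  using assms(2,3)
proof (induction A)
  case empty then show ?case using submodule_zero[OF H] by simp
next
  case (insert a A)
  then show ?case
    using submoduleE(5)[OF H] submodule_carrier[OF H]
    by (subst M.finsum_insert) (auto simp: Pi_iff)
qed

end

theorem finitely_generated_finite_length:
  assumes "artinian_cring R" and fg: "finitely_generated_module R M"
  shows "finite_length R M (carrier M)"
proof -
  interpret artinian_cring R by fact
  interpret module R M using fg by (simp add: finitely_generated_module_def)
  obtain A where A: "finite A" "A \<subseteq> carrier M"
      and gen: "\<And>x. x \<in> carrier M \<Longrightarrow> \<exists>c\<in>A \<rightarrow> carrier R. x = (\<Oplus>\<^bsub>M\<^esub>a\<in>A. c a \<odot>\<^bsub>M\<^esub> a)"
    using fg unfolding finitely_generated_module_def by blast
  have "\<exists>K. finite_length R M K \<and> A \<subseteq> K" using A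
  proof (induction A)
    case empty then show ?case using finite_length.zero by blast
  next
    case (insert x A)
    then obtain K where K: "finite_length R M K" "A \<subseteq> K" by auto
    have x: "x \<in> carrier M" using insert.prems by simp
    note sub = finite_length_submodule[OF K(1)]
    have "finite_length R M (adjoin R M K x)"
      using finite_length_adjoin_multiples[OF K(1) x finite_length_regular_module]
      by (simp add: adjoin_def)
    then show ?case using K(2) subset_adjoin[OF sub x] mem_adjoin[OF sub x] by blast
  qed
  then obtain K where K: "finite_length R M K" "A \<subseteq> K" by blast
  note sub = finite_length_submodule[OF K(1)]
  have "x \<in> K" if x: "x \<in> carrier M" for x
  proof -
    obtain c where "c \<in> A \<rightarrow> carrier R" "x = (\<Oplus>\<^bsub>M\<^esub>a\<in>A. c a \<odot>\<^bsub>M\<^esub> a)" using gen[OF x] by blast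
    moreover from this have "c a \<odot>\<^bsub>M\<^esub> a \<in> K" if "a \<in> A" for a
      using that K(2) submoduleE(4)[OF sub] by blast
    ultimately show ?thesis using submodule_finsum[OF sub A(1)] by simp
  qed
  then have "K = carrier M" using submodule_carrier[OF sub] by blast
  then show ?thesis using K(1) by simp
qed

lemma (in abelian_group) minus_eq_zero_iff:
  assumes "x \<in> carrier G" "y \<in> carrier G"
  shows "x \<ominus> y = \<zero> \<longleftrightarrow> x = y"
proof
  assume "x \<ominus> y = \<zero>"
  then show "x = y" using assms by (metis minus_eq add.inv_closed add.inv_inv minus_equality)
qed (use assms in \<open>simp add: minus_eq r_neg\<close>)


section \<open>Extension of linear maps into injective modules\<close>

text \<open>A partial linear map is given as a graph, so it can be prescribed on sums of submodules
  without choosing decompositions. By additivity, single-valuedness has to be checked only over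
  zero.\<close>

lemma injective_module_graph_extend:
  assumes inj: "injective_module R E" and M: "module R M"
    and G: "G \<subseteq> carrier M \<times> carrier E" "(\<zero>\<^bsub>M\<^esub>, \<zero>\<^bsub>E\<^esub>) \<in> G"
    and add: "\<And>x y x' y'. (x, y) \<in> G \<Longrightarrow> (x', y') \<in> G \<Longrightarrow> (x \<oplus>\<^bsub>M\<^esub> x', y \<oplus>\<^bsub>E\<^esub> y') \<in> G"
    and smult: "\<And>a x y. a \<in> carrier R \<Longrightarrow> (x, y) \<in> G \<Longrightarrow> (a \<odot>\<^bsub>M\<^esub> x, a \<odot>\<^bsub>E\<^esub> y) \<in> G"
    and single: "\<And>y. (\<zero>\<^bsub>M\<^esub>, y) \<in> G \<Longrightarrow> y = \<zero>\<^bsub>E\<^esub>"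
  obtains f where "f \<in> mod_hom R M E" "\<And>x y. (x, y) \<in> G \<Longrightarrow> f x = y"
proof -
  interpret M: module R M by fact
  interpret E: module R E using inj by (simp add: injective_module_def)
  have c: "x \<in> carrier M" "y \<in> carrier E" if "(x, y) \<in> G" for x y using that G(1) by auto
  have neg: "(\<ominus>\<^bsub>M\<^esub> x, \<ominus>\<^bsub>E\<^esub> y) \<in> G" if "(x, y) \<in> G" for x y
    using smult[OF _ that, of "\<ominus>\<^bsub>R\<^esub> \<one>\<^bsub>R\<^esub>"] c[OF that] by (simp add: M.smult_l_minus E.smult_l_minus)
  have uniq: "y = y'" if "(x, y) \<in> G" "(x, y') \<in> G" for x y y'
  proof -
    have "(\<zero>\<^bsub>M\<^esub>, y \<oplus>\<^bsub>E\<^esub> \<ominus>\<^bsub>E\<^esub> y') \<in> G"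
      using add[OF that(1) neg[OF that(2)]] c[OF that(1)] by (simp add: M.M.r_neg)
    then have "y \<ominus>\<^bsub>E\<^esub> y' = \<zero>\<^bsub>E\<^esub>" using single by (simp add: E.M.minus_eq)
    then show ?thesis using c that by (simp add: E.M.minus_eq_zero_iff)
  qed
  define f where "f x = (THE y. (x, y) \<in> G)" for x
  have f_eq: "f x = y" if "(x, y) \<in> G" for x y using that uniq by (auto simp: f_def)
  have "submodule (Domain G) R M"
  proof (rule M.submoduleI)
    show "x \<oplus>\<^bsub>M\<^esub> y \<in> Domain G" if "x \<in> Domain G" "y \<in> Domain G" for x y
      using that add by (meson DomainE DomainI)
    show "a \<odot>\<^bsub>M\<^esub> x \<in> Domain G" if "a \<in> carrier R" "x \<in> Domain G" for a x
      using that smult by (meson DomainE DomainI)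
    show "\<ominus>\<^bsub>M\<^esub> x \<in> Domain G" if "x \<in> Domain G" for x
      using that neg by (meson DomainE DomainI)
  qed (use G in auto)
  then have sub: "module R (M\<lparr>carrier := Domain G\<rparr>)"
    using submodule.submodule_is_module M by blast
  have "f \<in> mod_hom R (M\<lparr>carrier := Domain G\<rparr>) E"
    using c(2) f_eq f_eq[OF add] f_eq[OF smult] by (fastforce simp: mod_hom_def)
  moreover have "(\<lambda>x. x) \<in> mod_hom R (M\<lparr>carrier := Domain G\<rparr>) M"
    using c(1) by (auto simp: mod_hom_def)
  ultimately obtain g where "g \<in> mod_hom R M E" "\<forall>x\<in>Domain G. g x = f x"
    using injective_module_extend[OF inj sub M, of "\<lambda>x. x" f] by auto
  then show thesis using that[of g] f_eq by blast
qed

text \<open>The map on \<open>K + Rx\<close> killing \<open>K\<close> and sending \<open>x\<close>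
  to \<open>e\<close> is well defined because every scalar that carries \<open>x\<close> into
  \<open>K\<close> kills \<open>e\<close>.\<close>

lemma injective_module_adjoin_extend:
  assumes inj: "injective_module R E" and M: "module R M"
    and K: "submodule K R M" and x: "x \<in> carrier M" and e: "e \<in> carrier E"
    and ann: "\<And>a. a \<in> carrier R \<Longrightarrow> a \<odot>\<^bsub>M\<^esub> x \<in> K \<Longrightarrow> a \<odot>\<^bsub>E\<^esub> e = \<zero>\<^bsub>E\<^esub>"
  obtains f where "f \<in> mod_hom R M E" "\<And>k. k \<in> K \<Longrightarrow> f k = \<zero>\<^bsub>E\<^esub>" "f x = e"
proof -
  interpret M: module R M by fact
  interpret E: module R E using inj by (simp add: injective_module_def)
  note Kc = M.submodule_carrier[OF K] and KE = M.submoduleE[OF K]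
  let ?g = "\<lambda>k a. (k \<oplus>\<^bsub>M\<^esub> a \<odot>\<^bsub>M\<^esub> x, a \<odot>\<^bsub>E\<^esub> e)"
  define G where "G = {?g k a | k a. k \<in> K \<and> a \<in> carrier R}"
  have GI: "?g k a \<in> G" if "k \<in> K" "a \<in> carrier R" for k a using that by (auto simp: G_def)
  obtain f where f: "f \<in> mod_hom R M E" "\<And>x y. (x, y) \<in> G \<Longrightarrow> f x = y"
  proof (rule injective_module_graph_extend[OF inj M, of G])
    show "G \<subseteq> carrier M \<times> carrier E" using x e Kc by (auto simp: G_def)
    show "(\<zero>\<^bsub>M\<^esub>, \<zero>\<^bsub>E\<^esub>) \<in> G" using GI[OF M.submodule_zero[OF K] M.R.zero_closed] x e by simp
    fix u v assume "(u, v) \<in> G"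
    then obtain k a where u: "k \<in> K" "a \<in> carrier R" "u = k \<oplus>\<^bsub>M\<^esub> a \<odot>\<^bsub>M\<^esub> x" "v = a \<odot>\<^bsub>E\<^esub> e"
      by (auto simp: G_def)
    show "(b \<odot>\<^bsub>M\<^esub> u, b \<odot>\<^bsub>E\<^esub> v) \<in> G" if "b \<in> carrier R" for b
      using GI[OF KE(4)[OF that u(1)] M.R.m_closed[OF that u(2)]] u x e that Kc
      by (simp add: M.smult_r_distr M.smult_assoc1 E.smult_assoc1)
    fix u' v' assume "(u', v') \<in> G"
    then obtain l b where u': "l \<in> K" "b \<in> carrier R" "u' = l \<oplus>\<^bsub>M\<^esub> b \<odot>\<^bsub>M\<^esub> x" "v' = b \<odot>\<^bsub>E\<^esub> e"
      by (auto simp: G_def)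
    show "(u \<oplus>\<^bsub>M\<^esub> u', v \<oplus>\<^bsub>E\<^esub> v') \<in> G"
      using GI[OF KE(5)[OF u(1) u'(1)] M.R.a_closed[OF u(2) u'(2)]] u u' x e Kc
      by (simp add: M.smult_l_distr E.smult_l_distr M.M.a_ac)
  next
    fix v assume "(\<zero>\<^bsub>M\<^esub>, v) \<in> G"
    then obtain k a where u: "k \<in> K" "a \<in> carrier R" "k \<oplus>\<^bsub>M\<^esub> a \<odot>\<^bsub>M\<^esub> x = \<zero>\<^bsub>M\<^esub>" "v = a \<odot>\<^bsub>E\<^esub> e"
      by (auto simp: G_def)
    then have "a \<odot>\<^bsub>M\<^esub> x = \<ominus>\<^bsub>M\<^esub> k"
      using x Kc by (metis M.M.add.inv_equality M.M.add.m_comm M.smult_closed)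
    then show "v = \<zero>\<^bsub>E\<^esub>" using ann u KE(3) by simp
  qed blast
  show thesis
  proof (rule that[OF f(1)])
    show "f k = \<zero>\<^bsub>E\<^esub>" if "k \<in> K" for k
      using f(2)[OF GI[OF that M.R.zero_closed]] x e Kc that by simp
    show "f x = e" using f(2)[OF GI[OF M.submodule_zero[OF K] M.R.one_closed]] x e by simp
  qed
qed


section \<open>Socles of injective cogenerators\<close>

text \<open>For maximal \<open>P\<close> this is the part of the socle of type \<open>R/P\<close>, a
  copy of \<open>Hom(R/P, M)\<close> and a vector space over \<open>R/P\<close>.\<close>

definition socle_at :: "('r, 'x) ring_scheme \<Rightarrow> ('r, 'm, 'y) module_scheme \<Rightarrow> 'r set \<Rightarrow> 'm set"
  where "socle_at R M P = {u \<in> carrier M. \<forall>a\<in>P. a \<odot>\<^bsub>M\<^esub> u = \<zero>\<^bsub>M\<^esub>}"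

text \<open>The cogenerator property gives a functional on \<open>R/P\<close> that does not vanish
  at the class of one; its value there is killed by \<open>P\<close>.\<close>

lemma socle_at_nontrivial:
  assumes E: "injective_cogenerator R E" and "cring R" and P: "maximalideal P R"
  obtains e where "e \<in> socle_at R E P" "e \<noteq> \<zero>\<^bsub>E\<^esub>"
proof -
  interpret R: cring R by fact
  interpret P: maximalideal P R by fact
  let ?M = "scalar_module R (R Quot P) ((+>\<^bsub>R\<^esub>) P)"
  have M: "module R ?M"
    by (rule module_scalar_module[OF \<open>cring R\<close> P.quotient_is_cring[OF \<open>cring R\<close>] P.rcos_ring_hom])
  interpret M: module R ?M by fact
  interpret E: module R E using E by (simp add: injective_cogenerator_def injective_module_def)
  let ?x = "P +>\<^bsub>R\<^esub> \<one>\<^bsub>R\<^esub>"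
  have x: "?x \<in> carrier ?M"
    using P.rcos_ring_hom by (auto simp: scalar_module_def dest: ring_hom_closed)
  have "?x \<noteq> P" using P.I_notcarr P.one_imp_carrier P.rcos_const_imp_mem by blast
  then have "?x \<noteq> \<zero>\<^bsub>?M\<^esub>" by (simp add: scalar_module_def FactRing_def)
  then obtain f where f: "f \<in> mod_hom R ?M E" "f ?x \<noteq> \<zero>\<^bsub>E\<^esub>"
    using injective_cogenerator_separate[OF E M x] by blast
  have "a \<odot>\<^bsub>E\<^esub> f ?x = \<zero>\<^bsub>E\<^esub>" if a: "a \<in> P" for a
  proof -
    have "a \<odot>\<^bsub>?M\<^esub> ?x = P"
      using a ring_hom_mult[OF P.rcos_ring_hom, of a "\<one>\<^bsub>R\<^esub>"] P.a_rcos_const[OF a]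
      by (simp add: scalar_module_def P.Icarr)
    \<comment> \<open>As a coset, \<open>P\<close> is the zero of \<open>R/P\<close>; written as a
      zero multiple of \<open>?x\<close>, it is carried to zero by the linearity of
      \<open>f\<close>.\<close>
    also have "P = \<zero>\<^bsub>R\<^esub> \<odot>\<^bsub>?M\<^esub> ?x"
      using M.smult_l_null[OF x] by (simp add: scalar_module_def FactRing_def)
    finally have "a \<odot>\<^bsub>?M\<^esub> ?x = \<zero>\<^bsub>R\<^esub> \<odot>\<^bsub>?M\<^esub> ?x" .
    moreover have "f (b \<odot>\<^bsub>?M\<^esub> ?x) = b \<odot>\<^bsub>E\<^esub> f ?x" if "b \<in> carrier R" for b
      using f(1) x that unfolding mod_hom_def by blast
    moreover have "f ?x \<in> carrier E" using f(1) x unfolding mod_hom_def by blast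
    ultimately have "a \<odot>\<^bsub>E\<^esub> f ?x = \<zero>\<^bsub>R\<^esub> \<odot>\<^bsub>E\<^esub> f ?x" "f ?x \<in> carrier E"
      using P.Icarr[OF a] by (metis R.zero_closed)+
    then show ?thesis by simp
  qed
  then show thesis using that[of "f ?x"] f x by (auto simp: socle_at_def mod_hom_def)
qed

text \<open>The annihilator of a nonzero \<open>x\<close> lies in some maximal ideal
  \<open>P\<close>, so \<open>x\<close> may be sent to any element killed by \<open>P\<close>; a
  nonzero one is taken and the map extended by injectivity. This criterion is what makes the summand
  in \<open>socle_at_cyclic\<close> a cogenerator.\<close>

lemma cogenerator_moduleI_socle_at:
  assumes inj: "injective_module R E"
    and soc: "\<And>P. maximalideal P R \<Longrightarrow> socle_at R E P \<noteq> {\<zero>\<^bsub>E\<^esub>}"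
  shows "cogenerator_module R E"
  unfolding cogenerator_module_def
proof (intro conjI allI impI)
  show "module R E" using inj by (simp add: injective_module_def)
  then interpret E: module R E .
  fix M :: "('a, 'a set) module" and x
  assume *: "module R M \<and> x \<in> carrier M \<and> x \<noteq> \<zero>\<^bsub>M\<^esub>"
  interpret M: module R M using * by simp
  define I where "I = {a \<in> carrier R. a \<odot>\<^bsub>M\<^esub> x = \<zero>\<^bsub>M\<^esub>}"
  interpret N: module R "regular_module R" by (rule E.R.module_regular_module)
  have "ideal I R" unfolding E.R.submodule_regular_iff[symmetric]
    by (rule N.submoduleI)
      (use * in \<open>auto simp: E.R.regular_module_simps I_def M.smult_l_distr M.smult_l_minus M.smult_assoc1\<close>)
  moreover have "\<one>\<^bsub>R\<^esub> \<notin> I" using * by (simp add: I_def)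
  ultimately obtain P where P: "maximalideal P R" "I \<subseteq> P" by (rule E.R.exists_maximalideal)
  have "\<zero>\<^bsub>E\<^esub> \<in> socle_at R E P"
    using ideal.Icarr[OF maximalideal.axioms(1)[OF P(1)]] by (auto simp: socle_at_def)
  then obtain e where e: "e \<in> socle_at R E P" "e \<noteq> \<zero>\<^bsub>E\<^esub>" using soc[OF P(1)] by blast
  obtain f where "f \<in> mod_hom R M E" "f x = e"
  proof (rule injective_module_adjoin_extend[OF inj M.module_axioms M.submodule_zero_set, of x e])
    show "a \<odot>\<^bsub>E\<^esub> e = \<zero>\<^bsub>E\<^esub>" if "a \<in> carrier R" "a \<odot>\<^bsub>M\<^esub> x \<in> {\<zero>\<^bsub>M\<^esub>}" for a
      using that P(2) e(1) by (auto simp: I_def socle_at_def)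
  qed (use * e in \<open>auto simp: socle_at_def\<close>)
  then show "\<exists>f\<in>mod_hom R M E. f x \<noteq> \<zero>\<^bsub>E\<^esub>" using e(2) by auto
qed

context module
begin

lemma socle_at_submodule:
  assumes "ideal P R" shows "submodule (socle_at R M P) R M"
proof (rule submoduleI)
  note Pc = ideal.Icarr[OF assms]
  show "socle_at R M P \<subseteq> carrier M" by (auto simp: socle_at_def)
  show "\<zero>\<^bsub>M\<^esub> \<in> socle_at R M P" using Pc by (auto simp: socle_at_def)
  show "\<ominus>\<^bsub>M\<^esub> u \<in> socle_at R M P" if "u \<in> socle_at R M P" for u
    using that Pc by (auto simp: socle_at_def smult_r_minus)
  show "u \<oplus>\<^bsub>M\<^esub> v \<in> socle_at R M P" if "u \<in> socle_at R M P" "v \<in> socle_at R M P" for u v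
    using that Pc by (auto simp: socle_at_def smult_r_distr)
  show "b \<odot>\<^bsub>M\<^esub> u \<in> socle_at R M P" if "b \<in> carrier R" "u \<in> socle_at R M P" for b u
  proof -
    have "a \<odot>\<^bsub>M\<^esub> (b \<odot>\<^bsub>M\<^esub> u) = \<zero>\<^bsub>M\<^esub>" if "a \<in> P" for a
    proof -
      have *: "u \<in> carrier M" "a \<odot>\<^bsub>M\<^esub> u = \<zero>\<^bsub>M\<^esub>"
        using that \<open>u \<in> socle_at R M P\<close> by (auto simp: socle_at_def)
      have "a \<odot>\<^bsub>M\<^esub> (b \<odot>\<^bsub>M\<^esub> u) = (b \<otimes>\<^bsub>R\<^esub> a) \<odot>\<^bsub>M\<^esub> u"
        using * Pc[OF that] \<open>b \<in> carrier R\<close> by (simp add: smult_assoc1[symmetric] R.m_comm)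
      also have "\<dots> = \<zero>\<^bsub>M\<^esub>" using * Pc[OF that] \<open>b \<in> carrier R\<close> by (simp add: smult_assoc1)
      finally show ?thesis .
    qed
    then show ?thesis using that by (simp add: socle_at_def)
  qed
qed

text \<open>Since \<open>a\<close> does not kill \<open>u\<close>, it lies outside \<open>P\<close>
  and is invertible modulo \<open>P\<close>. So every nonzero element of the line \<open>Ru\<close>
  generates it.\<close>

lemma socle_at_multiple_cancel:
  assumes P: "maximalideal P R" and u: "u \<in> socle_at R M P"
    and a: "a \<in> carrier R" "a \<odot>\<^bsub>M\<^esub> u \<noteq> \<zero>\<^bsub>M\<^esub>"
  obtains b where "b \<in> carrier R" "b \<odot>\<^bsub>M\<^esub> (a \<odot>\<^bsub>M\<^esub> u) = u"
proof -
  have "a \<notin> P" using u a by (auto simp: socle_at_def)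
  then obtain b c where b: "b \<in> carrier R" "c \<in> P" "b \<otimes>\<^bsub>R\<^esub> a \<oplus>\<^bsub>R\<^esub> c = \<one>\<^bsub>R\<^esub>"
    by (rule R.maximalideal_inverse[OF P a(1)])
  have c: "c \<in> carrier R" using b(2) ideal.Icarr[OF maximalideal.axioms(1)[OF P]] by blast
  have uc: "u \<in> carrier M" "c \<odot>\<^bsub>M\<^esub> u = \<zero>\<^bsub>M\<^esub>" using u b(2) by (auto simp: socle_at_def)
  have "(b \<otimes>\<^bsub>R\<^esub> a \<oplus>\<^bsub>R\<^esub> c) \<odot>\<^bsub>M\<^esub> u = b \<odot>\<^bsub>M\<^esub> (a \<odot>\<^bsub>M\<^esub> u)"
    using a(1) b(1) c uc by (simp add: smult_l_distr smult_assoc1)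
  then show thesis using that b(1,3) uc(1) by simp
qed

end

text \<open>For \<open>H'\<close> maximal with \<open>B \<subseteq> H'\<close> and \<open>H \<inter> H' = 0\<close>, the projection of \<open>H + H'\<close> to
  \<open>H\<close> extends to an endomorphism of \<open>E\<close>, whose image is \<open>H\<close> by the maximality of \<open>H\<close>.\<close>

lemma injective_complement_retraction:
  assumes inj: "injective_module R E" and B: "submodule B R E"
    and H: "submodule H R E" "H \<inter> (B - {\<zero>\<^bsub>E\<^esub>}) = {}"
    and maxH: "\<And>K. submodule K R E \<Longrightarrow> H \<subset> K \<Longrightarrow> K \<inter> (B - {\<zero>\<^bsub>E\<^esub>}) \<noteq> {}"
  obtains p where "p \<in> mod_hom R E E" "\<And>h. h \<in> H \<Longrightarrow> p h = h" "p ` carrier E \<subseteq> H"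
proof -
  interpret E: module R E using inj by (simp add: injective_module_def)
  note HE = E.submoduleE[OF H(1)] and Hc = E.submodule_carrier[OF H(1)]
    and H0 = E.submodule_zero[OF H(1)]
  have "B \<inter> (H - {\<zero>\<^bsub>E\<^esub>}) = {}" using H(2) by blast
  then obtain H' where H': "submodule H' R E" "B \<subseteq> H'" "H' \<inter> (H - {\<zero>\<^bsub>E\<^esub>}) = {}"
      and maxH': "\<And>K. submodule K R E \<Longrightarrow> H' \<subset> K \<Longrightarrow> K \<inter> (H - {\<zero>\<^bsub>E\<^esub>}) \<noteq> {}"
    by (rule E.exists_maximal_submodule_avoiding[OF B]) blast
  note HE' = E.submoduleE[OF H'(1)] and Hc' = E.submodule_carrier[OF H'(1)]
    and H0' = E.submodule_zero[OF H'(1)]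
  define G where "G = {(h \<oplus>\<^bsub>E\<^esub> h', h) | h h'. h \<in> H \<and> h' \<in> H'}"
  have GI: "(h \<oplus>\<^bsub>E\<^esub> h', h) \<in> G" if "h \<in> H" "h' \<in> H'" for h h' using that by (auto simp: G_def)
  obtain p where p: "p \<in> mod_hom R E E" "\<And>x y. (x, y) \<in> G \<Longrightarrow> p x = y"
  proof (rule injective_module_graph_extend[OF inj E.module_axioms, of G])
    show "G \<subseteq> carrier E \<times> carrier E" using Hc Hc' by (auto simp: G_def)
    show "(\<zero>\<^bsub>E\<^esub>, \<zero>\<^bsub>E\<^esub>) \<in> G" using GI[OF H0 H0'] by simp
    fix u v assume "(u, v) \<in> G"
    then obtain h' where u: "v \<in> H" "h' \<in> H'" "u = v \<oplus>\<^bsub>E\<^esub> h'" by (auto simp: G_def)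
    show "(b \<odot>\<^bsub>E\<^esub> u, b \<odot>\<^bsub>E\<^esub> v) \<in> G" if "b \<in> carrier R" for b
      using GI[OF HE(4)[OF that u(1)] HE'(4)[OF that u(2)]] u that Hc Hc'
      by (simp add: E.smult_r_distr)
    fix x y assume "(x, y) \<in> G"
    then obtain k' where x: "y \<in> H" "k' \<in> H'" "x = y \<oplus>\<^bsub>E\<^esub> k'" by (auto simp: G_def)
    show "(u \<oplus>\<^bsub>E\<^esub> x, v \<oplus>\<^bsub>E\<^esub> y) \<in> G"
      using GI[OF HE(5)[OF u(1) x(1)] HE'(5)[OF u(2) x(2)]] u x Hc Hc' by (simp add: E.M.a_ac)
  next
    fix v assume "(\<zero>\<^bsub>E\<^esub>, v) \<in> G"
    then obtain h' where u: "v \<in> H" "h' \<in> H'" "\<zero>\<^bsub>E\<^esub> = v \<oplus>\<^bsub>E\<^esub> h'" by (auto simp: G_def)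
    then have "v = \<ominus>\<^bsub>E\<^esub> h'" using Hc Hc' by (metis E.M.minus_equality)
    then have "v \<in> H'" using HE'(3) u(2) by simp
    then show "v = \<zero>\<^bsub>E\<^esub>" using u(1) H'(3) by blast
  qed blast
  have pc: "p x \<in> carrier E" if "x \<in> carrier E" for x using that p(1) by (auto simp: mod_hom_def)
  have p_add: "p (x \<oplus>\<^bsub>E\<^esub> y) = p x \<oplus>\<^bsub>E\<^esub> p y" if "x \<in> carrier E" "y \<in> carrier E" for x y
    using that p(1) by (auto simp: mod_hom_def)
  have p_sm: "p (a \<odot>\<^bsub>E\<^esub> x) = a \<odot>\<^bsub>E\<^esub> p x" if "a \<in> carrier R" "x \<in> carrier E" for a x
    using that p(1) by (auto simp: mod_hom_def)
  have pH: "p h = h" if "h \<in> H" for h using p(2)[OF GI[OF that H0']] Hc[OF that] by simp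
  have pH': "p h = \<zero>\<^bsub>E\<^esub>" if "h \<in> H'" for h using p(2)[OF GI[OF H0 that]] Hc'[OF that] by simp
  have img: "submodule (p ` carrier E) R E"
  proof (rule E.submoduleI)
    show "\<zero>\<^bsub>E\<^esub> \<in> p ` carrier E" using pH[OF H0] by force
    show "b \<odot>\<^bsub>E\<^esub> u \<in> p ` carrier E" if b: "b \<in> carrier R" and u: "u \<in> p ` carrier E" for b u
    proof -
      obtain x where "x \<in> carrier E" "u = p x" using u by blast
      then show ?thesis using b p_sm[OF b] by (intro image_eqI[of _ _ "b \<odot>\<^bsub>E\<^esub> x"]) simp_all
    qed
    then show "\<ominus>\<^bsub>E\<^esub> u \<in> p ` carrier E" if "u \<in> p ` carrier E" for u
      using that pc by (metis E.R.a_inv_closed E.R.one_closed E.smult_l_minus E.smult_one imageE)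
    show "u \<oplus>\<^bsub>E\<^esub> v \<in> p ` carrier E" if uv: "u \<in> p ` carrier E" "v \<in> p ` carrier E" for u v
    proof -
      obtain x y where "x \<in> carrier E" "u = p x" "y \<in> carrier E" "v = p y" using uv by blast
      then show ?thesis using p_add by (intro image_eqI[of _ _ "x \<oplus>\<^bsub>E\<^esub> y"]) simp_all
    qed
  qed (use pc in auto)
  have "p ` carrier E \<inter> (B - {\<zero>\<^bsub>E\<^esub>}) = {}"
  proof (rule ccontr)
    assume "p ` carrier E \<inter> (B - {\<zero>\<^bsub>E\<^esub>}) \<noteq> {}"
    then obtain z where z: "z \<in> carrier E" "p z \<in> B" "p z \<noteq> \<zero>\<^bsub>E\<^esub>" by blast
    \<comment> \<open>By maximality of \<open>H'\<close>, the sum \<open>H' + Rz\<close> contains a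
      nonzero \<open>h = h' + az\<close> of \<open>H\<close>. Applying \<open>p\<close> gives
      \<open>h = a p(z)\<close>, an element of \<open>B\<close>, although \<open>H\<close> meets
      \<open>B\<close> only in zero.\<close>
    then have "z \<notin> H'" using pH' by blast
    then have "H' \<subset> adjoin R E H' z"
      using E.subset_adjoin[OF H'(1) z(1)] E.mem_adjoin[OF H'(1) z(1)] by blast
    then obtain h where h: "h \<in> adjoin R E H' z" "h \<in> H" "h \<noteq> \<zero>\<^bsub>E\<^esub>"
      using maxH'[OF E.submodule_adjoin[OF H'(1) z(1)]] by blast
    then obtain h' a where a: "h' \<in> H'" "a \<in> carrier R" "h = h' \<oplus>\<^bsub>E\<^esub> a \<odot>\<^bsub>E\<^esub> z"
      by (auto elim!: adjoinE)
    have "h = a \<odot>\<^bsub>E\<^esub> p z"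
      using pH[OF h(2)] a z(1) Hc' pc by (simp add: p_add p_sm pH')
    then have "h \<in> B" using E.submoduleE(4)[OF B] a(2) z(2) by simp
    then show False using h(2,3) H(2) by blast
  qed
  moreover have "H \<subseteq> p ` carrier E"
  proof
    fix h assume "h \<in> H"
    then show "h \<in> p ` carrier E" using pH[of h] Hc[of h] by force
  qed
  ultimately have "p ` carrier E = H" using maxH[OF img] by blast
  then show thesis using that[of p] p(1) pH by blast
qed

text \<open>If \<open>e\<close> were not a multiple of \<open>e'\<close>, the lines
  \<open>Re\<close> and \<open>Re'\<close> would meet only in zero. A submodule \<open>H\<close>
  that contains \<open>Re\<close> and is maximal with \<open>H \<inter> Re' = 0\<close> is a retract
  of \<open>E\<close>, hence injective, and it remains a cogenerator because it keeps a nonzero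
  socle at every maximal ideal. As it misses \<open>e'\<close>, this contradicts minimality.\<close>

theorem socle_at_cyclic:
  assumes E: "minimal_injective_cogenerator R E" and P: "maximalideal P R"
    and e: "e \<in> socle_at R E P" and e': "e' \<in> socle_at R E P" "e' \<noteq> \<zero>\<^bsub>E\<^esub>"
  shows "\<exists>b\<in>carrier R. e = b \<odot>\<^bsub>E\<^esub> e'"
proof (rule ccontr)
  assume neg: "\<not> (\<exists>b\<in>carrier R. e = b \<odot>\<^bsub>E\<^esub> e')"
  have cog: "injective_cogenerator R E" using E by (simp add: minimal_injective_cogenerator_def)
  then have inj: "injective_module R E" by (simp add: injective_cogenerator_def)
  interpret E: module R E using inj by (simp add: injective_module_def)
  have c: "e \<in> carrier E" "e' \<in> carrier E" using e e' by (auto simp: socle_at_def)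
  have e0: "e \<noteq> \<zero>\<^bsub>E\<^esub>" using neg c by (metis E.R.zero_closed E.smult_l_null)
  let ?A = "adjoin R E {\<zero>\<^bsub>E\<^esub>} e" and ?B = "adjoin R E {\<zero>\<^bsub>E\<^esub>} e'"
  note A = E.submodule_adjoin[OF E.submodule_zero_set c(1)]
    and B = E.submodule_adjoin[OF E.submodule_zero_set c(2)]
  have "?A \<inter> (?B - {\<zero>\<^bsub>E\<^esub>}) = {}"
  proof (rule ccontr)
    assume "?A \<inter> (?B - {\<zero>\<^bsub>E\<^esub>}) \<noteq> {}"
    then obtain w where w: "w \<in> ?A" "w \<in> ?B" "w \<noteq> \<zero>\<^bsub>E\<^esub>" by blast
    then obtain a b where ab: "a \<in> carrier R" "b \<in> carrier R" "w = a \<odot>\<^bsub>E\<^esub> e" "w = b \<odot>\<^bsub>E\<^esub> e'"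
      by (auto simp: E.adjoin_zero[OF c(1)] E.adjoin_zero[OF c(2)])
    have "a \<odot>\<^bsub>E\<^esub> e \<noteq> \<zero>\<^bsub>E\<^esub>" using w(3) ab by simp
    obtain d where "d \<in> carrier R" "d \<odot>\<^bsub>E\<^esub> (a \<odot>\<^bsub>E\<^esub> e) = e"
      by (rule E.socle_at_multiple_cancel[OF P e ab(1) \<open>a \<odot>\<^bsub>E\<^esub> e \<noteq> \<zero>\<^bsub>E\<^esub>\<close>])
    then have "e = (d \<otimes>\<^bsub>R\<^esub> b) \<odot>\<^bsub>E\<^esub> e'" using ab c by (simp add: E.smult_assoc1)
    then show False using neg \<open>d \<in> carrier R\<close> ab(2) by blast
  qed
  then obtain H where H: "submodule H R E" "?A \<subseteq> H" "H \<inter> (?B - {\<zero>\<^bsub>E\<^esub>}) = {}"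
      and maxH: "\<And>K. submodule K R E \<Longrightarrow> H \<subset> K \<Longrightarrow> K \<inter> (?B - {\<zero>\<^bsub>E\<^esub>}) \<noteq> {}"
    by (rule E.exists_maximal_submodule_avoiding[OF A]) blast
  note Hc = E.submodule_carrier[OF H(1)]
  obtain p where p: "p \<in> mod_hom R E E" "\<And>h. h \<in> H \<Longrightarrow> p h = h" "p ` carrier E \<subseteq> H"
    by (rule injective_complement_retraction[OF inj B H(1,3) maxH]) blast+
  let ?H = "E\<lparr>carrier := H\<rparr>"
  have mH: "module R ?H" by (rule submodule.submodule_is_module[OF H(1) E.module_axioms])
  \<comment> \<open>Maps into \<open>H\<close> are extended with values in \<open>E\<close> and then
    brought back by the retraction \<open>p\<close>.\<close>
  have "injective_module R ?H"
    unfolding injective_module_def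
  proof (intro conjI allI impI mH)
    fix M :: "('a, 'a set) module" and N :: "('a, 'a set) module" and i f
    assume *: "module R M \<and> module R N \<and> i \<in> mod_hom R M N \<and> inj_on i (carrier M) \<and> f \<in> mod_hom R M ?H"
    then have "f \<in> mod_hom R M E" using Hc by (auto simp: mod_hom_def Pi_iff)
    then obtain g where g: "g \<in> mod_hom R N E" "\<forall>x\<in>carrier M. g (i x) = f x"
      using injective_module_extend[OF inj] * by blast
    have "(\<lambda>x. p (g x)) \<in> mod_hom R N E" by (rule mod_hom_comp[OF g(1) p(1)])
    moreover have "p (g x) \<in> H" if "x \<in> carrier N" for x
      using that g(1) p(3) by (auto simp: mod_hom_def)
    ultimately have "(\<lambda>x. p (g x)) \<in> mod_hom R N ?H" by (auto simp: mod_hom_def)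
    moreover have "p (g (i x)) = f x" if "x \<in> carrier M" for x
    proof -
      have "f x \<in> H" using * that by (auto simp: mod_hom_def)
      then show ?thesis using g(2) that p(2) by simp
    qed
    ultimately show "\<exists>g\<in>mod_hom R N ?H. \<forall>x\<in>carrier M. g (i x) = f x"
      by (intro bexI[of _ "\<lambda>x. p (g x)"]) simp_all
  qed
  moreover from this have "cogenerator_module R ?H"
  proof (rule cogenerator_moduleI_socle_at)
    fix Q assume Q: "maximalideal Q R"
    note Qi = maximalideal.axioms(1)[OF Q]
    obtain u where u: "u \<in> socle_at R E Q" "u \<noteq> \<zero>\<^bsub>E\<^esub>"
      by (rule socle_at_nontrivial[OF cog E.R.is_cring Q])
    have uc: "u \<in> carrier E" using u(1) by (simp add: socle_at_def)
    \<comment> \<open>If the socle element \<open>u\<close> is not in \<open>H\<close>, then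
      \<open>H + Ru\<close> contains a nonzero \<open>w = h + ru\<close> of \<open>Re'\<close>. An
      \<open>a\<close> in \<open>Q\<close> kills \<open>u\<close>, so \<open>aw = ah\<close> lies in
      both \<open>H\<close> and \<open>Re'\<close> and is zero; outside \<open>P\<close> it would be
      invertible on \<open>w\<close>. Thus \<open>Q\<close> is contained in \<open>P\<close>, so
      \<open>Q = P\<close>, and \<open>e\<close> itself is the required element.\<close>
    have "\<exists>v\<in>H. v \<in> socle_at R E Q \<and> v \<noteq> \<zero>\<^bsub>E\<^esub>"
    proof (cases "u \<in> H")
      case False
      then have "H \<subset> adjoin R E H u"
        using E.subset_adjoin[OF H(1) uc] E.mem_adjoin[OF H(1) uc] by blast
      then obtain w where w: "w \<in> adjoin R E H u" "w \<in> ?B" "w \<noteq> \<zero>\<^bsub>E\<^esub>"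
        using maxH[OF E.submodule_adjoin[OF H(1) uc]] by blast
      then obtain h r where hr: "h \<in> H" "r \<in> carrier R" "w = h \<oplus>\<^bsub>E\<^esub> r \<odot>\<^bsub>E\<^esub> u"
        by (auto elim!: adjoinE)
      have w_soc: "w \<in> socle_at R E P"
        using w(2) e'(1) E.submoduleE(4)[OF E.socle_at_submodule[OF maximalideal.axioms(1)[OF P]]]
        by (auto simp: E.adjoin_zero[OF c(2)])
      have "a \<in> P" if a: "a \<in> Q" for a
      proof (rule ccontr)
        assume "a \<notin> P"
        have ac: "a \<in> carrier R" using ideal.Icarr[OF Qi a] .
        have wc: "w \<in> carrier E" using w_soc by (simp add: socle_at_def)
        have "r \<odot>\<^bsub>E\<^esub> u \<in> socle_at R E Q"
          using E.submoduleE(4)[OF E.socle_at_submodule[OF Qi]] hr(2) u(1) by blast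
        then have "a \<odot>\<^bsub>E\<^esub> w = a \<odot>\<^bsub>E\<^esub> h"
          using hr a ac uc Hc by (simp add: E.smult_r_distr socle_at_def)
        then have "a \<odot>\<^bsub>E\<^esub> w \<in> H" using E.submoduleE(4)[OF H(1) ac hr(1)] by simp
        moreover have "a \<odot>\<^bsub>E\<^esub> w \<in> ?B" using E.submoduleE(4)[OF B ac w(2)] .
        ultimately have aw: "a \<odot>\<^bsub>E\<^esub> w = \<zero>\<^bsub>E\<^esub>" using H(3) by blast
        obtain b d where bd: "b \<in> carrier R" "d \<in> P" "b \<otimes>\<^bsub>R\<^esub> a \<oplus>\<^bsub>R\<^esub> d = \<one>\<^bsub>R\<^esub>"
          by (rule E.R.maximalideal_inverse[OF P ac \<open>a \<notin> P\<close>])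
        have dc: "d \<in> carrier R" using ideal.Icarr[OF maximalideal.axioms(1)[OF P] bd(2)] .
        have "w = (b \<otimes>\<^bsub>R\<^esub> a \<oplus>\<^bsub>R\<^esub> d) \<odot>\<^bsub>E\<^esub> w" using bd(3) wc by simp
        also have "\<dots> = b \<odot>\<^bsub>E\<^esub> (a \<odot>\<^bsub>E\<^esub> w) \<oplus>\<^bsub>E\<^esub> d \<odot>\<^bsub>E\<^esub> w"
          using bd(1) ac dc wc by (simp add: E.smult_l_distr E.smult_assoc1)
        also have "\<dots> = \<zero>\<^bsub>E\<^esub>" using aw bd w_soc by (simp add: socle_at_def)
        finally show False using w(3) by simp
      qed
      then have "Q = P"
        using maximalideal.I_maximal[OF Q maximalideal.axioms(1)[OF P]] maximalideal.I_notcarr[OF P]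
          ideal.Icarr[OF maximalideal.axioms(1)[OF P]] by blast
      moreover have "e \<in> H" using H(2) E.mem_adjoin[OF E.submodule_zero_set c(1)] by blast
      ultimately show ?thesis using e e0 by blast
    qed (use u in blast)
    then show "socle_at R ?H Q \<noteq> {\<zero>\<^bsub>?H\<^esub>}" by (force simp: socle_at_def)
  qed
  ultimately have "injective_cogenerator R ?H" by (simp add: injective_cogenerator_def)
  then have "H = carrier E" using E H(1) by (simp add: minimal_injective_cogenerator_def)
  moreover have "e' \<notin> H" using H(3) e'(2) E.mem_adjoin[OF E.submodule_zero_set c(2)] by blast
  ultimately show False using c(2) by simp
qed


section \<open>Matlis reflexivity\<close>

lemma carrier_Matlis_dual: "carrier (Matlis_dual R E M) = mod_hom R M E \<inter> extensional (carrier M)"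
  by (simp add: Matlis_dual_def hom_module_def)

lemma Matlis_dual_apply:
  assumes "x \<in> carrier M"
  shows "(f \<oplus>\<^bsub>Matlis_dual R E M\<^esub> g) x = f x \<oplus>\<^bsub>E\<^esub> g x"
    and "(a \<odot>\<^bsub>Matlis_dual R E M\<^esub> f) x = a \<odot>\<^bsub>E\<^esub> f x"
  using assms by (simp_all add: Matlis_dual_def hom_module_def)

text \<open>On the functionals vanishing on \<open>K\<close>, a functional that vanishes on those vanishing on
  \<open>K + Rx\<close> is evaluation at a multiple of \<open>x\<close>, as they take values at \<open>x\<close> in a
  one-dimensional space.\<close>

lemma Matlis_evaluation_adjoin:
  assumes E: "minimal_injective_cogenerator R E" and M: "module R M"
    and K: "submodule K R M" and x: "x \<in> carrier M"
    and P: "maximalideal P R" "\<And>a. a \<in> P \<Longrightarrow> a \<odot>\<^bsub>M\<^esub> x \<in> K"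
    and l: "l \<in> mod_hom R (Matlis_dual R E M) E"
    and van: "\<And>f. f \<in> carrier (Matlis_dual R E M) \<Longrightarrow> \<forall>u\<in>adjoin R M K x. f u = \<zero>\<^bsub>E\<^esub> \<Longrightarrow> l f = \<zero>\<^bsub>E\<^esub>"
  obtains b where "b \<in> carrier R"
    "\<And>f. f \<in> carrier (Matlis_dual R E M) \<Longrightarrow> \<forall>k\<in>K. f k = \<zero>\<^bsub>E\<^esub> \<Longrightarrow> l f = f (b \<odot>\<^bsub>M\<^esub> x)"
proof -
  let ?D = "Matlis_dual R E M"
  have cog: "injective_cogenerator R E" using E by (simp add: minimal_injective_cogenerator_def)
  then have inj: "injective_module R E" by (simp add: injective_cogenerator_def)
  interpret M: module R M by fact
  interpret E: module R E using inj by (simp add: injective_module_def)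
  interpret D: module R ?D
    unfolding Matlis_dual_def by (rule hom_module_is_module[OF M E.module_axioms])
  note Pc = ideal.Icarr[OF maximalideal.axioms(1)[OF P(1)]] and Kc = M.submodule_carrier[OF K]
  have fc: "f u \<in> carrier E" if "f \<in> carrier ?D" "u \<in> carrier M" for f u
    using that by (auto simp: carrier_Matlis_dual mod_hom_def)
  have f_add: "f (u \<oplus>\<^bsub>M\<^esub> v) = f u \<oplus>\<^bsub>E\<^esub> f v"
    if "f \<in> carrier ?D" "u \<in> carrier M" "v \<in> carrier M" for f u v
    using that by (auto simp: carrier_Matlis_dual mod_hom_def)
  have f_sm: "f (a \<odot>\<^bsub>M\<^esub> u) = a \<odot>\<^bsub>E\<^esub> f u" if "f \<in> carrier ?D" "a \<in> carrier R" "u \<in> carrier M" for f a u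
    using that by (auto simp: carrier_Matlis_dual mod_hom_def)
  have lc: "l f \<in> carrier E" if "f \<in> carrier ?D" for f using that l by (auto simp: mod_hom_def)
  have l_add: "l (f \<oplus>\<^bsub>?D\<^esub> g) = l f \<oplus>\<^bsub>E\<^esub> l g" if "f \<in> carrier ?D" "g \<in> carrier ?D" for f g
    using that l by (auto simp: mod_hom_def)
  have l_sm: "l (a \<odot>\<^bsub>?D\<^esub> f) = a \<odot>\<^bsub>E\<^esub> l f" if "a \<in> carrier R" "f \<in> carrier ?D" for a f
    using that l by (auto simp: mod_hom_def)
  have van': "l f = \<zero>\<^bsub>E\<^esub>" if f: "f \<in> carrier ?D" "\<forall>k\<in>K. f k = \<zero>\<^bsub>E\<^esub>" "f x = \<zero>\<^bsub>E\<^esub>" for f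
    using f x Kc by (intro van) (auto elim!: adjoinE simp: f_add f_sm)
  show thesis
  proof (cases "x \<in> K")
    case True
    have "l f = f (\<zero>\<^bsub>R\<^esub> \<odot>\<^bsub>M\<^esub> x)" if "f \<in> carrier ?D" "\<forall>k\<in>K. f k = \<zero>\<^bsub>E\<^esub>" for f
      using van'[OF that] that True f_sm[OF that(1) M.R.zero_closed x] by simp
    then show thesis using that[of "\<zero>\<^bsub>R\<^esub>"] by simp
  next
    case False
    obtain e where e: "e \<in> socle_at R E P" "e \<noteq> \<zero>\<^bsub>E\<^esub>"
      by (rule socle_at_nontrivial[OF cog M.R.is_cring P(1)])
    have ec: "e \<in> carrier E" using e(1) by (simp add: socle_at_def)
    \<comment> \<open>The scalars carrying \<open>x\<close> into \<open>K\<close> form a proper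
      ideal containing \<open>P\<close>, hence \<open>P\<close> itself. So there is a functional
      killing \<open>K\<close> with value \<open>e\<close> at \<open>x\<close>.\<close>
    have inP: "a \<in> P" if a: "a \<in> carrier R" "a \<odot>\<^bsub>M\<^esub> x \<in> K" for a
    proof (rule ccontr)
      assume "a \<notin> P"
      then obtain b c where b: "b \<in> carrier R" "c \<in> P" "b \<otimes>\<^bsub>R\<^esub> a \<oplus>\<^bsub>R\<^esub> c = \<one>\<^bsub>R\<^esub>"
        by (rule M.R.maximalideal_inverse[OF P(1) a(1)])
      have "(b \<otimes>\<^bsub>R\<^esub> a \<oplus>\<^bsub>R\<^esub> c) \<odot>\<^bsub>M\<^esub> x = b \<odot>\<^bsub>M\<^esub> (a \<odot>\<^bsub>M\<^esub> x) \<oplus>\<^bsub>M\<^esub> c \<odot>\<^bsub>M\<^esub> x"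
        using a(1) b(1) Pc[OF b(2)] x by (simp add: M.smult_l_distr M.smult_assoc1)
      also have "\<dots> \<in> K" using M.submoduleE(4,5)[OF K] a(2) b(1,2) P(2) by blast
      finally show False using False b(3) x by simp
    qed
    obtain g where g: "g \<in> mod_hom R M E" "\<And>k. k \<in> K \<Longrightarrow> g k = \<zero>\<^bsub>E\<^esub>" "g x = e"
    proof (rule injective_module_adjoin_extend[OF inj M K x ec])
      show "a \<odot>\<^bsub>E\<^esub> e = \<zero>\<^bsub>E\<^esub>" if "a \<in> carrier R" "a \<odot>\<^bsub>M\<^esub> x \<in> K" for a
        using inP[OF that] e(1) by (simp add: socle_at_def)
    qed blast
    \<comment> \<open>\<open>f0\<close> serves as a basis vector. Its image \<open>l f0\<close> is
      killed by \<open>P\<close>, so it equals \<open>b e\<close> for some \<open>b\<close>, the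
      coefficient sought. If \<open>f\<close> kills \<open>K\<close> and \<open>f x = a e\<close>,
      then \<open>f - a f0\<close> kills \<open>K\<close> and \<open>x\<close>, so
      \<open>l f = a b e = b (f x)\<close>. The restriction makes \<open>f0\<close> extensional, as
      members of the dual must be.\<close>
    define f0 where "f0 = restrict g (carrier M)"
    have f0: "f0 \<in> carrier ?D" using g(1) by (auto simp: f0_def carrier_Matlis_dual mod_hom_def)
    have f0K: "f0 k = \<zero>\<^bsub>E\<^esub>" if "k \<in> K" for k using g(2) Kc that by (simp add: f0_def)
    have f0x: "f0 x = e" using g(3) x by (simp add: f0_def)
    have "l f0 \<in> socle_at R E P"
    proof -
      have "a \<odot>\<^bsub>E\<^esub> l f0 = \<zero>\<^bsub>E\<^esub>" if a: "a \<in> P" for a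
      proof -
        have "l (a \<odot>\<^bsub>?D\<^esub> f0) = \<zero>\<^bsub>E\<^esub>"
          by (rule van') (use a Pc f0 f0K f0x e(1) x Kc in \<open>auto simp: Matlis_dual_apply socle_at_def\<close>)
        then show ?thesis using l_sm[OF Pc[OF a] f0] by simp
      qed
      then show ?thesis using lc[OF f0] by (simp add: socle_at_def)
    qed
    then obtain b where b: "b \<in> carrier R" "l f0 = b \<odot>\<^bsub>E\<^esub> e"
      using socle_at_cyclic[OF E P(1) _ e] by blast
    have "l f = f (b \<odot>\<^bsub>M\<^esub> x)" if f: "f \<in> carrier ?D" "\<forall>k\<in>K. f k = \<zero>\<^bsub>E\<^esub>" for f
    proof -
      have "f x \<in> socle_at R E P"
      proof -
        have "a \<odot>\<^bsub>E\<^esub> f x = \<zero>\<^bsub>E\<^esub>" if "a \<in> P" for a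
          using f_sm[OF f(1) Pc[OF that] x] f(2) P(2)[OF that] by simp
        then show ?thesis using fc[OF f(1) x] by (simp add: socle_at_def)
      qed
      then obtain a where a: "a \<in> carrier R" "f x = a \<odot>\<^bsub>E\<^esub> e"
        using socle_at_cyclic[OF E P(1) _ e] by blast
      let ?h = "f \<oplus>\<^bsub>?D\<^esub> (\<ominus>\<^bsub>R\<^esub> a) \<odot>\<^bsub>?D\<^esub> f0"
      have "l ?h = \<zero>\<^bsub>E\<^esub>"
        by (rule van')
          (use a f f0 f0K f0x x Kc ec in \<open>auto simp: Matlis_dual_apply E.smult_l_minus E.M.r_neg\<close>)
      moreover have "l ?h = l f \<oplus>\<^bsub>E\<^esub> \<ominus>\<^bsub>E\<^esub> (a \<odot>\<^bsub>E\<^esub> l f0)"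
        using f(1) f0 a(1) lc by (simp add: l_add l_sm E.smult_l_minus)
      ultimately have "l f \<ominus>\<^bsub>E\<^esub> (a \<odot>\<^bsub>E\<^esub> l f0) = \<zero>\<^bsub>E\<^esub>" by (simp add: E.M.minus_eq)
      then have "l f = a \<odot>\<^bsub>E\<^esub> l f0"
        using lc[OF f(1)] lc[OF f0] a(1) by (simp add: E.M.minus_eq_zero_iff)
      also have "\<dots> = b \<odot>\<^bsub>E\<^esub> f x"
        using a b ec by (simp add: E.smult_assoc1[symmetric] M.R.m_comm)
      finally show ?thesis using f_sm[OF f(1) b(1) x] by simp
    qed
    then show thesis using that[OF b(1)] by blast
  qed
qed

text \<open>The vanishing condition relative to \<open>K\<close> makes the claim inductive. When
  \<open>x\<close> is adjoined, subtracting evaluation at a suitable multiple of \<open>x\<close>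
  turns the condition for \<open>K + Rx\<close> into the one for \<open>K\<close>; the evaluation
  points add up.\<close>

lemma finite_length_Matlis_evaluation:
  assumes E: "minimal_injective_cogenerator R E" and M: "module R M"
    and "finite_length R M K" and "l \<in> mod_hom R (Matlis_dual R E M) E"
    and "\<And>f. f \<in> carrier (Matlis_dual R E M) \<Longrightarrow> \<forall>u\<in>K. f u = \<zero>\<^bsub>E\<^esub> \<Longrightarrow> l f = \<zero>\<^bsub>E\<^esub>"
  shows "\<exists>x\<in>K. \<forall>f\<in>carrier (Matlis_dual R E M). l f = f x"
proof -
  let ?D = "Matlis_dual R E M"
  interpret M: module R M by fact
  interpret E: module R E
    using E by (simp add: minimal_injective_cogenerator_def injective_cogenerator_def
        injective_module_def)
  have f0: "f \<zero>\<^bsub>M\<^esub> = \<zero>\<^bsub>E\<^esub>" if "f \<in> carrier ?D" for f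
  proof -
    have "f (\<zero>\<^bsub>R\<^esub> \<odot>\<^bsub>M\<^esub> \<zero>\<^bsub>M\<^esub>) = \<zero>\<^bsub>R\<^esub> \<odot>\<^bsub>E\<^esub> f \<zero>\<^bsub>M\<^esub>" "f \<zero>\<^bsub>M\<^esub> \<in> carrier E"
      using that M.R.zero_closed M.M.zero_closed unfolding carrier_Matlis_dual mod_hom_def by blast+
    then show ?thesis by simp
  qed
  show ?thesis
    using assms(3,4,5)
  proof (induction arbitrary: l rule: finite_length.induct)
    case zero
    then show ?case using f0 by auto
  next
    case (adjoin K x P)
    have K: "submodule K R M" by (rule M.finite_length_submodule[OF adjoin.hyps(1)])
    note Kc = M.submodule_carrier[OF K] and x = adjoin.hyps(2)
    obtain b where b: "b \<in> carrier R"
        "\<And>f. f \<in> carrier ?D \<Longrightarrow> \<forall>k\<in>K. f k = \<zero>\<^bsub>E\<^esub> \<Longrightarrow> l f = f (b \<odot>\<^bsub>M\<^esub> x)"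
      by (rule Matlis_evaluation_adjoin[OF E M K x adjoin.hyps(3,4) adjoin.prems]) blast+
    let ?y = "b \<odot>\<^bsub>M\<^esub> x"
    have y: "?y \<in> carrier M" using b(1) x by simp
    have fc: "f u \<in> carrier E" if "f \<in> carrier ?D" "u \<in> carrier M" for f u
      using that by (auto simp: carrier_Matlis_dual mod_hom_def)
    have lc: "l f \<in> carrier E" if "f \<in> carrier ?D" for f
      using that adjoin.prems(1) by (auto simp: mod_hom_def)
    let ?l = "\<lambda>f. l f \<ominus>\<^bsub>E\<^esub> f ?y"
    have "?l \<in> mod_hom R ?D E"
      using adjoin.prems(1) y lc fc
      by (auto simp: mod_hom_def Matlis_dual_apply E.M.minus_eq E.M.minus_add E.M.a_ac
          E.smult_r_distr E.smult_r_minus)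
    moreover have "?l f = \<zero>\<^bsub>E\<^esub>" if "f \<in> carrier ?D" "\<forall>u\<in>K. f u = \<zero>\<^bsub>E\<^esub>" for f
      using b(2)[OF that] fc[OF that(1) y] by (simp add: E.M.minus_eq_zero_iff)
    ultimately obtain k where k: "k \<in> K" "\<forall>f\<in>carrier ?D. ?l f = f k"
      using adjoin.IH by blast
    have "l f = f (k \<oplus>\<^bsub>M\<^esub> ?y)" if f: "f \<in> carrier ?D" for f
    proof -
      have "l f = ?l f \<oplus>\<^bsub>E\<^esub> f ?y"
        using lc[OF f] fc[OF f y] by (simp add: E.M.minus_eq E.M.a_assoc E.M.l_neg)
      also have "\<dots> = f (k \<oplus>\<^bsub>M\<^esub> ?y)"
        using k f y Kc by (simp add: carrier_Matlis_dual mod_hom_def)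
      finally show ?thesis .
    qed
    then show ?case using adjoinI[OF k(1) b(1)] by blast
  qed
qed

text \<open>For \<open>K\<close> the whole module, the vanishing condition concerns only the zero
  functional, so every \<open>l\<close> satisfies it. This is surjectivity of the map to the bidual;
  its injectivity is the separation of points by \<open>E\<close>.\<close>

theorem Matlis_reflexive:
  assumes "artinian_cring R" and E: "minimal_injective_cogenerator R E"
    and fg: "finitely_generated_module R M" and l: "l \<in> mod_hom R (Matlis_dual R E M) E"
  shows "\<exists>x\<in>carrier M. \<forall>f\<in>carrier (Matlis_dual R E M). l f = f x"
proof (rule finite_length_Matlis_evaluation[OF E _ finitely_generated_finite_length l])
  show M: "module R M" using fg by (simp add: finitely_generated_module_def)
  interpret E: module R E
    using E by (simp add: minimal_injective_cogenerator_def injective_cogenerator_def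
        injective_module_def)
  interpret D: module R "Matlis_dual R E M"
    unfolding Matlis_dual_def by (rule hom_module_is_module[OF M E.module_axioms])
  have "l (\<zero>\<^bsub>R\<^esub> \<odot>\<^bsub>Matlis_dual R E M\<^esub> \<zero>\<^bsub>Matlis_dual R E M\<^esub>) = \<zero>\<^bsub>R\<^esub> \<odot>\<^bsub>E\<^esub> l \<zero>\<^bsub>Matlis_dual R E M\<^esub>"
      "l \<zero>\<^bsub>Matlis_dual R E M\<^esub> \<in> carrier E"
    using l E.R.zero_closed D.M.zero_closed unfolding mod_hom_def by blast+
  then have l0: "l \<zero>\<^bsub>Matlis_dual R E M\<^esub> = \<zero>\<^bsub>E\<^esub>" by simp
  fix f assume f: "f \<in> carrier (Matlis_dual R E M)" "\<forall>u\<in>carrier M. f u = \<zero>\<^bsub>E\<^esub>"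
  then have "f = \<zero>\<^bsub>Matlis_dual R E M\<^esub>"
    by (intro extensionalityI[of _ "carrier M"])
      (auto simp: Matlis_dual_def hom_module_def)
  then show "l f = \<zero>\<^bsub>E\<^esub>" using l0 by simp
qed (use assms in auto)


section \<open>Perfect pairings in linear categories\<close>

lemma mod_homD:
  assumes "f \<in> mod_hom R M N"
  shows "x \<in> carrier M \<Longrightarrow> f x \<in> carrier N"
    and "x \<in> carrier M \<Longrightarrow> y \<in> carrier M \<Longrightarrow> f (x \<oplus>\<^bsub>M\<^esub> y) = f x \<oplus>\<^bsub>N\<^esub> f y"
    and "a \<in> carrier R \<Longrightarrow> x \<in> carrier M \<Longrightarrow> f (a \<odot>\<^bsub>M\<^esub> x) = a \<odot>\<^bsub>N\<^esub> f x"
  using assms by (auto simp: mod_hom_def)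

lemma mod_homI:
  assumes "\<And>x. x \<in> carrier M \<Longrightarrow> f x \<in> carrier N"
    and "\<And>x y. x \<in> carrier M \<Longrightarrow> y \<in> carrier M \<Longrightarrow> f (x \<oplus>\<^bsub>M\<^esub> y) = f x \<oplus>\<^bsub>N\<^esub> f y"
    and "\<And>a x. a \<in> carrier R \<Longrightarrow> x \<in> carrier M \<Longrightarrow> f (a \<odot>\<^bsub>M\<^esub> x) = a \<odot>\<^bsub>N\<^esub> f x"
  shows "f \<in> mod_hom R M N"
  using assms by (auto simp: mod_hom_def)

lemma restrict_Matlis_dual:
  assumes "module R M" "f \<in> mod_hom R M E"
  shows "restrict f (carrier M) \<in> carrier (Matlis_dual R E M)"
proof -
  interpret module R M by fact
  show ?thesis using assms(2) by (auto simp: carrier_Matlis_dual mod_hom_def)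
qed

lemma Matlis_dual_closed:
  assumes "module R M" "module R E"
  shows "f \<in> carrier (Matlis_dual R E M) \<Longrightarrow> g \<in> carrier (Matlis_dual R E M)
      \<Longrightarrow> f \<oplus>\<^bsub>Matlis_dual R E M\<^esub> g \<in> carrier (Matlis_dual R E M)"
    and "a \<in> carrier R \<Longrightarrow> f \<in> carrier (Matlis_dual R E M)
      \<Longrightarrow> a \<odot>\<^bsub>Matlis_dual R E M\<^esub> f \<in> carrier (Matlis_dual R E M)"
proof -
  interpret D: module R "Matlis_dual R E M"
    unfolding Matlis_dual_def by (rule hom_module_is_module[OF assms])
  show "f \<in> carrier (Matlis_dual R E M) \<Longrightarrow> g \<in> carrier (Matlis_dual R E M)
      \<Longrightarrow> f \<oplus>\<^bsub>Matlis_dual R E M\<^esub> g \<in> carrier (Matlis_dual R E M)" by simp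
  show "a \<in> carrier R \<Longrightarrow> f \<in> carrier (Matlis_dual R E M)
      \<Longrightarrow> a \<odot>\<^bsub>Matlis_dual R E M\<^esub> f \<in> carrier (Matlis_dual R E M)" by simp
qed

lemma Matlis_dual_eqI:
  assumes "f \<in> carrier (Matlis_dual R E M)" "g \<in> carrier (Matlis_dual R E M)"
    and "\<And>x. x \<in> carrier M \<Longrightarrow> f x = g x"
  shows "f = g"
  using assms by (auto simp: carrier_Matlis_dual intro: extensionalityI)

text \<open>The two assumptions say that every Hom module maps bijectively to its bidual. They
  gather what the artinian ring, the finiteness of the Hom modules and the choice of
  \<open>E\<close> contribute to the categorical argument.\<close>

locale Matlis_category = linear_category R C + E: module R E
  for R :: "('r, 'x) ring_scheme" and C :: "('o, 'a, 'r) lin_cat"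
    and E :: "('r, 'e, 'y) module_scheme" +
  assumes reflexive: "\<lbrakk>X \<in> Obj C; Y \<in> Obj C; l \<in> mod_hom R (Matlis_dual R E (Hom C X Y)) E\<rbrakk>
      \<Longrightarrow> \<exists>f\<in>carrier (Hom C X Y). \<forall>\<theta>\<in>carrier (Matlis_dual R E (Hom C X Y)). l \<theta> = \<theta> f"
    and separating: "\<lbrakk>X \<in> Obj C; Y \<in> Obj C; f \<in> carrier (Hom C X Y); f' \<in> carrier (Hom C X Y);
      \<And>\<theta>. \<theta> \<in> carrier (Matlis_dual R E (Hom C X Y)) \<Longrightarrow> \<theta> f = \<theta> f'\<rbrakk> \<Longrightarrow> f = f'"
begin

abbreviation obj where "obj X \<equiv> X \<in> Obj C"
abbreviation mor where "mor X Y \<equiv> carrier (Hom C X Y)"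
abbreviation dual where "dual X Y \<equiv> carrier (Matlis_dual R E (Hom C X Y))"

lemma Comp_closed [simp, intro]:
  "\<lbrakk>obj X; obj Y; obj Z; f \<in> mor X Y; g \<in> mor Y Z\<rbrakk> \<Longrightarrow> Comp C X Y Z g f \<in> mor X Z"
  using Comp_linear_left mod_homD(1) by fast

lemma Comp_add_left:
  "\<lbrakk>obj X; obj Y; obj Z; f \<in> mor X Y; g \<in> mor Y Z; g' \<in> mor Y Z\<rbrakk>
    \<Longrightarrow> Comp C X Y Z (g \<oplus>\<^bsub>Hom C Y Z\<^esub> g') f = Comp C X Y Z g f \<oplus>\<^bsub>Hom C X Z\<^esub> Comp C X Y Z g' f"
  using mod_homD(2)[OF Comp_linear_left] by simp

lemma Comp_add_right:
  "\<lbrakk>obj X; obj Y; obj Z; f \<in> mor X Y; f' \<in> mor X Y; g \<in> mor Y Z\<rbrakk>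
    \<Longrightarrow> Comp C X Y Z g (f \<oplus>\<^bsub>Hom C X Y\<^esub> f') = Comp C X Y Z g f \<oplus>\<^bsub>Hom C X Z\<^esub> Comp C X Y Z g f'"
  using mod_homD(2)[OF Comp_linear_right] by simp

lemma Comp_smult_left:
  "\<lbrakk>obj X; obj Y; obj Z; f \<in> mor X Y; g \<in> mor Y Z; a \<in> carrier R\<rbrakk>
    \<Longrightarrow> Comp C X Y Z (a \<odot>\<^bsub>Hom C Y Z\<^esub> g) f = a \<odot>\<^bsub>Hom C X Z\<^esub> Comp C X Y Z g f"
  using mod_homD(3)[OF Comp_linear_left] by simp

lemma Comp_smult_right:
  "\<lbrakk>obj X; obj Y; obj Z; f \<in> mor X Y; g \<in> mor Y Z; a \<in> carrier R\<rbrakk>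
    \<Longrightarrow> Comp C X Y Z g (a \<odot>\<^bsub>Hom C X Y\<^esub> f) = a \<odot>\<^bsub>Hom C X Z\<^esub> Comp C X Y Z g f"
  using mod_homD(3)[OF Comp_linear_right] by simp

lemma Hom_closed:
  assumes "obj X" "obj Y"
  shows "f \<in> mor X Y \<Longrightarrow> f' \<in> mor X Y \<Longrightarrow> f \<oplus>\<^bsub>Hom C X Y\<^esub> f' \<in> mor X Y"
    and "f \<in> mor X Y \<Longrightarrow> a \<in> carrier R \<Longrightarrow> a \<odot>\<^bsub>Hom C X Y\<^esub> f \<in> mor X Y"
proof -
  interpret module R "Hom C X Y" by (rule Hom_module[OF assms])
  show "f \<in> mor X Y \<Longrightarrow> f' \<in> mor X Y \<Longrightarrow> f \<oplus>\<^bsub>Hom C X Y\<^esub> f' \<in> mor X Y" by simp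
  show "f \<in> mor X Y \<Longrightarrow> a \<in> carrier R \<Longrightarrow> a \<odot>\<^bsub>Hom C X Y\<^esub> f \<in> mor X Y" by simp
qed

section \<open>Perfect forms and the isomorphisms they define\<close>

definition form :: "'o \<Rightarrow> 'o \<Rightarrow> ('a \<Rightarrow> 'e) \<Rightarrow> bool"
  where "form X Z t \<longleftrightarrow> obj X \<and> obj Z \<and> t \<in> mod_hom R (Hom C X Z) E"

text \<open>Functionals range over all of \<open>mod_hom\<close>, not only over the extensional ones
  in the dual, so that expressions like \<open>t(hf)\<close> can be represented without restricting
  them first.\<close>

definition left_perfect :: "'o \<Rightarrow> 'o \<Rightarrow> ('a \<Rightarrow> 'e) \<Rightarrow> bool"
  where "left_perfect X Z t \<longleftrightarrow> form X Z t \<and>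
    (\<forall>Y\<in>Obj C. \<forall>\<theta>\<in>mod_hom R (Hom C X Y) E.
      \<exists>!g. g \<in> mor Y Z \<and> (\<forall>f\<in>mor X Y. t (Comp C X Y Z g f) = \<theta> f))"

definition right_perfect :: "'o \<Rightarrow> 'o \<Rightarrow> ('a \<Rightarrow> 'e) \<Rightarrow> bool"
  where "right_perfect X Z t \<longleftrightarrow> form X Z t \<and>
    (\<forall>Y\<in>Obj C. \<forall>\<theta>\<in>mod_hom R (Hom C Y Z) E.
      \<exists>!f. f \<in> mor X Y \<and> (\<forall>g\<in>mor Y Z. t (Comp C X Y Z g f) = \<theta> g))"

definition left_rep where
  "left_rep X Z t Y \<theta> = (THE g. g \<in> mor Y Z \<and> (\<forall>f\<in>mor X Y. t (Comp C X Y Z g f) = \<theta> f))"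

definition right_rep where
  "right_rep X Z t Y \<theta> = (THE f. f \<in> mor X Y \<and> (\<forall>g\<in>mor Y Z. t (Comp C X Y Z g f) = \<theta> g))"

lemma form_left: "\<lbrakk>form X Z t; obj Y; g \<in> mor Y Z\<rbrakk> \<Longrightarrow> (\<lambda>f. t (Comp C X Y Z g f)) \<in> mod_hom R (Hom C X Y) E"
  unfolding form_def by (auto intro!: mod_hom_comp[OF Comp_linear_right])

lemma form_right: "\<lbrakk>form X Z t; obj Y; f \<in> mor X Y\<rbrakk> \<Longrightarrow> (\<lambda>g. t (Comp C X Y Z g f)) \<in> mod_hom R (Hom C Y Z) E"
  unfolding form_def by (auto intro!: mod_hom_comp[OF Comp_linear_left])

lemma dual_mod_hom: "\<theta> \<in> dual X Y \<Longrightarrow> \<theta> \<in> mod_hom R (Hom C X Y) E"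
  by (simp add: carrier_Matlis_dual)

lemma left_rep:
  assumes "left_perfect X Z t" "obj Y" "\<theta> \<in> mod_hom R (Hom C X Y) E"
  shows "left_rep X Z t Y \<theta> \<in> mor Y Z"
    and "f \<in> mor X Y \<Longrightarrow> t (Comp C X Y Z (left_rep X Z t Y \<theta>) f) = \<theta> f"
proof -
  have "\<exists>!g. g \<in> mor Y Z \<and> (\<forall>f\<in>mor X Y. t (Comp C X Y Z g f) = \<theta> f)"
    using assms by (simp add: left_perfect_def)
  from theI'[OF this, folded left_rep_def]
  show "left_rep X Z t Y \<theta> \<in> mor Y Z"
    and "f \<in> mor X Y \<Longrightarrow> t (Comp C X Y Z (left_rep X Z t Y \<theta>) f) = \<theta> f" by auto
qed

lemma right_rep:
  assumes "right_perfect X Z t" "obj Y" "\<theta> \<in> mod_hom R (Hom C Y Z) E"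
  shows "right_rep X Z t Y \<theta> \<in> mor X Y"
    and "g \<in> mor Y Z \<Longrightarrow> t (Comp C X Y Z g (right_rep X Z t Y \<theta>)) = \<theta> g"
proof -
  have "\<exists>!f. f \<in> mor X Y \<and> (\<forall>g\<in>mor Y Z. t (Comp C X Y Z g f) = \<theta> g)"
    using assms by (simp add: right_perfect_def)
  from theI'[OF this, folded right_rep_def]
  show "right_rep X Z t Y \<theta> \<in> mor X Y"
    and "g \<in> mor Y Z \<Longrightarrow> t (Comp C X Y Z g (right_rep X Z t Y \<theta>)) = \<theta> g" by auto
qed

text \<open>Both morphisms represent the same functional. This nondegeneracy is how equations
  between morphisms into \<open>Z\<close> are proved below.\<close>

lemma left_perfect_cancel:
  assumes t: "left_perfect X Z t" and "obj Y" "g \<in> mor Y Z" "g' \<in> mor Y Z"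
    and "\<And>f. f \<in> mor X Y \<Longrightarrow> t (Comp C X Y Z g f) = t (Comp C X Y Z g' f)"
  shows "g = g'"
proof -
  have "form X Z t" using t by (simp add: left_perfect_def)
  then have "(\<lambda>f. t (Comp C X Y Z g' f)) \<in> mod_hom R (Hom C X Y) E" using assms form_left by blast
  then have "\<exists>!h. h \<in> mor Y Z \<and> (\<forall>f\<in>mor X Y. t (Comp C X Y Z h f) = t (Comp C X Y Z g' f))"
    using t assms(2) by (simp add: left_perfect_def)
  then show ?thesis using assms by blast
qed

lemma right_perfect_cancel:
  assumes t: "right_perfect X Z t" and "obj Y" "f \<in> mor X Y" "f' \<in> mor X Y"
    and "\<And>g. g \<in> mor Y Z \<Longrightarrow> t (Comp C X Y Z g f) = t (Comp C X Y Z g f')"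
  shows "f = f'"
proof -
  have "form X Z t" using t by (simp add: right_perfect_def)
  then have "(\<lambda>g. t (Comp C X Y Z g f')) \<in> mod_hom R (Hom C Y Z) E" using assms form_right by blast
  then have "\<exists>!h. h \<in> mor X Y \<and> (\<forall>g\<in>mor Y Z. t (Comp C X Y Z g h) = t (Comp C X Y Z g f'))"
    using t assms(2) by (simp add: right_perfect_def)
  then show ?thesis using assms by blast
qed

lemma form_apply:
  assumes "form X Z t" "obj Y"
  shows "f \<in> mor X Y \<Longrightarrow> g \<in> mor Y Z \<Longrightarrow> g' \<in> mor Y Z \<Longrightarrow>
      t (Comp C X Y Z (g \<oplus>\<^bsub>Hom C Y Z\<^esub> g') f) = t (Comp C X Y Z g f) \<oplus>\<^bsub>E\<^esub> t (Comp C X Y Z g' f)"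
    and "f \<in> mor X Y \<Longrightarrow> f' \<in> mor X Y \<Longrightarrow> g \<in> mor Y Z \<Longrightarrow>
      t (Comp C X Y Z g (f \<oplus>\<^bsub>Hom C X Y\<^esub> f')) = t (Comp C X Y Z g f) \<oplus>\<^bsub>E\<^esub> t (Comp C X Y Z g f')"
    and "f \<in> mor X Y \<Longrightarrow> g \<in> mor Y Z \<Longrightarrow> a \<in> carrier R \<Longrightarrow>
      t (Comp C X Y Z (a \<odot>\<^bsub>Hom C Y Z\<^esub> g) f) = a \<odot>\<^bsub>E\<^esub> t (Comp C X Y Z g f)"
    and "f \<in> mor X Y \<Longrightarrow> g \<in> mor Y Z \<Longrightarrow> a \<in> carrier R \<Longrightarrow>
      t (Comp C X Y Z g (a \<odot>\<^bsub>Hom C X Y\<^esub> f)) = a \<odot>\<^bsub>E\<^esub> t (Comp C X Y Z g f)"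
  using assms mod_homD(2,3)[of t R "Hom C X Z" E]
  by (simp_all add: form_def Comp_add_left Comp_add_right Comp_smult_left Comp_smult_right)

text \<open>Linearity follows by cancelling \<open>t\<close>. The inverse sends \<open>g\<close> to
  the functional \<open>t(gf)\<close> in \<open>f\<close>, restricted to the Hom module.\<close>

lemma left_rep_mod_iso:
  assumes t: "left_perfect X Z t" and Y: "obj Y"
  shows "left_rep X Z t Y \<in> mod_iso R (Matlis_dual R E (Hom C X Y)) (Hom C Y Z)"
proof -
  let ?D = "Matlis_dual R E (Hom C X Y)" and ?r = "left_rep X Z t Y"
  have f: "form X Z t" and X: "obj X" and Z: "obj Z" using t by (auto simp: left_perfect_def form_def)
  note H = Hom_module[OF X Y]
  note D = Matlis_dual_closed[OF H E.module_axioms] and r = left_rep[OF t Y dual_mod_hom]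
  have "?r \<in> mod_hom R ?D (Hom C Y Z)"
  proof (rule mod_homI)
    fix \<theta> \<psi> assume *: "\<theta> \<in> carrier ?D" "\<psi> \<in> carrier ?D"
    show "?r (\<theta> \<oplus>\<^bsub>?D\<^esub> \<psi>) = ?r \<theta> \<oplus>\<^bsub>Hom C Y Z\<^esub> ?r \<psi>"
      by (rule left_perfect_cancel[OF t Y])
        (use * in \<open>simp_all add: D r Hom_closed[OF Y Z] form_apply[OF f Y] Matlis_dual_apply\<close>)
  next
    fix a \<theta> assume *: "a \<in> carrier R" "\<theta> \<in> carrier ?D"
    show "?r (a \<odot>\<^bsub>?D\<^esub> \<theta>) = a \<odot>\<^bsub>Hom C Y Z\<^esub> ?r \<theta>"
      by (rule left_perfect_cancel[OF t Y])
        (use * in \<open>simp_all add: D r Hom_closed[OF Y Z] form_apply[OF f Y] Matlis_dual_apply\<close>)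
  qed (rule r)
  moreover have "bij_betw ?r (carrier ?D) (mor Y Z)"
  proof (intro bij_betwI' r(1))
    fix \<theta> \<psi> assume *: "\<theta> \<in> carrier ?D" "\<psi> \<in> carrier ?D"
    then show "(?r \<theta> = ?r \<psi>) = (\<theta> = \<psi>)"
      using Matlis_dual_eqI[OF *] r(2) by metis
  next
    fix g assume g: "g \<in> mor Y Z"
    let ?\<theta> = "\<lambda>f\<in>mor X Y. t (Comp C X Y Z g f)"
    have d: "?\<theta> \<in> carrier ?D" by (rule restrict_Matlis_dual[OF H form_left[OF f Y g]])
    have "g = ?r ?\<theta>"
      by (rule left_perfect_cancel[OF t Y g r(1)[OF d]]) (use r(2)[OF d] in simp)
    then show "\<exists>\<theta>\<in>carrier ?D. g = ?r \<theta>" using d by blast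
  qed
  ultimately show ?thesis by (simp add: mod_iso_def)
qed

lemma right_rep_mod_iso:
  assumes t: "right_perfect X Z t" and Y: "obj Y"
  shows "right_rep X Z t Y \<in> mod_iso R (Matlis_dual R E (Hom C Y Z)) (Hom C X Y)"
proof -
  let ?D = "Matlis_dual R E (Hom C Y Z)" and ?r = "right_rep X Z t Y"
  have f: "form X Z t" and X: "obj X" and Z: "obj Z" using t by (auto simp: right_perfect_def form_def)
  note H = Hom_module[OF Y Z]
  note D = Matlis_dual_closed[OF H E.module_axioms] and r = right_rep[OF t Y dual_mod_hom]
  have "?r \<in> mod_hom R ?D (Hom C X Y)"
  proof (rule mod_homI)
    fix \<theta> \<psi> assume *: "\<theta> \<in> carrier ?D" "\<psi> \<in> carrier ?D"
    show "?r (\<theta> \<oplus>\<^bsub>?D\<^esub> \<psi>) = ?r \<theta> \<oplus>\<^bsub>Hom C X Y\<^esub> ?r \<psi>"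
      by (rule right_perfect_cancel[OF t Y])
        (use * in \<open>simp_all add: D r Hom_closed[OF X Y] form_apply[OF f Y] Matlis_dual_apply\<close>)
  next
    fix a \<theta> assume *: "a \<in> carrier R" "\<theta> \<in> carrier ?D"
    show "?r (a \<odot>\<^bsub>?D\<^esub> \<theta>) = a \<odot>\<^bsub>Hom C X Y\<^esub> ?r \<theta>"
      by (rule right_perfect_cancel[OF t Y])
        (use * in \<open>simp_all add: D r Hom_closed[OF X Y] form_apply[OF f Y] Matlis_dual_apply\<close>)
  qed (rule r)
  moreover have "bij_betw ?r (carrier ?D) (mor X Y)"
  proof (intro bij_betwI' r(1))
    fix \<theta> \<psi> assume *: "\<theta> \<in> carrier ?D" "\<psi> \<in> carrier ?D"
    then show "(?r \<theta> = ?r \<psi>) = (\<theta> = \<psi>)"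
      using Matlis_dual_eqI[OF *] r(2) by metis
  next
    fix h assume h: "h \<in> mor X Y"
    let ?\<theta> = "\<lambda>g\<in>mor Y Z. t (Comp C X Y Z g h)"
    have d: "?\<theta> \<in> carrier ?D" by (rule restrict_Matlis_dual[OF H form_right[OF f Y h]])
    have "h = ?r ?\<theta>"
      by (rule right_perfect_cancel[OF t Y h r(1)[OF d]]) (use r(2)[OF d] in simp)
    then show "\<exists>\<theta>\<in>carrier ?D. h = ?r \<theta>" using d by blast
  qed
  ultimately show ?thesis by (simp add: mod_iso_def)
qed

text \<open>Reflexivity: a functional on \<open>Hom(Y,Z)\<close> composed with the isomorphism from the dual of
  \<open>Hom(X,Y)\<close> is an evaluation.\<close>

lemma left_perfect_imp_right_perfect:
  assumes t: "left_perfect X Z t"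
  shows "right_perfect X Z t"
  unfolding right_perfect_def
proof (intro conjI ballI ex_ex1I)
  show f: "form X Z t" using t by (simp add: left_perfect_def)
  then have X: "obj X" and Z: "obj Z" by (auto simp: form_def)
  fix Y \<theta> assume Y: "obj Y" and \<theta>: "\<theta> \<in> mod_hom R (Hom C Y Z) E"
  let ?r = "left_rep X Z t Y"
  note iso = left_rep_mod_iso[OF t Y] and H = Hom_module[OF X Y]
  note r = left_rep[OF t Y dual_mod_hom]
  have "(\<lambda>\<psi>. \<theta> (?r \<psi>)) \<in> mod_hom R (Matlis_dual R E (Hom C X Y)) E"
    by (rule mod_hom_comp[OF _ \<theta>]) (use iso in \<open>simp add: mod_iso_def\<close>)
  then obtain f where f': "f \<in> mor X Y" "\<And>\<psi>. \<psi> \<in> dual X Y \<Longrightarrow> \<theta> (?r \<psi>) = \<psi> f"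
    using reflexive[OF X Y] by blast
  have "t (Comp C X Y Z g f) = \<theta> g" if g: "g \<in> mor Y Z" for g
  proof -
    let ?\<psi> = "\<lambda>f\<in>mor X Y. t (Comp C X Y Z g f)"
    have d: "?\<psi> \<in> dual X Y" by (rule restrict_Matlis_dual[OF H form_left[OF f Y g]])
    have "g = ?r ?\<psi>"
      by (rule left_perfect_cancel[OF t Y g r(1)[OF d]]) (use r(2)[OF d] in simp)
    then show ?thesis using f'(2)[OF d] f'(1) by simp
  qed
  then show "\<exists>f. f \<in> mor X Y \<and> (\<forall>g\<in>mor Y Z. t (Comp C X Y Z g f) = \<theta> g)" using f'(1) by blast
  fix f f'
  assume *: "f \<in> mor X Y \<and> (\<forall>g\<in>mor Y Z. t (Comp C X Y Z g f) = \<theta> g)"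
    "f' \<in> mor X Y \<and> (\<forall>g\<in>mor Y Z. t (Comp C X Y Z g f') = \<theta> g)"
  \<comment> \<open>Every functional on \<open>Hom(X,Y)\<close> has the form \<open>t(g-)\<close>,
    so all functionals agree on \<open>f\<close> and \<open>f'\<close>.\<close>
  show "f = f'"
  proof (rule separating[OF X Y])
    fix \<psi> assume \<psi>: "\<psi> \<in> dual X Y"
    show "\<psi> f = \<psi> f'" using r[OF \<psi>] * by metis
  qed (use * in auto)
qed

text \<open>The mirror image of the preceding argument, by which objects of \<open>C_l\<close> also
  yield left perfect forms.\<close>

lemma right_perfect_imp_left_perfect:
  assumes t: "right_perfect X Z t"
  shows "left_perfect X Z t"
  unfolding left_perfect_def
proof (intro conjI ballI ex_ex1I)
  show f: "form X Z t" using t by (simp add: right_perfect_def)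
  then have X: "obj X" and Z: "obj Z" by (auto simp: form_def)
  fix Y \<theta> assume Y: "obj Y" and \<theta>: "\<theta> \<in> mod_hom R (Hom C X Y) E"
  let ?r = "right_rep X Z t Y"
  note iso = right_rep_mod_iso[OF t Y] and H = Hom_module[OF Y Z]
  note r = right_rep[OF t Y dual_mod_hom]
  have "(\<lambda>\<psi>. \<theta> (?r \<psi>)) \<in> mod_hom R (Matlis_dual R E (Hom C Y Z)) E"
    by (rule mod_hom_comp[OF _ \<theta>]) (use iso in \<open>simp add: mod_iso_def\<close>)
  then obtain g where g: "g \<in> mor Y Z" "\<And>\<psi>. \<psi> \<in> dual Y Z \<Longrightarrow> \<theta> (?r \<psi>) = \<psi> g"
    using reflexive[OF Y Z] by blast
  have "t (Comp C X Y Z g h) = \<theta> h" if h: "h \<in> mor X Y" for h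
  proof -
    let ?\<psi> = "\<lambda>g\<in>mor Y Z. t (Comp C X Y Z g h)"
    have d: "?\<psi> \<in> dual Y Z" by (rule restrict_Matlis_dual[OF H form_right[OF f Y h]])
    have "h = ?r ?\<psi>"
      by (rule right_perfect_cancel[OF t Y h r(1)[OF d]]) (use r(2)[OF d] in simp)
    then show ?thesis using g(2)[OF d] g(1) by simp
  qed
  then show "\<exists>g. g \<in> mor Y Z \<and> (\<forall>f\<in>mor X Y. t (Comp C X Y Z g f) = \<theta> f)" using g(1) by blast
  fix g g'
  assume *: "g \<in> mor Y Z \<and> (\<forall>f\<in>mor X Y. t (Comp C X Y Z g f) = \<theta> f)"
    "g' \<in> mor Y Z \<and> (\<forall>f\<in>mor X Y. t (Comp C X Y Z g' f) = \<theta> f)"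
  show "g = g'"
  proof (rule separating[OF Y Z])
    fix \<psi> assume \<psi>: "\<psi> \<in> dual Y Z"
    show "\<psi> g = \<psi> g'" using r[OF \<psi>] * by metis
  qed (use * in auto)
qed


subsection \<open>Representability\<close>

text \<open>Naturality is associativity of composition, tested under \<open>t\<close>.\<close>

lemma left_perfect_natural_iso:
  assumes t: "left_perfect X Z t"
  shows "natural_iso_contra R C (D_from R E C X) (Hom_to C Z) (left_rep X Z t)"
proof -
  have X: "obj X" and Z: "obj Z" using t by (auto simp: left_perfect_def form_def)
  have "left_rep X Z t Y (compose (mor X Y) \<theta> (Comp C X Y Y' f)) =
      Comp C Y Y' Z (left_rep X Z t Y' \<theta>) f"
    if Y: "obj Y" "obj Y'" and f: "f \<in> mor Y Y'" and \<theta>: "\<theta> \<in> dual X Y'" for Y Y' f \<theta>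
  proof -
    let ?\<theta> = "compose (mor X Y) \<theta> (Comp C X Y Y' f)"
    have "(\<lambda>h. \<theta> (Comp C X Y Y' f h)) \<in> mod_hom R (Hom C X Y) E"
      by (rule mod_hom_comp[OF Comp_linear_right[OF X Y f] dual_mod_hom[OF \<theta>]])
    then have d: "?\<theta> \<in> dual X Y"
      unfolding compose_def by (rule restrict_Matlis_dual[OF Hom_module[OF X Y(1)]])
    note r = left_rep[OF t Y(1) dual_mod_hom[OF d]] and r' = left_rep[OF t Y(2) dual_mod_hom[OF \<theta>]]
    show ?thesis
    proof (rule left_perfect_cancel[OF t Y(1) r(1)])
      show "Comp C Y Y' Z (left_rep X Z t Y' \<theta>) f \<in> mor Y Z" using Y Z f r'(1) by simp
      fix h assume h: "h \<in> mor X Y"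
      then show "t (Comp C X Y Z (left_rep X Z t Y ?\<theta>) h) =
          t (Comp C X Y Z (Comp C Y Y' Z (left_rep X Z t Y' \<theta>) f) h)"
        using X Y Z f r r' by (simp add: compose_eq Comp_assoc)
    qed
  qed
  then show ?thesis
    using left_rep_mod_iso[OF t]
    by (simp add: natural_iso_contra_def D_from_def Hom_from_def Hom_to_def Matlis_dual_map_def)
qed

lemma right_perfect_natural_iso:
  assumes t: "right_perfect X Z t"
  shows "natural_iso_cov R C (D_to R E C Z) (Hom_from C X) (right_rep X Z t)"
proof -
  have X: "obj X" and Z: "obj Z" using t by (auto simp: right_perfect_def form_def)
  have "right_rep X Z t Y' (compose (mor Y' Z) \<theta> (\<lambda>g. Comp C Y Y' Z g f)) =
      Comp C X Y Y' f (right_rep X Z t Y \<theta>)"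
    if Y: "obj Y" "obj Y'" and f: "f \<in> mor Y Y'" and \<theta>: "\<theta> \<in> dual Y Z" for Y Y' f \<theta>
  proof -
    let ?\<theta> = "compose (mor Y' Z) \<theta> (\<lambda>g. Comp C Y Y' Z g f)"
    have "(\<lambda>h. \<theta> (Comp C Y Y' Z h f)) \<in> mod_hom R (Hom C Y' Z) E"
      by (rule mod_hom_comp[OF Comp_linear_left[OF Y Z f] dual_mod_hom[OF \<theta>]])
    then have d: "?\<theta> \<in> dual Y' Z"
      unfolding compose_def by (rule restrict_Matlis_dual[OF Hom_module[OF Y(2) Z]])
    note r = right_rep[OF t Y(2) dual_mod_hom[OF d]] and r' = right_rep[OF t Y(1) dual_mod_hom[OF \<theta>]]
    show ?thesis
    proof (rule right_perfect_cancel[OF t Y(2) r(1)])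
      show "Comp C X Y Y' f (right_rep X Z t Y \<theta>) \<in> mor X Y'" using X Y f r'(1) by simp
      fix h assume h: "h \<in> mor Y' Z"
      then show "t (Comp C X Y' Z h (right_rep X Z t Y' ?\<theta>)) =
          t (Comp C X Y' Z h (Comp C X Y Y' f (right_rep X Z t Y \<theta>)))"
        using X Y Z f r r' by (simp add: compose_eq Comp_assoc[symmetric])
    qed
  qed
  then show ?thesis
    using right_rep_mod_iso[OF t]
    by (simp add: natural_iso_cov_def D_to_def Hom_from_def Hom_to_def Matlis_dual_map_def)
qed

text \<open>The form corresponds to the identity of the representing object (Yoneda).\<close>

lemma natural_iso_contra_form:
  assumes X: "obj X" and Z: "obj Z"
    and \<eta>: "natural_iso_contra R C (D_from R E C X) (Hom_to C Z) \<eta>"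
  obtains t where "left_perfect X Z t" "t \<in> dual X Z"
    "\<And>Y \<theta> g. obj Y \<Longrightarrow> \<theta> \<in> dual X Y \<Longrightarrow> g \<in> mor Y Z \<Longrightarrow>
      \<eta> Y \<theta> = g \<longleftrightarrow> (\<forall>f\<in>mor X Y. t (Comp C X Y Z g f) = \<theta> f)"
proof -
  have iso: "\<eta> Y \<in> mod_iso R (Matlis_dual R E (Hom C X Y)) (Hom C Y Z)" if "obj Y" for Y
    using \<eta> that by (simp add: natural_iso_contra_def D_from_def Hom_from_def Hom_to_def)
  have nat: "\<eta> Y (compose (mor X Y) \<theta> (Comp C X Y Y' f)) = Comp C Y Y' Z (\<eta> Y' \<theta>) f"
    if "obj Y" "obj Y'" "f \<in> mor Y Y'" "\<theta> \<in> dual X Y'" for Y Y' f \<theta>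
    using \<eta> that
    by (simp add: natural_iso_contra_def D_from_def Hom_from_def Hom_to_def Matlis_dual_map_def)
  have bij: "bij_betw (\<eta> Y) (dual X Y) (mor Y Z)" if "obj Y" for Y
    using iso[OF that] by (simp add: mod_iso_def)
  obtain t where t: "t \<in> dual X Z" "\<eta> Z t = Id C Z"
    using bij[OF Z] Id_closed[OF Z] by (metis bij_betw_imp_surj_on imageE)
  have form: "form X Z t" using X Z dual_mod_hom[OF t(1)] by (simp add: form_def)
  have eq: "\<eta> Y \<theta> = g \<longleftrightarrow> (\<forall>f\<in>mor X Y. t (Comp C X Y Z g f) = \<theta> f)"
    if Y: "obj Y" and \<theta>: "\<theta> \<in> dual X Y" and g: "g \<in> mor Y Z" for Y \<theta> g
  proof -
    let ?\<theta> = "compose (mor X Y) t (Comp C X Y Z g)"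
    have d: "?\<theta> \<in> dual X Y"
      unfolding compose_def by (rule restrict_Matlis_dual[OF Hom_module[OF X Y] form_left[OF form Y g]])
    \<comment> \<open>Naturality along \<open>g\<close>, applied to \<open>t\<close>: since
      \<open>t\<close> corresponds to the identity of \<open>Z\<close>, the functional
      \<open>t(g-)\<close> corresponds to \<open>g\<close>.\<close>
    have "\<eta> Y ?\<theta> = g" using nat[OF Y Z g t(1)] t(2) Comp_Id_left[OF Y Z g] by simp
    then have "\<eta> Y \<theta> = g \<longleftrightarrow> \<theta> = ?\<theta>"
      using bij_betw_imp_inj_on[OF bij[OF Y]] \<theta> d by (metis inj_onD)
    also have "\<dots> \<longleftrightarrow> (\<forall>f\<in>mor X Y. t (Comp C X Y Z g f) = \<theta> f)"
      using Matlis_dual_eqI[OF \<theta> d] by (auto simp: compose_eq)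
    finally show ?thesis .
  qed
  have "\<exists>!g. g \<in> mor Y Z \<and> (\<forall>f\<in>mor X Y. t (Comp C X Y Z g f) = \<theta> f)"
    if Y: "obj Y" and \<theta>: "\<theta> \<in> mod_hom R (Hom C X Y) E" for Y \<theta>
  proof -
    have d: "restrict \<theta> (mor X Y) \<in> dual X Y" by (rule restrict_Matlis_dual[OF Hom_module[OF X Y] \<theta>])
    have "\<eta> Y (restrict \<theta> (mor X Y)) \<in> mor Y Z" using bij_betwE[OF bij[OF Y]] d by blast
    then show ?thesis using eq[OF Y d] by (intro ex1I[of _ "\<eta> Y (restrict \<theta> (mor X Y))"]) auto
  qed
  then have "left_perfect X Z t" using form by (simp add: left_perfect_def)
  then show thesis using that t(1) eq by blast
qed

text \<open>The dual Yoneda argument, with the identity of \<open>X\<close>. Only the existence of a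
  form is recorded, which is what membership in \<open>C_l\<close> requires.\<close>

lemma natural_iso_cov_form:
  assumes X: "obj X" and Z: "obj Z"
    and \<eta>: "natural_iso_cov R C (D_to R E C Z) (Hom_from C X) \<eta>"
  obtains t where "right_perfect X Z t"
proof -
  have iso: "\<eta> Y \<in> mod_iso R (Matlis_dual R E (Hom C Y Z)) (Hom C X Y)" if "obj Y" for Y
    using \<eta> that by (simp add: natural_iso_cov_def D_to_def Hom_from_def Hom_to_def)
  have nat: "\<eta> Y' (compose (mor Y' Z) \<theta> (\<lambda>g. Comp C Y Y' Z g f)) = Comp C X Y Y' f (\<eta> Y \<theta>)"
    if "obj Y" "obj Y'" "f \<in> mor Y Y'" "\<theta> \<in> dual Y Z" for Y Y' f \<theta>
    using \<eta> that
    by (simp add: natural_iso_cov_def D_to_def Hom_from_def Hom_to_def Matlis_dual_map_def)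
  have bij: "bij_betw (\<eta> Y) (dual Y Z) (mor X Y)" if "obj Y" for Y
    using iso[OF that] by (simp add: mod_iso_def)
  obtain t where t: "t \<in> dual X Z" "\<eta> X t = Id C X"
    using bij[OF X] Id_closed[OF X] by (metis bij_betw_imp_surj_on imageE)
  have form: "form X Z t" using X Z dual_mod_hom[OF t(1)] by (simp add: form_def)
  have eq: "\<eta> Y \<theta> = f \<longleftrightarrow> (\<forall>g\<in>mor Y Z. t (Comp C X Y Z g f) = \<theta> g)"
    if Y: "obj Y" and \<theta>: "\<theta> \<in> dual Y Z" and f: "f \<in> mor X Y" for Y \<theta> f
  proof -
    let ?\<theta> = "compose (mor Y Z) t (\<lambda>g. Comp C X Y Z g f)"
    have d: "?\<theta> \<in> dual Y Z"
      unfolding compose_def by (rule restrict_Matlis_dual[OF Hom_module[OF Y Z] form_right[OF form Y f]])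
    have "\<eta> Y ?\<theta> = f" using nat[OF X Y f t(1)] t(2) Comp_Id_right[OF X Y f] by simp
    then have "\<eta> Y \<theta> = f \<longleftrightarrow> \<theta> = ?\<theta>"
      using bij_betw_imp_inj_on[OF bij[OF Y]] \<theta> d by (metis inj_onD)
    also have "\<dots> \<longleftrightarrow> (\<forall>g\<in>mor Y Z. t (Comp C X Y Z g f) = \<theta> g)"
      using Matlis_dual_eqI[OF \<theta> d] by (auto simp: compose_eq)
    finally show ?thesis .
  qed
  have "\<exists>!f. f \<in> mor X Y \<and> (\<forall>g\<in>mor Y Z. t (Comp C X Y Z g f) = \<theta> g)"
    if Y: "obj Y" and \<theta>: "\<theta> \<in> mod_hom R (Hom C Y Z) E" for Y \<theta>
  proof -
    have d: "restrict \<theta> (mor Y Z) \<in> dual Y Z" by (rule restrict_Matlis_dual[OF Hom_module[OF Y Z] \<theta>])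
    have "\<eta> Y (restrict \<theta> (mor Y Z)) \<in> mor X Y" using bij_betwE[OF bij[OF Y]] d by blast
    then show ?thesis using eq[OF Y d] by (intro ex1I[of _ "\<eta> Y (restrict \<theta> (mor Y Z))"]) auto
  qed
  then have "right_perfect X Z t" using form by (simp add: right_perfect_def)
  then show thesis using that by blast
qed

abbreviation obj_r where "obj_r X \<equiv> X \<in> Obj (C_r R E C)"
abbreviation obj_l where "obj_l X \<equiv> X \<in> Obj (C_l R E C)"

lemma C_r_C_l_simps [simp]:
  "Hom (C_r R E C) = Hom C" "Id (C_r R E C) = Id C" "Comp (C_r R E C) = Comp C"
  "Hom (C_l R E C) = Hom C" "Id (C_l R E C) = Id C" "Comp (C_l R E C) = Comp C"
  "iso_in (C_r R E C) = iso_in C" "iso_in (C_l R E C) = iso_in C"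
  by (simp_all add: C_r_def C_l_def full_subcategory_def iso_in_def fun_eq_iff)

lemma obj_r_iff: "obj_r X \<longleftrightarrow> (\<exists>Z t. left_perfect X Z t)"
proof
  assume "obj_r X"
  then obtain Z \<eta> where "obj X" "obj Z" "natural_iso_contra R C (D_from R E C X) (Hom_to C Z) \<eta>"
    by (auto simp: C_r_def full_subcategory_def)
  then show "\<exists>Z t. left_perfect X Z t" using natural_iso_contra_form by metis
next
  assume "\<exists>Z t. left_perfect X Z t"
  then obtain Z t where t: "left_perfect X Z t" by blast
  then have "obj X" "obj Z" by (auto simp: left_perfect_def form_def)
  then show "obj_r X"
    using left_perfect_natural_iso[OF t] by (auto simp: C_r_def full_subcategory_def)
qed

text \<open>Together with \<open>obj_r_iff\<close> this puts \<open>C_r\<close> and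
  \<open>C_l\<close> at the two ends of the same forms: it places the values of \<open>S\<close> in
  \<open>C_l\<close> and supplies the objects for the quasi-inverse.\<close>

lemma obj_l_iff: "obj_l Z \<longleftrightarrow> (\<exists>X t. left_perfect X Z t)"
proof
  assume "obj_l Z"
  then obtain X \<eta> where "obj X" "obj Z" "natural_iso_cov R C (D_to R E C Z) (Hom_from C X) \<eta>"
    by (auto simp: C_l_def full_subcategory_def)
  then show "\<exists>X t. left_perfect X Z t"
    using natural_iso_cov_form right_perfect_imp_left_perfect by metis
next
  assume "\<exists>X t. left_perfect X Z t"
  then obtain X t where t: "right_perfect X Z t" using left_perfect_imp_right_perfect by blast
  then have "obj X" "obj Z" by (auto simp: right_perfect_def form_def)
  then show "obj_l Z"
    using right_perfect_natural_iso[OF t] by (auto simp: C_l_def full_subcategory_def)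
qed


subsection \<open>Mates\<close>

text \<open>Adjoint operators with respect to the two pairings. Kept as a relation, it lets
  identities, composites and linear combinations be treated once for both \<open>S\<close> and its
  quasi-inverse.\<close>

definition mate ::
    "'o \<Rightarrow> 'o \<Rightarrow> ('a \<Rightarrow> 'e) \<Rightarrow> 'o \<Rightarrow> 'o \<Rightarrow> ('a \<Rightarrow> 'e) \<Rightarrow> 'a \<Rightarrow> 'a \<Rightarrow> bool"
  where "mate X Z t X' Z' t' f g \<longleftrightarrow> f \<in> mor X X' \<and> g \<in> mor Z Z' \<and>
    (\<forall>h\<in>mor X' Z. t' (Comp C X' Z Z' g h) = t (Comp C X X' Z h f))"

lemma left_perfectD:
  assumes "left_perfect X Z t"
  shows "obj X" "obj Z" "form X Z t" "right_perfect X Z t"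
  using assms left_perfect_imp_right_perfect by (auto simp: left_perfect_def form_def)

lemma mate_right_ex1:
  assumes t: "left_perfect X Z t" and t': "left_perfect X' Z' t'" and f: "f \<in> mor X X'"
  shows "\<exists>!g. mate X Z t X' Z' t' f g"
proof -
  have "(\<lambda>h. t (Comp C X X' Z h f)) \<in> mod_hom R (Hom C X' Z) E"
    using form_right left_perfectD t t' f by blast
  then show ?thesis using t' f left_perfectD(2)[OF t] by (simp add: left_perfect_def mate_def)
qed

text \<open>Uses that \<open>t\<close> is perfect on the right, while \<open>mate_right_ex1\<close>
  uses that \<open>t'\<close> is perfect on the left.\<close>

lemma mate_left_ex1:
  assumes t: "left_perfect X Z t" and t': "left_perfect X' Z' t'" and g: "g \<in> mor Z Z'"
  shows "\<exists>!f. mate X Z t X' Z' t' f g"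
proof -
  have "(\<lambda>h. t' (Comp C X' Z Z' g h)) \<in> mod_hom R (Hom C X' Z) E"
    using form_left left_perfectD t t' g by blast
  then have "\<exists>!f. f \<in> mor X X' \<and> (\<forall>h\<in>mor X' Z. t (Comp C X X' Z h f) = t' (Comp C X' Z Z' g h))"
    using left_perfectD(4)[OF t] left_perfectD(1)[OF t'] by (simp add: right_perfect_def)
  then show ?thesis using g by (simp add: mate_def eq_commute)
qed

lemma mate_right_unique:
  "\<lbrakk>left_perfect X Z t; left_perfect X' Z' t'; mate X Z t X' Z' t' f g; mate X Z t X' Z' t' f g'\<rbrakk>
    \<Longrightarrow> g = g'"
  using mate_right_ex1[of X Z t X' Z' t' f] by (auto simp: mate_def)

lemma mate_left_unique:
  "\<lbrakk>left_perfect X Z t; left_perfect X' Z' t'; mate X Z t X' Z' t' f g; mate X Z t X' Z' t' f' g\<rbrakk>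
    \<Longrightarrow> f = f'"
  using mate_left_ex1[of X Z t X' Z' t' g] by (auto simp: mate_def)

lemma mate_Id:
  assumes "obj X" "obj Z"
  shows "mate X Z t X Z t (Id C X) (Id C Z)"
  using assms by (simp add: mate_def Id_closed Comp_Id_left Comp_Id_right)

lemma mate_Comp:
  assumes o: "obj X" "obj Z" "obj X'" "obj Z'" "obj X''" "obj Z''"
    and m: "mate X Z t X' Z' t' f g" and m': "mate X' Z' t' X'' Z'' t'' f' g'"
  shows "mate X Z t X'' Z'' t'' (Comp C X X' X'' f' f) (Comp C Z Z' Z'' g' g)"
proof -
  have c: "f \<in> mor X X'" "g \<in> mor Z Z'" "f' \<in> mor X' X''" "g' \<in> mor Z' Z''"
    using m m' by (auto simp: mate_def)
  have "t'' (Comp C X'' Z Z'' (Comp C Z Z' Z'' g' g) h) = t (Comp C X X'' Z h (Comp C X X' X'' f' f))"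
    if h: "h \<in> mor X'' Z" for h
  proof -
    have "t'' (Comp C X'' Z Z'' (Comp C Z Z' Z'' g' g) h) = t'' (Comp C X'' Z' Z'' g' (Comp C X'' Z Z' g h))"
      using o c h by (simp add: Comp_assoc)
    also have "\<dots> = t' (Comp C X' X'' Z' (Comp C X'' Z Z' g h) f')"
      using o c h m' by (simp add: mate_def)
    also have "\<dots> = t' (Comp C X' Z Z' g (Comp C X' X'' Z h f'))"
      using o c h by (simp add: Comp_assoc)
    also have "\<dots> = t (Comp C X X' Z (Comp C X' X'' Z h f') f)"
      using o c h m by (simp add: mate_def)
    also have "\<dots> = t (Comp C X X'' Z h (Comp C X X' X'' f' f))"
      using o c h by (simp add: Comp_assoc)
    finally show ?thesis .
  qed
  then show ?thesis using o c by (simp add: mate_def)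
qed

lemma mate_add:
  assumes t: "form X Z t" and t': "form X' Z' t'"
    and m: "mate X Z t X' Z' t' f g" and m': "mate X Z t X' Z' t' f' g'"
  shows "mate X Z t X' Z' t' (f \<oplus>\<^bsub>Hom C X X'\<^esub> f') (g \<oplus>\<^bsub>Hom C Z Z'\<^esub> g')"
  using assms by (simp add: mate_def Hom_closed form_apply form_def[of X] form_def[of X'])

lemma mate_smult:
  assumes t: "form X Z t" and t': "form X' Z' t'"
    and m: "mate X Z t X' Z' t' f g" and a: "a \<in> carrier R"
  shows "mate X Z t X' Z' t' (a \<odot>\<^bsub>Hom C X X'\<^esub> f) (a \<odot>\<^bsub>Hom C Z Z'\<^esub> g)"
  using assms by (simp add: mate_def Hom_closed form_apply form_def[of X] form_def[of X'])

text \<open>The mates of two inverse morphisms have composites that are mates of identities, hence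
  identities by uniqueness.\<close>

lemma mate_iso_iff:
  assumes t: "left_perfect X Z t" and t': "left_perfect X' Z' t'" and m: "mate X Z t X' Z' t' f g"
  shows "f \<in> iso_in C X X' \<longleftrightarrow> g \<in> iso_in C Z Z'"
proof
  note o = left_perfectD(1,2)[OF t] left_perfectD(1,2)[OF t']
  have c: "f \<in> mor X X'" "g \<in> mor Z Z'" using m by (auto simp: mate_def)
  {
    assume "f \<in> iso_in C X X'"
    then obtain f' where f': "f' \<in> mor X' X" "Comp C X X' X f' f = Id C X" "Comp C X' X X' f f' = Id C X'"
      by (auto simp: iso_in_def)
    obtain g' where m': "mate X' Z' t' X Z t f' g'" using mate_right_ex1[OF t' t f'(1)] by blast
    have "Comp C Z Z' Z g' g = Id C Z"
      by (rule mate_right_unique[OF t t mate_Comp[OF _ _ _ _ _ _ m m']])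
        (use o f' mate_Id in simp_all)
    moreover have "Comp C Z' Z Z' g g' = Id C Z'"
      by (rule mate_right_unique[OF t' t' mate_Comp[OF _ _ _ _ _ _ m' m]])
        (use o f' mate_Id in simp_all)
    ultimately show "g \<in> iso_in C Z Z'" using c m' by (auto simp: iso_in_def mate_def)
  next
    assume "g \<in> iso_in C Z Z'"
    then obtain g' where g': "g' \<in> mor Z' Z" "Comp C Z Z' Z g' g = Id C Z" "Comp C Z' Z Z' g g' = Id C Z'"
      by (auto simp: iso_in_def)
    obtain f' where m': "mate X' Z' t' X Z t f' g'" using mate_left_ex1[OF t' t g'(1)] by blast
    have "Comp C X X' X f' f = Id C X"
      by (rule mate_left_unique[OF t t mate_Comp[OF _ _ _ _ _ _ m m']])
        (use o g' mate_Id in simp_all)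
    moreover have "Comp C X' X X' f f' = Id C X'"
      by (rule mate_left_unique[OF t' t' mate_Comp[OF _ _ _ _ _ _ m' m]])
        (use o g' mate_Id in simp_all)
    ultimately show "f \<in> iso_in C X X'" using c m' by (auto simp: iso_in_def mate_def)
  }
qed

lemma Id_iso: "obj X \<Longrightarrow> Id C X \<in> iso_in C X X"
  by (auto simp: iso_in_def Id_closed Comp_Id_left intro!: bexI[of _ "Id C X"])


subsection \<open>Serre functors\<close>

text \<open>The trace forms of Serre duality: \<open>t X\<close> plays the role of the functional
  that the duality at \<open>X\<close> and \<open>S X\<close> sends to the identity of
  \<open>S X\<close>. The mate condition encodes naturality in \<open>X\<close>.\<close>

definition Serre_forms :: "('o, 'a, 'o, 'a) cat_functor \<Rightarrow> ('o \<Rightarrow> 'a \<Rightarrow> 'e) \<Rightarrow> bool"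
  where "Serre_forms S t \<longleftrightarrow>
    (\<forall>X. obj_r X \<longrightarrow> left_perfect X (on_obj S X) (t X)) \<and>
    (\<forall>X X' f. obj_r X \<and> obj_r X' \<and> f \<in> mor X X' \<longrightarrow>
      mate X (on_obj S X) (t X) X' (on_obj S X') (t X') f (on_hom S X X' f))"

lemma obj_r_obj: "obj_r X \<Longrightarrow> obj X"
  by (simp add: C_r_def full_subcategory_def)

lemma obj_l_obj: "obj_l X \<Longrightarrow> obj X"
  by (simp add: C_l_def full_subcategory_def)

text \<open>The duality is \<open>left_rep\<close>. Its naturality in \<open>X\<close>, tested under
  \<open>t X'\<close> against a morphism \<open>u\<close> from \<open>X'\<close> to
  \<open>Y\<close>, is the mate condition applied to the composite of the representing morphism with
  \<open>u\<close>.\<close>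

lemma generalized_Serre_functorI:
  assumes S: "is_functor (C_r R E C) (C_l R E C) S" and t: "Serre_forms S t"
  shows "generalized_Serre_functor R E C S"
proof -
  let ?\<phi> = "\<lambda>X. left_rep X (on_obj S X) (t X)"
  have p: "left_perfect X (on_obj S X) (t X)" if "obj_r X" for X
    using t that by (simp add: Serre_forms_def)
  have "?\<phi> X' Y (compose (mor X' Y) \<theta> (\<lambda>g. Comp C X X' Y g f)) =
      Comp C Y (on_obj S X) (on_obj S X') (on_hom S X X' f) (?\<phi> X Y \<theta>)"
    if X: "obj_r X" "obj_r X'" and f: "f \<in> mor X X'" and Y: "obj Y" and \<theta>: "\<theta> \<in> dual X Y"
    for X X' f Y \<theta>
  proof -
    let ?\<theta> = "compose (mor X' Y) \<theta> (\<lambda>g. Comp C X X' Y g f)"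
    note q = p[OF X(1)] and q' = p[OF X(2)]
    note o = left_perfectD(1,2)[OF q] left_perfectD(1,2)[OF q'] Y
    have m: "mate X (on_obj S X) (t X) X' (on_obj S X') (t X') f (on_hom S X X' f)"
      using t X f by (simp add: Serre_forms_def)
    then have Sf: "on_hom S X X' f \<in> mor (on_obj S X) (on_obj S X')" by (simp add: mate_def)
    have "(\<lambda>g. \<theta> (Comp C X X' Y g f)) \<in> mod_hom R (Hom C X' Y) E"
      by (rule mod_hom_comp[OF Comp_linear_left[OF o(1,3,5) f] dual_mod_hom[OF \<theta>]])
    then have d: "?\<theta> \<in> dual X' Y"
      unfolding compose_def by (rule restrict_Matlis_dual[OF Hom_module[OF o(3,5)]])
    note r = left_rep[OF q Y dual_mod_hom[OF \<theta>]] and r' = left_rep[OF q' Y dual_mod_hom[OF d]]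
    show ?thesis
    proof (rule left_perfect_cancel[OF q' Y r'(1)])
      show "Comp C Y (on_obj S X) (on_obj S X') (on_hom S X X' f) (?\<phi> X Y \<theta>) \<in> mor Y (on_obj S X')"
        using o Sf r(1) by simp
      fix u assume u: "u \<in> mor X' Y"
      have "t X' (Comp C X' Y (on_obj S X') (?\<phi> X' Y ?\<theta>) u) = \<theta> (Comp C X X' Y u f)"
        using r'(2)[OF u] u by (simp add: compose_eq)
      also have "\<dots> = t X (Comp C X Y (on_obj S X) (?\<phi> X Y \<theta>) (Comp C X X' Y u f))"
        using r(2) o u f by simp
      also have "\<dots> = t X (Comp C X X' (on_obj S X) (Comp C X' Y (on_obj S X) (?\<phi> X Y \<theta>) u) f)"
        using r(1) o u f by (simp add: Comp_assoc)
      also have "\<dots> = t X' (Comp C X' (on_obj S X) (on_obj S X') (on_hom S X X' f)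
          (Comp C X' Y (on_obj S X) (?\<phi> X Y \<theta>) u))"
        using m r(1) o u by (simp add: mate_def)
      also have "\<dots> = t X' (Comp C X' Y (on_obj S X')
          (Comp C Y (on_obj S X) (on_obj S X') (on_hom S X X' f) (?\<phi> X Y \<theta>)) u)"
        using r(1) o u Sf by (simp add: Comp_assoc)
      finally show "t X' (Comp C X' Y (on_obj S X') (?\<phi> X' Y ?\<theta>) u) = \<dots>" .
    qed
  qed
  then show ?thesis
    unfolding generalized_Serre_functor_def
    using S left_perfect_natural_iso[OF p]
    by (intro conjI exI[of _ ?\<phi>]) (simp_all add: D_to_def Hom_to_def Matlis_dual_map_def Matlis_dual_def)
qed

text \<open>Turns an arbitrary solution, with its abstract isomorphisms, into forms, so that mates
  can be used for it.\<close>

lemma generalized_Serre_functorD: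
  assumes "generalized_Serre_functor R E C S"
  obtains t where "is_functor (C_r R E C) (C_l R E C) S" "Serre_forms S t"
proof -
  have S: "is_functor (C_r R E C) (C_l R E C) S"
    using assms by (simp add: generalized_Serre_functor_def)
  obtain \<phi> where \<phi>: "\<And>X. obj_r X \<Longrightarrow>
        natural_iso_contra R C (D_from R E C X) (Hom_to C (on_obj S X)) (\<phi> X)"
    and nat': "\<forall>X\<in>Obj (C_r R E C). \<forall>X'\<in>Obj (C_r R E C). \<forall>f\<in>mor X X'. \<forall>Y\<in>Obj C. \<forall>\<theta>\<in>dual X Y.
        \<phi> X' Y (on_mor (D_to R E C Y) X X' f \<theta>) =
        Comp C Y (on_obj S X) (on_obj S X') (on_hom S X X' f) (\<phi> X Y \<theta>)"
    using assms unfolding generalized_Serre_functor_def by blast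
  have nat: "\<phi> X' Y (compose (mor X' Y) \<theta> (\<lambda>g. Comp C X X' Y g f)) =
        Comp C Y (on_obj S X) (on_obj S X') (on_hom S X X' f) (\<phi> X Y \<theta>)"
    if "obj_r X" "obj_r X'" "f \<in> mor X X'" "obj Y" "\<theta> \<in> dual X Y" for X X' f Y \<theta>
    using nat' that by (simp add: D_to_def Hom_to_def Matlis_dual_map_def)
  have So: "obj (on_obj S X)" if "obj_r X" for X
    using S that obj_l_obj by (auto simp: is_functor_def)
  have Sf: "on_hom S X X' f \<in> mor (on_obj S X) (on_obj S X')"
    if "obj_r X" "obj_r X'" "f \<in> mor X X'" for X X' f
    using S that by (auto simp: is_functor_def)
  have "\<exists>t. left_perfect X (on_obj S X) t \<and> t \<in> dual X (on_obj S X) \<and>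
      (\<forall>Y \<theta> g. obj Y \<longrightarrow> \<theta> \<in> dual X Y \<longrightarrow> g \<in> mor Y (on_obj S X) \<longrightarrow>
        (\<phi> X Y \<theta> = g \<longleftrightarrow> (\<forall>f\<in>mor X Y. t (Comp C X Y (on_obj S X) g f) = \<theta> f)))"
    if X: "obj_r X" for X
    by (rule natural_iso_contra_form[OF obj_r_obj[OF X] So[OF X] \<phi>[OF X]]) blast
  then obtain t where p: "\<And>X. obj_r X \<Longrightarrow> left_perfect X (on_obj S X) (t X)"
    and d: "\<And>X. obj_r X \<Longrightarrow> t X \<in> dual X (on_obj S X)"
    and eq: "\<And>X Y \<theta> g. \<lbrakk>obj_r X; obj Y; \<theta> \<in> dual X Y; g \<in> mor Y (on_obj S X)\<rbrakk> \<Longrightarrow>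
        \<phi> X Y \<theta> = g \<longleftrightarrow> (\<forall>f\<in>mor X Y. t X (Comp C X Y (on_obj S X) g f) = \<theta> f)"
    by metis
  have "mate X (on_obj S X) (t X) X' (on_obj S X') (t X') f (on_hom S X X' f)"
    if X: "obj_r X" "obj_r X'" and f: "f \<in> mor X X'" for X X' f
  proof -
    let ?Z = "on_obj S X" and ?Z' = "on_obj S X'"
    let ?\<theta> = "compose (mor X' ?Z) (t X) (\<lambda>g. Comp C X X' ?Z g f)"
    note o = obj_r_obj[OF X(1)] obj_r_obj[OF X(2)] So[OF X(1)] So[OF X(2)]
    have d': "?\<theta> \<in> dual X' ?Z"
      unfolding compose_def
      by (rule restrict_Matlis_dual[OF Hom_module[OF o(2,3)] form_right[OF left_perfectD(3)[OF p[OF X(1)]] o(2) f]])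
    \<comment> \<open>Naturality in \<open>X\<close>, evaluated at the object \<open>S X\<close> and
      the functional \<open>t X\<close> belonging to the identity, exhibits \<open>S f\<close> as
      the morphism representing \<open>t X (-f)\<close>, which is the mate of
      \<open>f\<close>.\<close>
    have "\<phi> X ?Z (t X) = Id C ?Z"
      by (subst eq[OF X(1) o(3) d[OF X(1)] Id_closed[OF o(3)]]) (use o in \<open>simp add: Comp_Id_left\<close>)
    then have "\<phi> X' ?Z ?\<theta> = Comp C ?Z ?Z ?Z' (on_hom S X X' f) (Id C ?Z)"
      using nat[OF X f o(3) d[OF X(1)]] by simp
    also have "\<dots> = on_hom S X X' f" by (rule Comp_Id_right[OF o(3,4) Sf[OF X f]])
    finally have "\<forall>h\<in>mor X' ?Z. t X' (Comp C X' ?Z ?Z' (on_hom S X X' f) h) = ?\<theta> h"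
      using eq[OF X(2) o(3) d' Sf[OF X f]] by simp
    then show ?thesis using f Sf[OF X f] by (simp add: mate_def compose_eq)
  qed
  then have "Serre_forms S t" using p by (simp add: Serre_forms_def)
  then show thesis using that S by blast
qed

text \<open>Only the representing objects and forms are chosen. The action on morphisms is then
  forced, and the functor laws follow from the uniqueness of mates.\<close>

lemma exists_Serre_functor: "\<exists>S. generalized_Serre_functor R E C S"
proof -
  obtain Z t where p: "\<And>X. obj_r X \<Longrightarrow> left_perfect X (Z X) (t X)"
    using obj_r_iff by metis
  define S where "S = \<lparr>on_obj = Z, on_hom = (\<lambda>X X' f. THE g. mate X (Z X) (t X) X' (Z X') (t X') f g)\<rparr>"
  have So: "on_obj S X = Z X" for X by (simp add: S_def)
  have m: "mate X (Z X) (t X) X' (Z X') (t X') f (on_hom S X X' f)"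
    if "obj_r X" "obj_r X'" "f \<in> mor X X'" for X X' f
    using theI'[OF mate_right_ex1[OF p p that(3)]] that by (simp add: S_def)
  have forms: "Serre_forms S t" using p m by (simp add: Serre_forms_def So)
  have "is_functor (C_r R E C) (C_l R E C) S"
    unfolding is_functor_def C_r_C_l_simps So
  proof (intro conjI ballI)
    fix X assume X: "obj_r X"
    note o = left_perfectD(1,2)[OF p[OF X]]
    show "obj_l (Z X)" using p[OF X] obj_l_iff by blast
    show "on_hom S X X (Id C X) = Id C (Z X)"
      by (rule mate_right_unique[OF p[OF X] p[OF X] m[OF X X] mate_Id]) (use o Id_closed in auto)
    fix X' assume X': "obj_r X'"
    note o' = left_perfectD(1,2)[OF p[OF X']]
    show "on_hom S X X' f \<in> mor (Z X) (Z X')" if "f \<in> mor X X'" for f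
      using m[OF X X' that] by (simp add: mate_def)
    fix X'' f f' assume X'': "obj_r X''" and f: "f \<in> mor X X'" "f' \<in> mor X' X''"
    note o'' = left_perfectD(1,2)[OF p[OF X'']]
    show "on_hom S X X'' (Comp C X X' X'' f' f) =
        Comp C (Z X) (Z X') (Z X'') (on_hom S X' X'' f') (on_hom S X X' f)"
      by (rule mate_right_unique[OF p[OF X] p[OF X''] m[OF X X'']
            mate_Comp[OF o o' o'' m[OF X X' f(1)] m[OF X' X'' f(2)]]]) (use o o' o'' f in auto)
  qed
  then show ?thesis using generalized_Serre_functorI forms by blast
qed

text \<open>The comparison at \<open>X\<close> is the mate of the identity of \<open>X\<close> with
  respect to the two forms. Both sides of the naturality square at \<open>f\<close> are mates of
  \<open>f\<close>.\<close>

lemma Serre_functor_unique: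
  assumes "generalized_Serre_functor R E C S" "generalized_Serre_functor R E C S'"
  shows "functors_isomorphic (C_r R E C) (C_l R E C) S S'"
proof -
  obtain t where t: "Serre_forms S t" by (rule generalized_Serre_functorD[OF assms(1)])
  obtain t' where t': "Serre_forms S' t'" by (rule generalized_Serre_functorD[OF assms(2)])
  let ?S = "on_obj S" and ?S' = "on_obj S'"
  have p: "left_perfect X (?S X) (t X)" "left_perfect X (?S' X) (t' X)" if "obj_r X" for X
    using t t' that by (auto simp: Serre_forms_def)
  define \<eta> where "\<eta> X = (THE g. mate X (?S X) (t X) X (?S' X) (t' X) (Id C X) g)" for X
  have \<eta>: "mate X (?S X) (t X) X (?S' X) (t' X) (Id C X) (\<eta> X)" if X: "obj_r X" for X
    unfolding \<eta>_def by (rule theI'[OF mate_right_ex1[OF p[OF X] Id_closed[OF obj_r_obj[OF X]]]])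
  show ?thesis
    unfolding functors_isomorphic_def C_r_C_l_simps
  proof (intro exI[of _ \<eta>] conjI ballI)
    fix X assume X: "obj_r X"
    show "\<eta> X \<in> iso_in C (?S X) (?S' X)"
      using mate_iso_iff[OF p[OF X] \<eta>[OF X]] Id_iso[OF obj_r_obj[OF X]] by simp
    fix Y f assume Y: "obj_r Y" and f: "f \<in> mor X Y"
    note o = obj_r_obj[OF X] obj_r_obj[OF Y] and oS = left_perfectD(2)[OF p(1)] left_perfectD(2)[OF p(2)]
    have m: "mate X (?S X) (t X) Y (?S Y) (t Y) f (on_hom S X Y f)"
      and m': "mate X (?S' X) (t' X) Y (?S' Y) (t' Y) f (on_hom S' X Y f)"
      using t t' X Y f by (auto simp: Serre_forms_def)
    have "mate X (?S X) (t X) Y (?S' Y) (t' Y) f (Comp C (?S X) (?S Y) (?S' Y) (\<eta> Y) (on_hom S X Y f))"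
      using mate_Comp[OF o(1) oS(1)[OF X] o(2) oS(1)[OF Y] o(2) oS(2)[OF Y] m \<eta>[OF Y]] o f
      by (simp add: Comp_Id_left)
    moreover have "mate X (?S X) (t X) Y (?S' Y) (t' Y) f (Comp C (?S X) (?S' X) (?S' Y) (on_hom S' X Y f) (\<eta> X))"
      using mate_Comp[OF o(1) oS(1)[OF X] o(1) oS(2)[OF X] o(2) oS(2)[OF Y] \<eta>[OF X] m'] o f
      by (simp add: Comp_Id_right)
    ultimately show "Comp C (?S X) (?S Y) (?S' Y) (\<eta> Y) (on_hom S X Y f) =
        Comp C (?S X) (?S' X) (?S' Y) (on_hom S' X Y f) (\<eta> X)"
      by (rule mate_right_unique[OF p(1)[OF X] p(2)[OF Y]])
  qed
qed

text \<open>The quasi-inverse \<open>G\<close> uses forms \<open>u Z\<close> on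
  \<open>Hom(K Z, Z)\<close>, chosen for \<open>Z\<close> in \<open>C_l\<close> independently of the
  forms of \<open>S\<close>. Mates of identities between the two families are the components of both
  natural isomorphisms.\<close>

lemma Serre_functor_equivalence:
  assumes "generalized_Serre_functor R E C S"
  shows "is_linear_equivalence R (C_r R E C) (C_l R E C) S"
proof -
  obtain t where S: "is_functor (C_r R E C) (C_l R E C) S" and t: "Serre_forms S t"
    by (rule generalized_Serre_functorD[OF assms])
  let ?S = "on_obj S"
  have p: "left_perfect X (?S X) (t X)" if "obj_r X" for X
    using t that by (simp add: Serre_forms_def)
  have m: "mate X (?S X) (t X) Y (?S Y) (t Y) f (on_hom S X Y f)"
    if "obj_r X" "obj_r Y" "f \<in> mor X Y" for X Y f
    using t that by (simp add: Serre_forms_def)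
  have Sr: "obj_l (?S X)" if "obj_r X" for X using p[OF that] obj_l_iff by blast
  obtain K u where q: "\<And>Z. obj_l Z \<Longrightarrow> left_perfect (K Z) Z (u Z)"
    using obj_l_iff by metis
  define G where "G = \<lparr>on_obj = K, on_hom = (\<lambda>Z Z' g. THE f. mate (K Z) Z (u Z) (K Z') Z' (u Z') f g)\<rparr>"
  have Go: "on_obj G Z = K Z" for Z by (simp add: G_def)
  have Gl: "obj_r (K Z)" if "obj_l Z" for Z using q[OF that] obj_r_iff by blast
  have n: "mate (K Z) Z (u Z) (K Z') Z' (u Z') (on_hom G Z Z' g) g"
    if "obj_l Z" "obj_l Z'" "g \<in> mor Z Z'" for Z Z' g
    using theI'[OF mate_left_ex1[OF q q that(3)]] that by (simp add: G_def)
  \<comment> \<open>A generalized Serre functor is only required to be a functor; linearity follows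
    because mates are closed under sums and multiples and are unique.\<close>
  have S_linear: "is_linear_functor R (C_r R E C) (C_l R E C) S"
    unfolding is_linear_functor_def C_r_C_l_simps
  proof (intro conjI ballI S mod_homI)
    fix X Y assume XY: "obj_r X" "obj_r Y"
    note pX = p[OF XY(1)] and pY = p[OF XY(2)]
    note fm = left_perfectD(3)[OF pX] left_perfectD(3)[OF pY]
      and H = Hom_closed[OF left_perfectD(1)[OF pX] left_perfectD(1)[OF pY]]
    show "on_hom S X Y f \<in> mor (?S X) (?S Y)" if "f \<in> mor X Y" for f
      using m[OF XY that] by (simp add: mate_def)
    show "on_hom S X Y (f \<oplus>\<^bsub>Hom C X Y\<^esub> f') = on_hom S X Y f \<oplus>\<^bsub>Hom C (?S X) (?S Y)\<^esub> on_hom S X Y f'"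
      if "f \<in> mor X Y" "f' \<in> mor X Y" for f f'
      by (rule mate_right_unique[OF pX pY m[OF XY H(1)[OF that]]
            mate_add[OF fm m[OF XY that(1)] m[OF XY that(2)]]])
    show "on_hom S X Y (a \<odot>\<^bsub>Hom C X Y\<^esub> f) = a \<odot>\<^bsub>Hom C (?S X) (?S Y)\<^esub> on_hom S X Y f"
      if "a \<in> carrier R" "f \<in> mor X Y" for a f
      by (rule mate_right_unique[OF pX pY m[OF XY H(2)[OF that(2,1)]] mate_smult[OF fm m[OF XY that(2)] that(1)]])
  qed
  have G_functor: "is_functor (C_l R E C) (C_r R E C) G"
    unfolding is_functor_def C_r_C_l_simps Go
  proof (intro conjI ballI)
    fix X assume X: "obj_l X"
    note o = left_perfectD(1,2)[OF q[OF X]]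
    show "obj_r (K X)" by (rule Gl[OF X])
    show "on_hom G X X (Id C X) = Id C (K X)"
      by (rule mate_left_unique[OF q[OF X] q[OF X] n[OF X X Id_closed[OF o(2)]] mate_Id[OF o]])
    fix X' assume X': "obj_l X'"
    note o' = left_perfectD(1,2)[OF q[OF X']]
    show "on_hom G X X' f \<in> mor (K X) (K X')" if "f \<in> mor X X'" for f
      using n[OF X X' that] by (simp add: mate_def)
    fix X'' f f' assume X'': "obj_l X''" and f: "f \<in> mor X X'" "f' \<in> mor X' X''"
    note o'' = left_perfectD(1,2)[OF q[OF X'']]
    show "on_hom G X X'' (Comp C X X' X'' f' f) =
        Comp C (K X) (K X') (K X'') (on_hom G X' X'' f') (on_hom G X X' f)"
      by (rule mate_left_unique[OF q[OF X] q[OF X''] n[OF X X'' Comp_closed[OF o(2) o'(2) o''(2) f]]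
            mate_Comp[OF o o' o'' n[OF X X' f(1)] n[OF X' X'' f(2)]]])
  qed
  have G_linear: "is_linear_functor R (C_l R E C) (C_r R E C) G"
    unfolding is_linear_functor_def C_r_C_l_simps Go
  proof (intro conjI ballI G_functor mod_homI)
    fix X Y assume XY: "obj_l X" "obj_l Y"
    note qX = q[OF XY(1)] and qY = q[OF XY(2)]
    note fm = left_perfectD(3)[OF qX] left_perfectD(3)[OF qY]
      and H = Hom_closed[OF left_perfectD(2)[OF qX] left_perfectD(2)[OF qY]]
    show "on_hom G X Y f \<in> mor (K X) (K Y)" if "f \<in> mor X Y" for f
      using n[OF XY that] by (simp add: mate_def)
    show "on_hom G X Y (f \<oplus>\<^bsub>Hom C X Y\<^esub> f') = on_hom G X Y f \<oplus>\<^bsub>Hom C (K X) (K Y)\<^esub> on_hom G X Y f'"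
      if "f \<in> mor X Y" "f' \<in> mor X Y" for f f'
      by (rule mate_left_unique[OF qX qY n[OF XY H(1)[OF that]]
            mate_add[OF fm n[OF XY that(1)] n[OF XY that(2)]]])
    show "on_hom G X Y (a \<odot>\<^bsub>Hom C X Y\<^esub> f) = a \<odot>\<^bsub>Hom C (K X) (K Y)\<^esub> on_hom G X Y f"
      if "a \<in> carrier R" "f \<in> mor X Y" for a f
      by (rule mate_left_unique[OF qX qY n[OF XY H(2)[OF that(2,1)]] mate_smult[OF fm n[OF XY that(2)] that(1)]])
  qed
  have GS: "functors_isomorphic (C_r R E C) (C_r R E C) (comp_functor G S) id_functor"
  proof -
    \<comment> \<open>The objects \<open>K (S X)\<close> and \<open>X\<close> both carry a perfect
      form into \<open>S X\<close>; the comparison is the left mate of the identity of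
      \<open>S X\<close>.\<close>
    define \<eta> where "\<eta> X = (THE f. mate (K (?S X)) (?S X) (u (?S X)) X (?S X) (t X) f (Id C (?S X)))" for X
    have \<eta>: "mate (K (?S X)) (?S X) (u (?S X)) X (?S X) (t X) (\<eta> X) (Id C (?S X))" if X: "obj_r X" for X
      unfolding \<eta>_def
      by (rule theI'[OF mate_left_ex1[OF q[OF Sr[OF X]] p[OF X] Id_closed[OF obj_l_obj[OF Sr[OF X]]]]])
    show ?thesis
      unfolding functors_isomorphic_def C_r_C_l_simps comp_functor_def id_functor_def
        cat_functor.simps Go
    proof (intro exI[of _ \<eta>] conjI ballI)
      fix X assume X: "obj_r X"
      note pX = p[OF X] and qX = q[OF Sr[OF X]]
      note o = left_perfectD(1,2)[OF qX] left_perfectD(1,2)[OF pX]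
      show "\<eta> X \<in> iso_in C (K (?S X)) X"
        using mate_iso_iff[OF qX pX \<eta>[OF X]] Id_iso[OF o(2)] by simp
      fix Y f assume Y: "obj_r Y" and f: "f \<in> mor X Y"
      note pY = p[OF Y] and qY = q[OF Sr[OF Y]]
      note o' = left_perfectD(1,2)[OF qY] left_perfectD(1,2)[OF pY]
      let ?g = "on_hom S X Y f"
      have g: "?g \<in> mor (?S X) (?S Y)" using m[OF X Y f] by (simp add: mate_def)
      have "mate (K (?S X)) (?S X) (u (?S X)) Y (?S Y) (t Y)
          (Comp C (K (?S X)) (K (?S Y)) Y (\<eta> Y) (on_hom G (?S X) (?S Y) ?g)) ?g"
        using mate_Comp[OF o(1,2) o'(1,2) o'(3,4) n[OF Sr[OF X] Sr[OF Y] g] \<eta>[OF Y]] o o' g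
        by (simp add: Comp_Id_left)
      moreover have "mate (K (?S X)) (?S X) (u (?S X)) Y (?S Y) (t Y)
          (Comp C (K (?S X)) X Y f (\<eta> X)) ?g"
        using mate_Comp[OF o o'(3,4) \<eta>[OF X] m[OF X Y f]] o o' g by (simp add: Comp_Id_right)
      ultimately show "Comp C (K (?S X)) (K (?S Y)) Y (\<eta> Y) (on_hom G (?S X) (?S Y) ?g) =
          Comp C (K (?S X)) X Y f (\<eta> X)"
        by (rule mate_left_unique[OF qX pY])
    qed
  qed
  have SG: "functors_isomorphic (C_l R E C) (C_l R E C) (comp_functor S G) id_functor"
  proof -
    \<comment> \<open>Here \<open>S (K Z)\<close> and \<open>Z\<close> both carry a perfect form
      from \<open>K Z\<close>, so the right mate of the identity of \<open>K Z\<close> is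
      taken.\<close>
    define \<eta> where "\<eta> Z = (THE g. mate (K Z) (?S (K Z)) (t (K Z)) (K Z) Z (u Z) (Id C (K Z)) g)" for Z
    have \<eta>: "mate (K Z) (?S (K Z)) (t (K Z)) (K Z) Z (u Z) (Id C (K Z)) (\<eta> Z)" if Z: "obj_l Z" for Z
      unfolding \<eta>_def
      by (rule theI'[OF mate_right_ex1[OF p[OF Gl[OF Z]] q[OF Z] Id_closed[OF obj_r_obj[OF Gl[OF Z]]]]])
    show ?thesis
      unfolding functors_isomorphic_def C_r_C_l_simps comp_functor_def id_functor_def
        cat_functor.simps Go
    proof (intro exI[of _ \<eta>] conjI ballI)
      fix X assume X: "obj_l X"
      note qX = q[OF X] and pX = p[OF Gl[OF X]]
      note o = left_perfectD(1,2)[OF pX] left_perfectD(1,2)[OF qX]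
      show "\<eta> X \<in> iso_in C (?S (K X)) X"
        using mate_iso_iff[OF pX qX \<eta>[OF X]] Id_iso[OF o(1)] by simp
      fix Y g assume Y: "obj_l Y" and g: "g \<in> mor X Y"
      note qY = q[OF Y] and pY = p[OF Gl[OF Y]]
      note o' = left_perfectD(1,2)[OF pY] left_perfectD(1,2)[OF qY]
      let ?f = "on_hom G X Y g"
      have f: "?f \<in> mor (K X) (K Y)" using n[OF X Y g] by (simp add: mate_def)
      have "mate (K X) (?S (K X)) (t (K X)) (K Y) Y (u Y) ?f
          (Comp C (?S (K X)) (?S (K Y)) Y (\<eta> Y) (on_hom S (K X) (K Y) ?f))"
        using mate_Comp[OF o(1,2) o'(1,2) o'(3,4) m[OF Gl[OF X] Gl[OF Y] f] \<eta>[OF Y]] o o' f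
        by (simp add: Comp_Id_left)
      moreover have "mate (K X) (?S (K X)) (t (K X)) (K Y) Y (u Y) ?f
          (Comp C (?S (K X)) X Y g (\<eta> X))"
        using mate_Comp[OF o o'(3,4) \<eta>[OF X] n[OF X Y g]] o o' f by (simp add: Comp_Id_right)
      ultimately show "Comp C (?S (K X)) (?S (K Y)) Y (\<eta> Y) (on_hom S (K X) (K Y) ?f) =
          Comp C (?S (K X)) X Y g (\<eta> X)"
        by (rule mate_right_unique[OF pX qY])
    qed
  qed
  show ?thesis
    unfolding is_linear_equivalence_def using S_linear G_linear GS SG by blast
qed

end

text \<open>Surjectivity onto the bidual is \<open>Matlis_reflexive\<close>; for injectivity, a
  functional nonzero on the difference of two distinct morphisms tells them apart.\<close>

lemma Matlis_categoryI:
  assumes "artinian_cring R" "minimal_injective_cogenerator R E" "linear_category R C" "hom_finite R C"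
  shows "Matlis_category R C E"
proof -
  interpret linear_category R C by fact
  have cog: "injective_cogenerator R E"
    using assms(2) by (simp add: minimal_injective_cogenerator_def)
  interpret E: module R E
    using cog by (simp add: injective_cogenerator_def injective_module_def)
  show ?thesis
  proof unfold_locales
    fix X Y l assume XY: "X \<in> Obj C" "Y \<in> Obj C" and "l \<in> mod_hom R (Matlis_dual R E (Hom C X Y)) E"
    then show "\<exists>f\<in>carrier (Hom C X Y). \<forall>\<theta>\<in>carrier (Matlis_dual R E (Hom C X Y)). l \<theta> = \<theta> f"
      using Matlis_reflexive[OF assms(1,2), of "Hom C X Y" l] assms(4) by (simp add: hom_finite_def)
  next
    fix X Y f f' assume XY: "X \<in> Obj C" "Y \<in> Obj C"
      and f: "f \<in> carrier (Hom C X Y)" "f' \<in> carrier (Hom C X Y)"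
      and eq: "\<And>\<theta>. \<theta> \<in> carrier (Matlis_dual R E (Hom C X Y)) \<Longrightarrow> \<theta> f = \<theta> f'"
    interpret H: module R "Hom C X Y" by (rule Hom_module[OF XY])
    let ?d = "f \<ominus>\<^bsub>Hom C X Y\<^esub> f'"
    show "f = f'"
    proof (rule ccontr)
      assume "f \<noteq> f'"
      then have "?d \<in> carrier (Hom C X Y)" "?d \<noteq> \<zero>\<^bsub>Hom C X Y\<^esub>"
        using f by (simp_all add: H.M.minus_eq_zero_iff)
      then obtain \<theta> where \<theta>: "\<theta> \<in> mod_hom R (Hom C X Y) E" "\<theta> ?d \<noteq> \<zero>\<^bsub>E\<^esub>"
        using injective_cogenerator_separate[OF cog H.module_axioms] by blast
      have "\<theta> f = \<theta> f'"
        using eq[OF restrict_Matlis_dual[OF H.module_axioms \<theta>(1)]] f by simp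
      moreover have "\<theta> f = \<theta> ?d \<oplus>\<^bsub>E\<^esub> \<theta> f'"
      proof -
        have "f = ?d \<oplus>\<^bsub>Hom C X Y\<^esub> f'" using f by (simp add: H.M.minus_eq H.M.a_assoc H.M.l_neg)
        then show ?thesis using mod_homD(2)[OF \<theta>(1), of ?d f'] f by simp
      qed
      ultimately have "\<theta> ?d = \<zero>\<^bsub>E\<^esub>"
        using mod_homD(1)[OF \<theta>(1)] f by (metis E.M.add.r_cancel_one H.M.minus_closed)
      then show False using \<theta>(2) by simp
    qed
  qed
qed

theorem propositionA1:
  fixes R :: "('r, 'x) ring_scheme"
    and E :: "('r, 'e, 'y) module_scheme"
    and C :: "('o, 'a, 'r) lin_cat"
  assumes "artinian_cring R"
    and "minimal_injective_cogenerator R E"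
    and "linear_category R C"
    and "hom_finite R C"
  shows "(\<exists>S. generalized_Serre_functor R E C S) \<and>
    (\<forall>S S'. generalized_Serre_functor R E C S \<and> generalized_Serre_functor R E C S'
      \<longrightarrow> functors_isomorphic (C_r R E C) (C_l R E C) S S') \<and>
    (\<forall>S. generalized_Serre_functor R E C S
      \<longrightarrow> is_linear_equivalence R (C_r R E C) (C_l R E C) S)"
proof -
  interpret Matlis_category R C E by (rule Matlis_categoryI[OF assms])
  show ?thesis
    using exists_Serre_functor Serre_functor_unique Serre_functor_equivalence by blast
qed

end
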